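(* Let $B$ be a definite quaternion algebra over $\mathbb{Q}$, $R$ an order in $B$, $K$ a quadratic field with a fixed embedding $i:K\hookrightarrow B$, and $O$ an order in $K$ of discriminant $D$. Then the classes of special points for $O$ are in one-to-one correspondence with the $O$-points.
   Context: A left $R$-ideal is a lattice $\mathfrak{a}\subset B$ with $\mathfrak{a}_\ell=R_\ell x_\ell$, $x_\ell\in B_\ell^\times$, for every prime $\ell$; its right order is $R_r(\mathfrak{a})=\{x\in B:\mathfrak{a}x\subseteq\mathfrak{a}\}$. A special point for $O$ is a pair $(\mathfrak{a},\psi)$ where $\mathfrak{a}$ is a left $R$-ideal and $\psi:K\hookrightarrow B$ is an embedding with $R_r(\mathfrak{a})\cap\psi(K)=\psi(O)$. The group $B^\times$ acts on the right on special points by $(\mathfrak{a},\psi)\cdot\alpha=(\mathfrak{a}\alpha,\alpha^{-1}\psi\alpha)$; the classes of special points are the orbits. Let $\widehat{\mathbb{Z}}=\prod_\ell\mathbb{Z}_\ell$, $\widehat{\mathbb{Q}}=\widehat{\mathbb{Z}}\otimes\mathbb{Q}$, $\widehat{B}=B\otimes\widehat{\mathbb{Q}}$, $\widehat{R}=R\otimes\widehat{\mathbb{Z}}$. Identify $K$ with $i(K)\subset B$. For $x\in\widehat{B}^\times$ put $O_x=K\cap x^{-1}\widehat{R}x$, an order in $K$, and let $\widehat{N}_O=\{x\in\widehat{B}^\times:O_x=O\}$. The $O$-points are the elements of the double quotient $\widehat{R}^\times\backslash\widehat{N}_O/K^\times$. *)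

theory Defs
  imports
    Complex_Main
    "HOL-Algebra.Embedded_Algebras"
    "HOL-Algebra.QuotRing"
    "HOL-Algebra.Free_Abelian_Groups"
    "HOL-Number_Theory.Residues"
begin

section \<open>Rings of numbers\<close>

definition rat_ring :: "rat ring" where
  "rat_ring = \<lparr>carrier = UNIV, monoid.mult = (*), monoid.one = 1, ring.zero = 0, ring.add = (+)\<rparr>"

definition real_ring :: "real ring" where
  "real_ring = \<lparr>carrier = UNIV, monoid.mult = (*), monoid.one = 1, ring.zero = 0, ring.add = (+)\<rparr>"

text \<open>The ring of l-adic integers is the inverse limit of the rings Z/l^n with n \<ge> 1. The component
  with index n of a sequence lives modulo l^(n+1), since \<^const>\<open>residue_ring\<close> is a ring only for a
  modulus greater than 1.\<close>

definition padic_int :: "nat \<Rightarrow> (nat \<Rightarrow> int) ring" where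
  "padic_int l =
     \<lparr>carrier = {f. \<forall>n. f n \<in> carrier (residue_ring (int l ^ Suc n))
                       \<and> f (Suc n) mod int l ^ Suc n = f n},
      monoid.mult = (\<lambda>f g n. f n \<otimes>\<^bsub>residue_ring (int l ^ Suc n)\<^esub> g n),
      monoid.one = (\<lambda>n. \<one>\<^bsub>residue_ring (int l ^ Suc n)\<^esub>),
      ring.zero = (\<lambda>n. \<zero>\<^bsub>residue_ring (int l ^ Suc n)\<^esub>),
      ring.add = (\<lambda>f g n. f n \<oplus>\<^bsub>residue_ring (int l ^ Suc n)\<^esub> g n)\<rparr>"

definition product_ring :: "'i set \<Rightarrow> ('i \<Rightarrow> ('a, 'm) ring_scheme) \<Rightarrow> ('i \<Rightarrow> 'a) ring" where
  "product_ring I A =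
     \<lparr>carrier = (\<Pi>\<^sub>E i\<in>I. carrier (A i)),
      monoid.mult = (\<lambda>f g. \<lambda>i\<in>I. f i \<otimes>\<^bsub>A i\<^esub> g i),
      monoid.one = (\<lambda>i\<in>I. \<one>\<^bsub>A i\<^esub>),
      ring.zero = (\<lambda>i\<in>I. \<zero>\<^bsub>A i\<^esub>),
      ring.add = (\<lambda>f g. \<lambda>i\<in>I. f i \<oplus>\<^bsub>A i\<^esub> g i)\<rparr>"

definition zhat :: "(nat \<Rightarrow> nat \<Rightarrow> int) ring" where
  "zhat = product_ring {l. prime l} padic_int"


section \<open>Tensor products of rings\<close>

text \<open>The tensor product over Z of two (not necessarily commutative) rings: the integral monoid ring
  of the multiplicative monoid of A \<times> B, modulo the ideal generated by the biadditivity relations.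
  Every additive map between rational vector spaces is Q-linear, so when A and B are Q-algebras
  this is also their tensor product over Q.\<close>

definition pair_ring ::
    "('a, 'm) ring_scheme \<Rightarrow> ('b, 'n) ring_scheme \<Rightarrow> (('a \<times> 'b) \<Rightarrow>\<^sub>0 int) ring" where
  "pair_ring A B =
     \<lparr>carrier = carrier (free_Abelian_group (carrier A \<times> carrier B)),
      monoid.mult = (\<lambda>u v. frag_extend (\<lambda>p. frag_extend (\<lambda>q.
                frag_of (fst p \<otimes>\<^bsub>A\<^esub> fst q, snd p \<otimes>\<^bsub>B\<^esub> snd q)) v) u),
      monoid.one = frag_of (\<one>\<^bsub>A\<^esub>, \<one>\<^bsub>B\<^esub>),
      ring.zero = 0,
      ring.add = (+)\<rparr>"

definition tensor_relations ::
    "('a, 'm) ring_scheme \<Rightarrow> ('b, 'n) ring_scheme \<Rightarrow> (('a \<times> 'b) \<Rightarrow>\<^sub>0 int) set" where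
  "tensor_relations A B =
     {frag_of (a \<oplus>\<^bsub>A\<^esub> a', b) - frag_of (a, b) - frag_of (a', b) | a a' b.
        a \<in> carrier A \<and> a' \<in> carrier A \<and> b \<in> carrier B} \<union>
     {frag_of (a, b \<oplus>\<^bsub>B\<^esub> b') - frag_of (a, b) - frag_of (a, b') | a b b'.
        a \<in> carrier A \<and> b \<in> carrier B \<and> b' \<in> carrier B}"

definition tensor_ring ::
    "('a, 'm) ring_scheme \<Rightarrow> ('b, 'n) ring_scheme \<Rightarrow> (('a \<times> 'b) \<Rightarrow>\<^sub>0 int) set ring" where
  "tensor_ring A B = pair_ring A B Quot (Idl\<^bsub>pair_ring A B\<^esub> (tensor_relations A B))"

definition pure_tensor ::
    "('a, 'm) ring_scheme \<Rightarrow> ('b, 'n) ring_scheme \<Rightarrow> 'a \<Rightarrow> 'b \<Rightarrow> (('a \<times> 'b) \<Rightarrow>\<^sub>0 int) set" where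
  "pure_tensor A B a b =
     (Idl\<^bsub>pair_ring A B\<^esub> (tensor_relations A B)) +>\<^bsub>pair_ring A B\<^esub> frag_of (a, b)"


section \<open>Algebras over Q, lattices and orders\<close>

text \<open>A ring carries at most one structure of Q-algebra, so no structure map is recorded.\<close>

definition rat_in :: "('a, 'm) ring_scheme \<Rightarrow> rat \<Rightarrow> 'a" where
  "rat_in A q = [fst (quotient_of q)] \<cdot>\<^bsub>A\<^esub> \<one>\<^bsub>A\<^esub> \<otimes>\<^bsub>A\<^esub> inv\<^bsub>A\<^esub> ([snd (quotient_of q)] \<cdot>\<^bsub>A\<^esub> \<one>\<^bsub>A\<^esub>)"

definition rats_of :: "('a, 'm) ring_scheme \<Rightarrow> 'a set" where
  "rats_of A = range (rat_in A)"

definition rat_algebra :: "('a, 'm) ring_scheme \<Rightarrow> bool" where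
  "rat_algebra A \<longleftrightarrow> ring A \<and> rat_in A \<in> ring_hom rat_ring A"

definition is_rat_basis :: "('a, 'm) ring_scheme \<Rightarrow> 'a list \<Rightarrow> bool" where
  "is_rat_basis A vs \<longleftrightarrow>
     ring.independent A (rats_of A) vs \<and> ring.Span A (rats_of A) vs = carrier A"

definition quaternion_algebra :: "('a, 'm) ring_scheme \<Rightarrow> bool" where
  "quaternion_algebra B \<longleftrightarrow> rat_algebra B \<and>
     (\<exists>a b. a \<noteq> 0 \<and> b \<noteq> 0 \<and> (\<exists>u\<in>carrier B. \<exists>v\<in>carrier B.
        u \<otimes>\<^bsub>B\<^esub> u = rat_in B a \<and> v \<otimes>\<^bsub>B\<^esub> v = rat_in B b \<and> v \<otimes>\<^bsub>B\<^esub> u = \<ominus>\<^bsub>B\<^esub> (u \<otimes>\<^bsub>B\<^esub> v) \<and>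
        is_rat_basis B [\<one>\<^bsub>B\<^esub>, u, v, u \<otimes>\<^bsub>B\<^esub> v]))"

text \<open>Definite means ramified at infinity: the tensor product with the reals is a division ring.\<close>

definition definite_quaternion_algebra :: "('a, 'm) ring_scheme \<Rightarrow> bool" where
  "definite_quaternion_algebra B \<longleftrightarrow> quaternion_algebra B \<and>
     Units (tensor_ring B real_ring) =
       carrier (tensor_ring B real_ring) - {\<zero>\<^bsub>tensor_ring B real_ring\<^esub>}"

definition quadratic_field :: "('a, 'm) ring_scheme \<Rightarrow> bool" where
  "quadratic_field K \<longleftrightarrow> field K \<and> rat_algebra K \<and> ring.dimension K 2 (rats_of K) (carrier K)"

definition is_lattice :: "('a, 'm) ring_scheme \<Rightarrow> 'a set \<Rightarrow> bool" where
  "is_lattice A L \<longleftrightarrow> (\<exists>vs. set vs \<subseteq> carrier A \<and> L = generate (add_monoid A) (set vs) \<and>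
     ring.Span A (rats_of A) vs = carrier A)"

definition is_order :: "('a, 'm) ring_scheme \<Rightarrow> 'a set \<Rightarrow> bool" where
  "is_order A R \<longleftrightarrow> is_lattice A R \<and> subring R A"

definition has_trace :: "('a, 'm) ring_scheme \<Rightarrow> 'a \<Rightarrow> rat \<Rightarrow> bool" where
  "has_trace K x t \<longleftrightarrow> (\<exists>u v a b c d. is_rat_basis K [u, v] \<and>
     x \<otimes>\<^bsub>K\<^esub> u = rat_in K a \<otimes>\<^bsub>K\<^esub> u \<oplus>\<^bsub>K\<^esub> rat_in K b \<otimes>\<^bsub>K\<^esub> v \<and>
     x \<otimes>\<^bsub>K\<^esub> v = rat_in K c \<otimes>\<^bsub>K\<^esub> u \<oplus>\<^bsub>K\<^esub> rat_in K d \<otimes>\<^bsub>K\<^esub> v \<and>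
     t = a + d)"

text \<open>The determinant of the trace form on a Z-basis of an order in a quadratic field.\<close>

definition has_discriminant :: "('a, 'm) ring_scheme \<Rightarrow> 'a set \<Rightarrow> int \<Rightarrow> bool" where
  "has_discriminant K S D \<longleftrightarrow> (\<exists>u v r s t. is_rat_basis K [u, v] \<and>
     S = generate (add_monoid K) {u, v} \<and>
     has_trace K (u \<otimes>\<^bsub>K\<^esub> u) r \<and> has_trace K (u \<otimes>\<^bsub>K\<^esub> v) s \<and> has_trace K (v \<otimes>\<^bsub>K\<^esub> v) t \<and>
     of_int D = r * t - s * s)"

definition ring_embeddings ::
    "('a, 'm) ring_scheme \<Rightarrow> ('b, 'n) ring_scheme \<Rightarrow> ('a \<Rightarrow> 'b) set" where
  "ring_embeddings K B = {f \<in> ring_hom K B. inj_on f (carrier K)}"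


section \<open>Extension of scalars\<close>

text \<open>For Z = \<^term>\<open>padic_int l\<close> and Z = \<^term>\<open>zhat\<close> the tensor product of Z with Q is the field of
  l-adic numbers and the ring of finite adeles, and \<open>scalar_ext Z B\<close> is the
  localisation of B at l and the adelic algebra of B. As Z is flat over the integers,
  \<open>lattice_ext Z B L\<close>, the image of the tensor product of L with Z, is isomorphic to that
  tensor product.\<close>

definition scalar_ext where
  "scalar_ext Z B = tensor_ring B (tensor_ring Z rat_ring)"

definition scalar_ext_embed where
  "scalar_ext_embed Z B x =
     pure_tensor B (tensor_ring Z rat_ring) x \<one>\<^bsub>tensor_ring Z rat_ring\<^esub>"

definition lattice_ext where
  "lattice_ext Z B L = generate (add_monoid (scalar_ext Z B))
     {pure_tensor B (tensor_ring Z rat_ring) x (pure_tensor Z rat_ring z 1) | x z.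
        x \<in> L \<and> z \<in> carrier Z}"


section \<open>Special points\<close>

definition left_ideal_of :: "('a, 'm) ring_scheme \<Rightarrow> 'a set \<Rightarrow> 'a set \<Rightarrow> bool" where
  "left_ideal_of B R I \<longleftrightarrow> is_lattice B I \<and>
     (\<forall>l. prime l \<longrightarrow> (\<exists>x\<in>Units (scalar_ext (padic_int l) B).
        lattice_ext (padic_int l) B I =
          lattice_ext (padic_int l) B R #>\<^bsub>scalar_ext (padic_int l) B\<^esub> x))"

definition right_order :: "('a, 'm) ring_scheme \<Rightarrow> 'a set \<Rightarrow> 'a set" where
  "right_order B I = {x \<in> carrier B. I #>\<^bsub>B\<^esub> x \<subseteq> I}"

text \<open>Embeddings are required to be extensional, so that each is represented by a single HOL
  function; otherwise the set of orbits would depend on values outside the carrier of K.\<close>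

definition special_points ::
    "('b, 'm) ring_scheme \<Rightarrow> 'b set \<Rightarrow> ('k, 'n) ring_scheme \<Rightarrow> 'k set \<Rightarrow> ('b set \<times> ('k \<Rightarrow> 'b)) set" where
  "special_points B R K S =
     {(I, \<psi>). left_ideal_of B R I \<and> \<psi> \<in> ring_embeddings K B \<inter> extensional (carrier K) \<and>
        right_order B I \<inter> \<psi> ` carrier K = \<psi> ` S}"

definition point_act ::
    "('b, 'm) ring_scheme \<Rightarrow> ('k, 'n) ring_scheme \<Rightarrow> 'b set \<times> ('k \<Rightarrow> 'b) \<Rightarrow> 'b \<Rightarrow> 'b set \<times> ('k \<Rightarrow> 'b)" where
  "point_act B K p \<alpha> =
     (fst p #>\<^bsub>B\<^esub> \<alpha>, \<lambda>k\<in>carrier K. inv\<^bsub>B\<^esub> \<alpha> \<otimes>\<^bsub>B\<^esub> snd p k \<otimes>\<^bsub>B\<^esub> \<alpha>)"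

definition special_point_classes ::
    "('b, 'm) ring_scheme \<Rightarrow> 'b set \<Rightarrow> ('k, 'n) ring_scheme \<Rightarrow> 'k set \<Rightarrow>
       ('b set \<times> ('k \<Rightarrow> 'b)) set set" where
  "special_point_classes B R K S = (\<lambda>p. point_act B K p ` Units B) ` special_points B R K S"


section \<open>O-points\<close>

abbreviation "adelic B \<equiv> scalar_ext zhat B"

text \<open>The order of K cut out by an adelic unit x, with K identified with its image under i.\<close>

definition adelic_order where
  "adelic_order B R K i x = {k \<in> carrier K. scalar_ext_embed zhat B (i k) \<in>
     (\<lambda>r. inv\<^bsub>adelic B\<^esub> x \<otimes>\<^bsub>adelic B\<^esub> r \<otimes>\<^bsub>adelic B\<^esub> x) ` lattice_ext zhat B R}"

definition adelic_units_with_order where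
  "adelic_units_with_order B R K i S = {x \<in> Units (adelic B). adelic_order B R K i x = S}"

definition order_points where
  "order_points B R K i S =
     (\<lambda>x. {u \<otimes>\<^bsub>adelic B\<^esub> x \<otimes>\<^bsub>adelic B\<^esub> scalar_ext_embed zhat B (i k) | u k.
             u \<in> Units (adelic B \<lparr>carrier := lattice_ext zhat B R\<rparr>) \<and> k \<in> Units K})
     ` adelic_units_with_order B R K i S"

end

theory Submission
  imports Defs
begin

text \<open>A left R-ideal I is encoded by an idele x such that the profinite completion of I is the completion
  of R times x. Local generators exist by definition and can be taken to be 1 at almost all primes,
  so they glue to x; conversely I is the intersection of B with the completion of R times x. In these
  terms right multiplication of I by \<open>\<alpha>\<close> turns x into \<open>x \<alpha>\<close>, the right order of I is the intersection
  of B with the x-conjugate of the completion of R, and x is unique up to a unit of that completion.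
  By Skolem-Noether every class of special points contains a point of the form \<open>(I, i)\<close>, and the
  elements of B that fix i form the centraliser of \<open>i K\<close>, which is \<open>i K\<close> itself. The bijection
  sends a class to the set of all ideles attached to the ideals I with \<open>(I, i)\<close> in the class.

  Lattices are completed without choosing bases of them: if L0 is the span of a rational basis of B
  and L contains N L0, then the completion of L is L plus N times the completion of L0, because the
  profinite integers are \<open>\<int> + N\<close> times themselves.\<close>

section \<open>Tensor products of rings\<close>

text \<open>The tensor products are quotients of huge free groups, where nothing can be read off
  from representatives: maps out of them come from the universal property, and equalities are
  detected by such maps. Only the injectivity of a torsion-free ring Z into its tensor product with
  the rationals needs a direct argument; in the extension of B everything is reduced to it by
  coordinates along a rational basis. Completions are studied for any torsion-free Z with Z =
  integers + k Z for all k > 0, so that one development serves the l-adic and the profinite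
  integers, which are compared by the ring homomorphisms \<open>proj l\<close>. Two difficulties
  shape the passage from local to global. A family of local elements comes from an adelic element
  only if it has a common denominator, and gluing gives elements, not units, so inverses have to be
  glued as well. Membership of an element of B in a lattice has to be tested prime by prime, by
  multipliers prime to l. Definiteness makes every nonzero element of B invertible; this turns an
  intertwiner of two embeddings of K into a conjugating unit.\<close>

lemma pair_ring_simps:
  "u \<in> carrier (pair_ring A B) \<longleftrightarrow> Poly_Mapping.keys u \<subseteq> carrier A \<times> carrier B"
  "\<zero>\<^bsub>pair_ring A B\<^esub> = 0" "u \<oplus>\<^bsub>pair_ring A B\<^esub> v = u + v"
  "\<one>\<^bsub>pair_ring A B\<^esub> = frag_of (\<one>\<^bsub>A\<^esub>, \<one>\<^bsub>B\<^esub>)"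
  by (simp_all add: pair_ring_def)

lemma pair_ring_mult:
  "frag_of p \<otimes>\<^bsub>pair_ring A B\<^esub> frag_of q = frag_of (fst p \<otimes>\<^bsub>A\<^esub> fst q, snd p \<otimes>\<^bsub>B\<^esub> snd q)"
  "(u - u') \<otimes>\<^bsub>pair_ring A B\<^esub> v = u \<otimes>\<^bsub>pair_ring A B\<^esub> v - u' \<otimes>\<^bsub>pair_ring A B\<^esub> v"
  "u \<otimes>\<^bsub>pair_ring A B\<^esub> (v - v') = u \<otimes>\<^bsub>pair_ring A B\<^esub> v - u \<otimes>\<^bsub>pair_ring A B\<^esub> v'"
  "(u + u') \<otimes>\<^bsub>pair_ring A B\<^esub> v = u \<otimes>\<^bsub>pair_ring A B\<^esub> v + u' \<otimes>\<^bsub>pair_ring A B\<^esub> v"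
  "u \<otimes>\<^bsub>pair_ring A B\<^esub> (v + v') = u \<otimes>\<^bsub>pair_ring A B\<^esub> v + u \<otimes>\<^bsub>pair_ring A B\<^esub> v'"
  "0 \<otimes>\<^bsub>pair_ring A B\<^esub> v = 0" "u \<otimes>\<^bsub>pair_ring A B\<^esub> 0 = 0"
proof -
  \<comment> \<open>The right factor enters through the function that is extended, so linearity in
    it needs \<open>frag_extend\<close> to be additive in its function argument.\<close>
  have *: "frag_extend (\<lambda>p. f p - g p) u = frag_extend f u - frag_extend g u"
    "frag_extend (\<lambda>p. f p + g p) u = frag_extend f u + frag_extend g u"
    for f g :: "'e \<Rightarrow> 'f \<Rightarrow>\<^sub>0 int" and u
    by (rule free_Abelian_group_induct[where S = UNIV and x = u]; simp add: frag_extend_diff)+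
  show "(u - u') \<otimes>\<^bsub>pair_ring A B\<^esub> v = u \<otimes>\<^bsub>pair_ring A B\<^esub> v - u' \<otimes>\<^bsub>pair_ring A B\<^esub> v"
    "u \<otimes>\<^bsub>pair_ring A B\<^esub> (v - v') = u \<otimes>\<^bsub>pair_ring A B\<^esub> v - u \<otimes>\<^bsub>pair_ring A B\<^esub> v'"
    "(u + u') \<otimes>\<^bsub>pair_ring A B\<^esub> v = u \<otimes>\<^bsub>pair_ring A B\<^esub> v + u' \<otimes>\<^bsub>pair_ring A B\<^esub> v"
    "u \<otimes>\<^bsub>pair_ring A B\<^esub> (v + v') = u \<otimes>\<^bsub>pair_ring A B\<^esub> v + u \<otimes>\<^bsub>pair_ring A B\<^esub> v'"
    by (simp_all add: pair_ring_def frag_extend_diff frag_extend_add *)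
qed (auto simp: pair_ring_def intro: frag_extend_eq_0)

text \<open>Turns the shape of a biadditivity relation that has become 0 in the quotient into
  additivity of pure tensors.\<close>

lemma (in ring) minus_minus_eq_zero:
  assumes "x \<in> carrier R" "y \<in> carrier R" "z \<in> carrier R" "x \<ominus> y \<ominus> z = \<zero>"
  shows "x = y \<oplus> z"
proof -
  have "x = (x \<ominus> y \<ominus> z) \<oplus> (y \<oplus> z)"
    using assms(1-3) by algebra
  then show ?thesis using assms by simp
qed

locale ring_pair = A: ring A + B: ring B
  for A :: "('a, 'm) ring_scheme" and B :: "('b, 'n) ring_scheme"
begin

text \<open>The ring laws are multilinear, so this rule reduces them to generators, where they are
  the laws of A and B in each coordinate.\<close>

lemma pair_induct [consumes 1, case_names zero diff gen]:
  assumes "u \<in> carrier (pair_ring A B)" "P 0"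
    "\<And>u v. \<lbrakk>u \<in> carrier (pair_ring A B); v \<in> carrier (pair_ring A B); P u; P v\<rbrakk> \<Longrightarrow> P (u - v)"
    "\<And>a b. \<lbrakk>a \<in> carrier A; b \<in> carrier B\<rbrakk> \<Longrightarrow> P (frag_of (a, b))"
  shows "P u"
  using assms(1) unfolding pair_ring_simps
  by (rule free_Abelian_group_induct) (use assms(2-) in \<open>auto simp: pair_ring_simps\<close>)

lemma frag_of_closed: "frag_of (a, b) \<in> carrier (pair_ring A B) \<longleftrightarrow> a \<in> carrier A \<and> b \<in> carrier B"
  by (simp add: pair_ring_simps)

lemma pair_diff_closed:
  "\<lbrakk>u \<in> carrier (pair_ring A B); v \<in> carrier (pair_ring A B)\<rbrakk> \<Longrightarrow> u - v \<in> carrier (pair_ring A B)"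
  unfolding pair_ring_simps using keys_diff[of u v] by blast

lemma pair_zero_closed: "0 \<in> carrier (pair_ring A B)"
  by (simp add: pair_ring_simps)

lemma pair_mult_closed:
  assumes "u \<in> carrier (pair_ring A B)" "v \<in> carrier (pair_ring A B)"
  shows "u \<otimes>\<^bsub>pair_ring A B\<^esub> v \<in> carrier (pair_ring A B)"
  using assms(1)
proof (induction u rule: pair_induct)
  case (gen a b)
  from assms(2) show ?case
    by (induction v rule: pair_induct)
       (use gen in \<open>auto simp: pair_ring_mult frag_of_closed pair_diff_closed pair_zero_closed\<close>)
qed (auto simp: pair_ring_mult pair_diff_closed pair_zero_closed)

lemma pair_assoc:
  assumes "u \<in> carrier (pair_ring A B)" "v \<in> carrier (pair_ring A B)" "w \<in> carrier (pair_ring A B)"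
  shows "u \<otimes>\<^bsub>pair_ring A B\<^esub> v \<otimes>\<^bsub>pair_ring A B\<^esub> w = u \<otimes>\<^bsub>pair_ring A B\<^esub> (v \<otimes>\<^bsub>pair_ring A B\<^esub> w)"
  using assms(1)
proof (induction u rule: pair_induct)
  case (gen a b)
  from assms(2) show ?case
  proof (induction v rule: pair_induct)
    case (gen a' b')
    from assms(3) show ?case
      by (induction w rule: pair_induct)
         (use gen \<open>a \<in> _\<close> \<open>b \<in> _\<close> in \<open>auto simp: pair_ring_mult A.m_assoc B.m_assoc\<close>)
  qed (auto simp: pair_ring_mult)
qed (auto simp: pair_ring_mult)

lemma pair_one:
  assumes "u \<in> carrier (pair_ring A B)"
  shows "\<one>\<^bsub>pair_ring A B\<^esub> \<otimes>\<^bsub>pair_ring A B\<^esub> u = u" "u \<otimes>\<^bsub>pair_ring A B\<^esub> \<one>\<^bsub>pair_ring A B\<^esub> = u"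
  using assms by (induction u rule: pair_induct) (auto simp: pair_ring_mult pair_ring_simps)

sublocale P: ring "pair_ring A B"
proof (rule ringI)
  show "abelian_group (pair_ring A B)"
  proof (rule abelian_groupI)
    fix x assume x: "x \<in> carrier (pair_ring A B)"
    then have "0 - x \<in> carrier (pair_ring A B)"
      by (intro pair_diff_closed) (auto simp: pair_ring_simps)
    then show "\<exists>y\<in>carrier (pair_ring A B). y \<oplus>\<^bsub>pair_ring A B\<^esub> x = \<zero>\<^bsub>pair_ring A B\<^esub>"
      by (auto simp: pair_ring_simps intro!: bexI[of _ "0 - x"])
  next
    fix x y assume "x \<in> carrier (pair_ring A B)" "y \<in> carrier (pair_ring A B)"
    then show "x \<oplus>\<^bsub>pair_ring A B\<^esub> y \<in> carrier (pair_ring A B)"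
      using keys_add[of x y] unfolding pair_ring_simps by blast
  qed (simp_all add: pair_ring_simps add_ac)
  show "monoid (pair_ring A B)"
    by (rule monoidI) (auto simp: pair_mult_closed pair_assoc pair_one, auto simp: pair_ring_simps)
qed (auto simp: pair_ring_simps pair_ring_mult)

lemma pair_minus: "u \<in> carrier (pair_ring A B) \<Longrightarrow> \<ominus>\<^bsub>pair_ring A B\<^esub> u = - u"
  by (rule P.minus_equality) (auto simp: pair_ring_simps)

lemma relations_closed: "tensor_relations A B \<subseteq> carrier (pair_ring A B)"
  unfolding tensor_relations_def by (auto intro!: pair_diff_closed simp: frag_of_closed)

sublocale I: ideal "Idl\<^bsub>pair_ring A B\<^esub> (tensor_relations A B)" "pair_ring A B"
  by (rule P.genideal_ideal[OF relations_closed])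

text \<open>Distributivity in A and in B carries a biadditivity relation, multiplied by a generator
  on either side, to another biadditivity relation.\<close>

lemma relation_mult:
  assumes rel: "r \<in> tensor_relations A B" and p: "a \<in> carrier A" "b \<in> carrier B"
  shows "frag_of (a, b) \<otimes>\<^bsub>pair_ring A B\<^esub> r \<in> tensor_relations A B"
    "r \<otimes>\<^bsub>pair_ring A B\<^esub> frag_of (a, b) \<in> tensor_relations A B"
proof -
  consider (l) x y c where "r = frag_of (x \<oplus>\<^bsub>A\<^esub> y, c) - frag_of (x, c) - frag_of (y, c)"
      "x \<in> carrier A" "y \<in> carrier A" "c \<in> carrier B"
    | (r) c x y where "r = frag_of (c, x \<oplus>\<^bsub>B\<^esub> y) - frag_of (c, x) - frag_of (c, y)"
      "x \<in> carrier B" "y \<in> carrier B" "c \<in> carrier A"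
    using rel unfolding tensor_relations_def by blast
  then have "frag_of (a, b) \<otimes>\<^bsub>pair_ring A B\<^esub> r \<in> tensor_relations A B \<and>
    r \<otimes>\<^bsub>pair_ring A B\<^esub> frag_of (a, b) \<in> tensor_relations A B"
  proof cases
    case l
    show ?thesis
    proof
      have "frag_of (a, b) \<otimes>\<^bsub>pair_ring A B\<^esub> r = frag_of (a \<otimes>\<^bsub>A\<^esub> x \<oplus>\<^bsub>A\<^esub> a \<otimes>\<^bsub>A\<^esub> y, b \<otimes>\<^bsub>B\<^esub> c)
          - frag_of (a \<otimes>\<^bsub>A\<^esub> x, b \<otimes>\<^bsub>B\<^esub> c) - frag_of (a \<otimes>\<^bsub>A\<^esub> y, b \<otimes>\<^bsub>B\<^esub> c)"
        using l p by (simp add: pair_ring_mult A.r_distr)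
      then show "frag_of (a, b) \<otimes>\<^bsub>pair_ring A B\<^esub> r \<in> tensor_relations A B"
        unfolding tensor_relations_def using l p by blast
      have "r \<otimes>\<^bsub>pair_ring A B\<^esub> frag_of (a, b) = frag_of (x \<otimes>\<^bsub>A\<^esub> a \<oplus>\<^bsub>A\<^esub> y \<otimes>\<^bsub>A\<^esub> a, c \<otimes>\<^bsub>B\<^esub> b)
          - frag_of (x \<otimes>\<^bsub>A\<^esub> a, c \<otimes>\<^bsub>B\<^esub> b) - frag_of (y \<otimes>\<^bsub>A\<^esub> a, c \<otimes>\<^bsub>B\<^esub> b)"
        using l p by (simp add: pair_ring_mult A.l_distr)
      then show "r \<otimes>\<^bsub>pair_ring A B\<^esub> frag_of (a, b) \<in> tensor_relations A B"
        unfolding tensor_relations_def using l p by blast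
    qed
  next
    case r
    show ?thesis
    proof
      have "frag_of (a, b) \<otimes>\<^bsub>pair_ring A B\<^esub> r = frag_of (a \<otimes>\<^bsub>A\<^esub> c, b \<otimes>\<^bsub>B\<^esub> x \<oplus>\<^bsub>B\<^esub> b \<otimes>\<^bsub>B\<^esub> y)
          - frag_of (a \<otimes>\<^bsub>A\<^esub> c, b \<otimes>\<^bsub>B\<^esub> x) - frag_of (a \<otimes>\<^bsub>A\<^esub> c, b \<otimes>\<^bsub>B\<^esub> y)"
        using r p by (simp add: pair_ring_mult B.r_distr)
      then show "frag_of (a, b) \<otimes>\<^bsub>pair_ring A B\<^esub> r \<in> tensor_relations A B"
        unfolding tensor_relations_def using r p by blast
      have "r \<otimes>\<^bsub>pair_ring A B\<^esub> frag_of (a, b) = frag_of (c \<otimes>\<^bsub>A\<^esub> a, x \<otimes>\<^bsub>B\<^esub> b \<oplus>\<^bsub>B\<^esub> y \<otimes>\<^bsub>B\<^esub> b)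
          - frag_of (c \<otimes>\<^bsub>A\<^esub> a, x \<otimes>\<^bsub>B\<^esub> b) - frag_of (c \<otimes>\<^bsub>A\<^esub> a, y \<otimes>\<^bsub>B\<^esub> b)"
        using r p by (simp add: pair_ring_mult B.l_distr)
      then show "r \<otimes>\<^bsub>pair_ring A B\<^esub> frag_of (a, b) \<in> tensor_relations A B"
        unfolding tensor_relations_def using r p by blast
    qed
  qed
  then show "frag_of (a, b) \<otimes>\<^bsub>pair_ring A B\<^esub> r \<in> tensor_relations A B"
    "r \<otimes>\<^bsub>pair_ring A B\<^esub> frag_of (a, b) \<in> tensor_relations A B" by auto
qed

text \<open>The relations are stable under multiplication by generators, so the ideal which they generate
  is just the additive subgroup which they generate.\<close>

lemma tensor_ideal_subset:
  assumes S: "tensor_relations A B \<subseteq> S" "0 \<in> S" "\<And>u v. \<lbrakk>u \<in> S; v \<in> S\<rbrakk> \<Longrightarrow> u - v \<in> S"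
  shows "Idl\<^bsub>pair_ring A B\<^esub> (tensor_relations A B) \<subseteq> S"
proof -
  \<comment> \<open>The largest two-sided ideal inside the additive group S. It contains the
    relations by \<open>relation_mult\<close>, and it lies in S by taking both multipliers to be
    1.\<close>
  define J where "J = {u \<in> carrier (pair_ring A B). \<forall>v\<in>carrier (pair_ring A B).
    \<forall>w\<in>carrier (pair_ring A B). v \<otimes>\<^bsub>pair_ring A B\<^esub> u \<otimes>\<^bsub>pair_ring A B\<^esub> w \<in> S}"
  have S_add: "u + v \<in> S" if "u \<in> S" "v \<in> S" for u v
    using S(3)[OF that(1) S(3)[OF S(2) that(2)]] by simp
  have S_minus: "- u \<in> S" if "u \<in> S" for u
    using S(3)[OF S(2) that] by simp
  have "ideal J (pair_ring A B)"
  proof (rule idealI[OF P.ring_axioms])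
    have neg: "- u \<in> J" if "u \<in> J" for u
    proof -
      have c: "- u \<in> carrier (pair_ring A B)" using that by (simp add: J_def pair_ring_simps)
      have "v \<otimes>\<^bsub>pair_ring A B\<^esub> (0 - u) \<otimes>\<^bsub>pair_ring A B\<^esub> w = - (v \<otimes>\<^bsub>pair_ring A B\<^esub> u \<otimes>\<^bsub>pair_ring A B\<^esub> w)"
        for v w unfolding pair_ring_mult by simp
      then show ?thesis using that c by (auto simp: J_def S_minus)
    qed
    show "subgroup J (add_monoid (pair_ring A B))"
    proof (rule P.add.subgroupI)
      show "J \<noteq> {}" using S(2) by (auto simp: J_def pair_ring_mult pair_ring_simps(1) intro!: exI[of _ 0])
    next
      fix a assume "a \<in> J"
      then show "\<ominus>\<^bsub>pair_ring A B\<^esub> a \<in> J" using neg by (simp add: pair_minus J_def)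
    next
      fix a b assume "a \<in> J" "b \<in> J"
      then show "a \<oplus>\<^bsub>pair_ring A B\<^esub> b \<in> J"
        using P.a_closed[of a b] by (auto simp: J_def pair_ring_simps(3) pair_ring_mult S_add)
    qed (auto simp: J_def)
  next
    fix a x assume "a \<in> J" "x \<in> carrier (pair_ring A B)"
    then have a: "a \<in> carrier (pair_ring A B)" and x: "x \<in> carrier (pair_ring A B)"
      and J: "\<And>v w. \<lbrakk>v \<in> carrier (pair_ring A B); w \<in> carrier (pair_ring A B)\<rbrakk>
        \<Longrightarrow> v \<otimes>\<^bsub>pair_ring A B\<^esub> a \<otimes>\<^bsub>pair_ring A B\<^esub> w \<in> S"
      unfolding J_def by blast+
    show "x \<otimes>\<^bsub>pair_ring A B\<^esub> a \<in> J"
      unfolding J_def using a x J by (simp del: pair_ring_simps add: P.m_assoc [symmetric])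
    show "a \<otimes>\<^bsub>pair_ring A B\<^esub> x \<in> J"
      unfolding J_def using a x J by (simp add: P.m_assoc)
  qed
  moreover have "tensor_relations A B \<subseteq> J"
  proof
    fix r assume r: "r \<in> tensor_relations A B"
    have "v \<otimes>\<^bsub>pair_ring A B\<^esub> r \<otimes>\<^bsub>pair_ring A B\<^esub> w \<in> S"
      if v: "v \<in> carrier (pair_ring A B)" and w: "w \<in> carrier (pair_ring A B)" for v w
      using v
    proof (induction v rule: pair_induct)
      case (gen a b)
      from w show ?case
      proof (induction w rule: pair_induct)
        case (gen a' b')
        then show ?case using r S(1) \<open>a \<in> _\<close> \<open>b \<in> _\<close> relation_mult by blast
      qed (use S in \<open>auto simp: pair_ring_mult\<close>)
    qed (use S in \<open>auto simp: pair_ring_mult\<close>)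
    then show "r \<in> J" using r relations_closed by (auto simp: J_def)
  qed
  ultimately have "Idl\<^bsub>pair_ring A B\<^esub> (tensor_relations A B) \<subseteq> J" by (rule P.genideal_minimal)
  moreover have "J \<subseteq> S"
  proof
    fix u assume "u \<in> J"
    then have "u \<in> carrier (pair_ring A B)"
      "\<one>\<^bsub>pair_ring A B\<^esub> \<otimes>\<^bsub>pair_ring A B\<^esub> u \<otimes>\<^bsub>pair_ring A B\<^esub> \<one>\<^bsub>pair_ring A B\<^esub> \<in> S"
      unfolding J_def using P.one_closed by blast+
    then show "u \<in> S" by simp
  qed
  ultimately show ?thesis by blast
qed

sublocale T: ring "tensor_ring A B"
  unfolding tensor_ring_def by (rule I.quotient_is_ring)

abbreviation "coset \<equiv> (+>\<^bsub>pair_ring A B\<^esub>) (Idl\<^bsub>pair_ring A B\<^esub> (tensor_relations A B))"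

lemma coset_hom: "coset \<in> ring_hom (pair_ring A B) (tensor_ring A B)"
  unfolding tensor_ring_def by (rule I.rcos_ring_hom)

lemma coset_diff:
  assumes "u \<in> carrier (pair_ring A B)" "v \<in> carrier (pair_ring A B)"
  shows "coset (u - v) = coset u \<ominus>\<^bsub>tensor_ring A B\<^esub> coset v"
proof -
  interpret h: ring_hom_ring "pair_ring A B" "tensor_ring A B" coset
    using P.ring_axioms T.ring_axioms coset_hom by (rule ring_hom_ringI2)
  have "u - v = u \<ominus>\<^bsub>pair_ring A B\<^esub> v"
    using assms by (simp add: a_minus_def pair_ring_simps pair_minus)
  then show ?thesis using assms by (simp add: a_minus_def)
qed

lemma coset_eq_zero_iff:
  assumes "u \<in> carrier (pair_ring A B)"
  shows "coset u = \<zero>\<^bsub>tensor_ring A B\<^esub> \<longleftrightarrow> u \<in> Idl\<^bsub>pair_ring A B\<^esub> (tensor_relations A B)"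
  unfolding tensor_ring_def FactRing_def using assms I.rcos_const_imp_mem P.a_rcos_zero[OF I.is_ideal]
  by auto

lemma pure_closed [simp]:
  "a \<in> carrier A \<Longrightarrow> b \<in> carrier B \<Longrightarrow> pure_tensor A B a b \<in> carrier (tensor_ring A B)"
  unfolding pure_tensor_def using ring_hom_closed[OF coset_hom] by (simp add: frag_of_closed)

lemma pure_mult:
  "\<lbrakk>a \<in> carrier A; b \<in> carrier B; a' \<in> carrier A; b' \<in> carrier B\<rbrakk> \<Longrightarrow>
    pure_tensor A B a b \<otimes>\<^bsub>tensor_ring A B\<^esub> pure_tensor A B a' b' = pure_tensor A B (a \<otimes>\<^bsub>A\<^esub> a') (b \<otimes>\<^bsub>B\<^esub> b')"
  unfolding pure_tensor_def using ring_hom_mult[OF coset_hom, of "frag_of (a,b)" "frag_of (a',b')"]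
  by (simp add: frag_of_closed pair_ring_mult)

lemma pure_one: "pure_tensor A B \<one>\<^bsub>A\<^esub> \<one>\<^bsub>B\<^esub> = \<one>\<^bsub>tensor_ring A B\<^esub>"
  unfolding pure_tensor_def using ring_hom_one[OF coset_hom] by (simp add: pair_ring_simps)

lemma pure_add_left:
  assumes "a \<in> carrier A" "a' \<in> carrier A" "b \<in> carrier B"
  shows "pure_tensor A B (a \<oplus>\<^bsub>A\<^esub> a') b = pure_tensor A B a b \<oplus>\<^bsub>tensor_ring A B\<^esub> pure_tensor A B a' b"
proof -
  have "frag_of (a \<oplus>\<^bsub>A\<^esub> a', b) - frag_of (a, b) - frag_of (a', b) \<in> tensor_relations A B"
    unfolding tensor_relations_def using assms by blast
  then have "frag_of (a \<oplus>\<^bsub>A\<^esub> a', b) - frag_of (a, b) - frag_of (a', b)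
      \<in> Idl\<^bsub>pair_ring A B\<^esub> (tensor_relations A B)"
    using P.genideal_self[OF relations_closed] by blast
  then have "coset (frag_of (a \<oplus>\<^bsub>A\<^esub> a', b) - frag_of (a, b) - frag_of (a', b)) = \<zero>\<^bsub>tensor_ring A B\<^esub>"
    using coset_eq_zero_iff I.a_Hcarr by blast
  then have "pure_tensor A B (a \<oplus>\<^bsub>A\<^esub> a') b \<ominus>\<^bsub>tensor_ring A B\<^esub> pure_tensor A B a b
      \<ominus>\<^bsub>tensor_ring A B\<^esub> pure_tensor A B a' b = \<zero>\<^bsub>tensor_ring A B\<^esub>"
    using assms by (simp add: coset_diff frag_of_closed pair_diff_closed pure_tensor_def)
  then show ?thesis
    using assms by (intro T.minus_minus_eq_zero) auto
qed

lemma pure_add_right: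
  assumes "a \<in> carrier A" "b \<in> carrier B" "b' \<in> carrier B"
  shows "pure_tensor A B a (b \<oplus>\<^bsub>B\<^esub> b') = pure_tensor A B a b \<oplus>\<^bsub>tensor_ring A B\<^esub> pure_tensor A B a b'"
proof -
  have "frag_of (a, b \<oplus>\<^bsub>B\<^esub> b') - frag_of (a, b) - frag_of (a, b') \<in> tensor_relations A B"
    unfolding tensor_relations_def using assms by blast
  then have "frag_of (a, b \<oplus>\<^bsub>B\<^esub> b') - frag_of (a, b) - frag_of (a, b')
      \<in> Idl\<^bsub>pair_ring A B\<^esub> (tensor_relations A B)"
    using P.genideal_self[OF relations_closed] by blast
  then have "coset (frag_of (a, b \<oplus>\<^bsub>B\<^esub> b') - frag_of (a, b) - frag_of (a, b')) = \<zero>\<^bsub>tensor_ring A B\<^esub>"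
    using coset_eq_zero_iff I.a_Hcarr by blast
  then have "pure_tensor A B a (b \<oplus>\<^bsub>B\<^esub> b') \<ominus>\<^bsub>tensor_ring A B\<^esub> pure_tensor A B a b
      \<ominus>\<^bsub>tensor_ring A B\<^esub> pure_tensor A B a b' = \<zero>\<^bsub>tensor_ring A B\<^esub>"
    using assms by (simp add: coset_diff frag_of_closed pair_diff_closed pure_tensor_def)
  then show ?thesis
    using assms by (intro T.minus_minus_eq_zero) auto
qed

text \<open>Zero needs no case of its own, being the difference of a pure tensor and itself; with
  differences in place of sums there is no case for negatives either.\<close>

lemma tensor_induct [consumes 1, case_names pure diff]:
  assumes x: "x \<in> carrier (tensor_ring A B)"
    and pure: "\<And>a b. \<lbrakk>a \<in> carrier A; b \<in> carrier B\<rbrakk> \<Longrightarrow> P (pure_tensor A B a b)"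
    and diff: "\<And>x y. \<lbrakk>x \<in> carrier (tensor_ring A B); y \<in> carrier (tensor_ring A B); P x; P y\<rbrakk>
      \<Longrightarrow> P (x \<ominus>\<^bsub>tensor_ring A B\<^esub> y)"
  shows "P x"
proof -
  obtain u where u: "u \<in> carrier (pair_ring A B)" "x = coset u"
    using x unfolding tensor_ring_def FactRing_def A_RCOSETS_def' by (auto simp: a_r_coset_def)
  from u(1) have "P (coset u)"
  proof (induction u rule: pair_induct)
    case zero
    have "P (pure_tensor A B \<zero>\<^bsub>A\<^esub> \<zero>\<^bsub>B\<^esub> \<ominus>\<^bsub>tensor_ring A B\<^esub> pure_tensor A B \<zero>\<^bsub>A\<^esub> \<zero>\<^bsub>B\<^esub>)"
      by (intro diff pure) auto
    moreover have "coset 0 = \<zero>\<^bsub>tensor_ring A B\<^esub>"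
      using coset_eq_zero_iff[of 0] I.zero_closed by (simp add: pair_ring_simps)
    ultimately show ?case by (simp add: T.minus_eq T.r_neg)
  next
    case (diff u v)
    then show ?case using assms(3) ring_hom_closed[OF coset_hom] by (simp add: coset_diff)
  next
    case (gen a b)
    then show ?case using pure by (simp add: pure_tensor_def)
  qed
  with u(2) show ?thesis by simp
qed

end

section \<open>Additive homomorphisms\<close>

context abelian_group
begin

lemma zmult_closed [simp, intro]: "x \<in> carrier G \<Longrightarrow> [(k::int)] \<cdot> x \<in> carrier G"
  by (rule add.int_pow_closed)

lemma zmult_add: "x \<in> carrier G \<Longrightarrow> [(k + l :: int)] \<cdot> x = [k] \<cdot> x \<oplus> [l] \<cdot> x"
  by (rule add.int_pow_mult)

lemma zmult_distrib: "x \<in> carrier G \<Longrightarrow> y \<in> carrier G \<Longrightarrow> [(k::int)] \<cdot> (x \<oplus> y) = [k] \<cdot> x \<oplus> [k] \<cdot> y"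
  by (rule add.int_pow_distrib)

lemma zmult_zmult: "x \<in> carrier G \<Longrightarrow> [(k::int)] \<cdot> ([(l::int)] \<cdot> x) = [(k * l)] \<cdot> x"
  by (subst add.int_pow_pow) (simp_all add: mult.commute)

lemma zmult_neg: "x \<in> carrier G \<Longrightarrow> [(- k :: int)] \<cdot> x = \<ominus> ([k] \<cdot> x)"
  using add.int_pow_neg a_inv_def by metis

lemma zmult_minus: "x \<in> carrier G \<Longrightarrow> [(k::int)] \<cdot> (\<ominus> x) = \<ominus> ([k] \<cdot> x)"
  using add.int_pow_inv a_inv_def by metis

lemma zmult_diff: "x \<in> carrier G \<Longrightarrow> y \<in> carrier G \<Longrightarrow> [(k::int)] \<cdot> (x \<ominus> y) = [k] \<cdot> x \<ominus> [k] \<cdot> y"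
  by (simp add: a_minus_def zmult_distrib zmult_minus)

lemma zmult_one [simp]: "x \<in> carrier G \<Longrightarrow> [(1::int)] \<cdot> x = x"
  using add.int_pow_1 by simp

lemma zmult_zero_left [simp]: "[(0::int)] \<cdot> x = \<zero>"
  unfolding add_pow_def by (simp add: int_pow_def)

lemma zmult_zero_right [simp]: "[(k::int)] \<cdot> \<zero> = \<zero>"
  using add.int_pow_one .

lemma diff_eq_zero:
  assumes "x \<in> carrier G" "y \<in> carrier G" "x \<ominus> y = \<zero>"
  shows "x = y"
proof -
  have "x = (x \<ominus> y) \<oplus> y" using assms(1,2) by (simp add: a_minus_def a_assoc l_neg)
  then show ?thesis using assms by simp
qed

lemma add_diff_diff_cancel:
  assumes "x \<in> carrier G" "y \<in> carrier G"
  shows "x \<oplus> y \<ominus> x \<ominus> y = \<zero>"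
proof -
  have "x \<oplus> y \<ominus> x \<ominus> y = (x \<oplus> y) \<oplus> \<ominus> (x \<oplus> y)"
    using assms by (simp only: a_minus_def minus_add a_assoc add.inv_closed a_closed a_inv_closed)
  then show ?thesis using assms by (simp add: r_neg)
qed

lemma generate_zmult:
  assumes "x \<in> generate (add_monoid G) S" "S \<subseteq> carrier G"
  shows "[(k::int)] \<cdot> x \<in> generate (add_monoid G) S"
proof -
  have "subgroup (generate (add_monoid G) S) (add_monoid G)"
    using assms(2) add.generate_is_subgroup by simp
  then show ?thesis using assms(1) add.subgroup_int_pow_closed by simp
qed

text \<open>One case for differences covers both inverses and sums of the inductive definition, as
  -y = 0 - y and x + y = x - (-y).\<close>

lemma generate_add_induct [consumes 2, case_names gen zero diff]:
  assumes "x \<in> generate (add_monoid G) S" "S \<subseteq> carrier G"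
    and gen: "\<And>s. s \<in> S \<Longrightarrow> P s" and zero: "P \<zero>"
    and diff: "\<And>x y. \<lbrakk>x \<in> carrier G; y \<in> carrier G; P x; P y\<rbrakk> \<Longrightarrow> P (x \<ominus> y)"
  shows "P x"
proof -
  have neg: "P (\<ominus> y)" if "y \<in> carrier G" "P y" for y
    using diff[OF _ that(1) zero that(2)] that by (simp add: a_minus_def)
  have "x \<in> carrier G \<and> P x" using assms(1)
  proof (induction rule: generate.induct)
    case one then show ?case using zero by simp
  next
    case (incl h) then show ?case using assms(2) gen by auto
  next
    case (inv h)
    then show ?case using assms(2) gen neg by (auto simp flip: a_inv_def)
  next
    case (eng x y)
    then show ?case using diff[of x "\<ominus> y"] neg by (simp add: a_minus_def)
  qed
  then show ?thesis by simp
qed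

end

context abelian_group_hom
begin

lemma hom_zmult: "x \<in> carrier G \<Longrightarrow> h ([(k::int)] \<cdot> x) = [k] \<cdot>\<^bsub>H\<^esub> h x"
  using group_hom.hom_int_pow[OF a_group_hom, of x k] by (simp add: add_pow_def)

lemma hom_diff: "x \<in> carrier G \<Longrightarrow> y \<in> carrier G \<Longrightarrow> h (x \<ominus> y) = h x \<ominus>\<^bsub>H\<^esub> h y"
  by (simp add: a_minus_def)

lemma hom_finsum':
  assumes "\<And>i. i < n \<Longrightarrow> f i \<in> carrier G"
  shows "h (\<Oplus>i\<in>{..<n::nat}. f i) = (\<Oplus>\<^bsub>H\<^esub>i\<in>{..<n}. h (f i))"
  using assms
proof (induction n)
  case (Suc n)
  then show ?case by (simp add: lessThan_Suc Pi_def finsum_closed)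
qed simp

lemma hom_generate:
  assumes "S \<subseteq> carrier G"
  shows "h ` generate (add_monoid G) S = generate (add_monoid H) (h ` S)"
  using group_hom.generate_img[OF a_group_hom, of S] assms by simp

end

lemma abelian_group_homI':
  assumes "abelian_group G" "abelian_group H" "\<And>x. x \<in> carrier G \<Longrightarrow> h x \<in> carrier H"
    "\<And>x y. \<lbrakk>x \<in> carrier G; y \<in> carrier G\<rbrakk> \<Longrightarrow> h (x \<oplus>\<^bsub>G\<^esub> y) = h x \<oplus>\<^bsub>H\<^esub> h y"
  shows "abelian_group_hom G H h"
proof (rule abelian_group_homI[OF assms(1,2)])
  interpret G: abelian_group G by fact
  interpret H: abelian_group H by fact
  show "group_hom (add_monoid G) (add_monoid H) h"
    by (intro group_hom.intro group_hom_axioms.intro G.a_group H.a_group)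
       (simp add: hom_def assms)
qed

lemma ring_hom_abelian_group_hom:
  assumes "ring A" "ring B" "h \<in> ring_hom A B"
  shows "abelian_group_hom A B h"
  by (rule abelian_group_homI')
     (use assms ring.is_abelian_group in \<open>auto simp: ring_hom_closed ring_hom_add\<close>)

lemma rat_ring_simps [simp]:
  "carrier rat_ring = UNIV" "p \<otimes>\<^bsub>rat_ring\<^esub> q = p * q" "p \<oplus>\<^bsub>rat_ring\<^esub> q = p + q"
  "\<one>\<^bsub>rat_ring\<^esub> = 1" "\<zero>\<^bsub>rat_ring\<^esub> = 0"
  by (simp_all add: rat_ring_def)

lemma ring_rat_ring: "ring rat_ring"
proof (rule ringI)
  show "abelian_group rat_ring"
    by (rule abelian_groupI) (auto intro!: exI[of _ "- _"])
  show "monoid rat_ring" by (rule monoidI) auto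
qed (auto simp: algebra_simps)

lemma rat_ring_minus: "\<ominus>\<^bsub>rat_ring\<^esub> q = - q" "p \<ominus>\<^bsub>rat_ring\<^esub> q = p - q"
proof -
  interpret ring rat_ring by (rule ring_rat_ring)
  show *: "\<ominus>\<^bsub>rat_ring\<^esub> q = - q" for q
    by (rule minus_equality) auto
  show "p \<ominus>\<^bsub>rat_ring\<^esub> q = p - q" by (simp add: a_minus_def *)
qed

lemma zmult_rat_ring [simp]: "[(k::int)] \<cdot>\<^bsub>rat_ring\<^esub> q = of_int k * q"
proof -
  interpret ring rat_ring by (rule ring_rat_ring)
  have *: "[(int n)] \<cdot>\<^bsub>rat_ring\<^esub> q = of_nat n * q" for n
  proof (induction n)
    case 0 then show ?case using zmult_zero_left by simp
  next
    case (Suc n)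
    have "[(int n + 1)] \<cdot>\<^bsub>rat_ring\<^esub> q = [(int n)] \<cdot>\<^bsub>rat_ring\<^esub> q + q"
      by (subst zmult_add) auto
    then show ?case using Suc by (simp add: algebra_simps)
  qed
  show ?thesis
  proof (cases "k \<ge> 0")
    case True then show ?thesis using *[of "nat k"] by simp
  next
    case False
    have "[(- int (nat (- k)))] \<cdot>\<^bsub>rat_ring\<^esub> q = - (of_nat (nat (- k)) * q)"
      using * zmult_neg[of q "int (nat (- k))"] by (simp only: rat_ring_minus) simp
    then show ?thesis using False by simp
  qed
qed

section \<open>The universal property of the tensor product\<close>

context ring_pair
begin

lemma pure_left_hom: "b \<in> carrier B \<Longrightarrow> abelian_group_hom A (tensor_ring A B) (\<lambda>a. pure_tensor A B a b)"
  by (rule abelian_group_homI') (auto simp: pure_add_left A.is_abelian_group T.is_abelian_group)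

lemma pure_right_hom: "a \<in> carrier A \<Longrightarrow> abelian_group_hom B (tensor_ring A B) (pure_tensor A B a)"
  by (rule abelian_group_homI') (auto simp: pure_add_right B.is_abelian_group T.is_abelian_group)

lemma pure_zmult:
  assumes "a \<in> carrier A" "b \<in> carrier B"
  shows "[(k::int)] \<cdot>\<^bsub>tensor_ring A B\<^esub> pure_tensor A B a b = pure_tensor A B ([k] \<cdot>\<^bsub>A\<^esub> a) b"
    "[(k::int)] \<cdot>\<^bsub>tensor_ring A B\<^esub> pure_tensor A B a b = pure_tensor A B a ([k] \<cdot>\<^bsub>B\<^esub> b)"
  using abelian_group_hom.hom_zmult[OF pure_left_hom] abelian_group_hom.hom_zmult[OF pure_right_hom] assms
  by auto

text \<open>A biadditive map extends to the free group and kills the relations, hence by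
  \<open>tensor_ideal_subset\<close> the whole ideal. Thus its value on a coset does not depend on
  the representative, which is picked by choice.\<close>

lemma tensor_lift:
  assumes G: "abelian_group G"
    and closed: "\<And>a b. \<lbrakk>a \<in> carrier A; b \<in> carrier B\<rbrakk> \<Longrightarrow> f a b \<in> carrier G"
    and left: "\<And>a a' b. \<lbrakk>a \<in> carrier A; a' \<in> carrier A; b \<in> carrier B\<rbrakk>
      \<Longrightarrow> f (a \<oplus>\<^bsub>A\<^esub> a') b = f a b \<oplus>\<^bsub>G\<^esub> f a' b"
    and right: "\<And>a b b'. \<lbrakk>a \<in> carrier A; b \<in> carrier B; b' \<in> carrier B\<rbrakk>
      \<Longrightarrow> f a (b \<oplus>\<^bsub>B\<^esub> b') = f a b \<oplus>\<^bsub>G\<^esub> f a b'"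
  shows "\<exists>\<phi>. abelian_group_hom (tensor_ring A B) G \<phi> \<and>
    (\<forall>a\<in>carrier A. \<forall>b\<in>carrier B. \<phi> (pure_tensor A B a b) = f a b)"
proof -
  interpret G: abelian_group G by (rule G)
  obtain h where h: "h \<in> hom (free_Abelian_group (carrier A \<times> carrier B)) (add_monoid G)"
    and hf: "\<And>x. x \<in> carrier A \<times> carrier B \<Longrightarrow> h (frag_of x) = (\<lambda>(a, b). f a b) x"
  proof (rule comm_group.free_Abelian_group_universal[OF G.a_comm_group])
    show "(\<lambda>(a, b). f a b) ` (carrier A \<times> carrier B) \<subseteq> carrier (add_monoid G)" using closed by auto
  qed auto
  interpret h: abelian_group_hom "pair_ring A B" G h
    by (rule abelian_group_homI'[OF P.is_abelian_group G])
       (use h in \<open>auto simp: hom_def pair_ring_simps Pi_def\<close>)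
  have h_diff: "h (u - v) = h u \<ominus>\<^bsub>G\<^esub> h v" if "u \<in> carrier (pair_ring A B)" "v \<in> carrier (pair_ring A B)" for u v
    using h.hom_diff[OF that] that by (simp add: a_minus_def pair_minus pair_ring_simps(3))
  have gen: "h (frag_of (a, b)) = f a b" if "a \<in> carrier A" "b \<in> carrier B" for a b
    using hf[of "(a, b)"] that by simp
  have ker: "h u = \<zero>\<^bsub>G\<^esub>" if "u \<in> Idl\<^bsub>pair_ring A B\<^esub> (tensor_relations A B)" for u
  proof -
    have "Idl\<^bsub>pair_ring A B\<^esub> (tensor_relations A B) \<subseteq> {u \<in> carrier (pair_ring A B). h u = \<zero>\<^bsub>G\<^esub>}"
    proof (rule tensor_ideal_subset)
      show "tensor_relations A B \<subseteq> {u \<in> carrier (pair_ring A B). h u = \<zero>\<^bsub>G\<^esub>}"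
      proof
        fix r assume r: "r \<in> tensor_relations A B"
        have "h r = \<zero>\<^bsub>G\<^esub>"
          using r unfolding tensor_relations_def
          by (auto simp: h_diff frag_of_closed pair_diff_closed gen left right G.add_diff_diff_cancel closed)
        then show "r \<in> {u \<in> carrier (pair_ring A B). h u = \<zero>\<^bsub>G\<^esub>}" using r relations_closed by auto
      qed
      show "0 \<in> {u \<in> carrier (pair_ring A B). h u = \<zero>\<^bsub>G\<^esub>}"
        using h.hom_zero pair_zero_closed by (simp add: pair_ring_simps)
    next
      fix u v assume "u \<in> {u \<in> carrier (pair_ring A B). h u = \<zero>\<^bsub>G\<^esub>}" "v \<in> {u \<in> carrier (pair_ring A B). h u = \<zero>\<^bsub>G\<^esub>}"
      then show "u - v \<in> {u \<in> carrier (pair_ring A B). h u = \<zero>\<^bsub>G\<^esub>}"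
        by (auto simp: h_diff pair_diff_closed a_minus_def)
    qed
    then show ?thesis using that by blast
  qed
  define \<phi> where "\<phi> x = h (SOME u. u \<in> carrier (pair_ring A B) \<and> coset u = x)" for x
  have \<phi>_coset: "\<phi> (coset u) = h u" if u: "u \<in> carrier (pair_ring A B)" for u
  proof -
    define v where "v = (SOME v. v \<in> carrier (pair_ring A B) \<and> coset v = coset u)"
    have v: "v \<in> carrier (pair_ring A B) \<and> coset v = coset u"
      unfolding v_def using u by (intro someI) auto
    then have "coset (v - u) = \<zero>\<^bsub>tensor_ring A B\<^esub>"
      using u ring_hom_closed[OF coset_hom u] by (simp add: coset_diff a_minus_def T.r_neg)
    then have "h (v - u) = \<zero>\<^bsub>G\<^esub>"
      using u v ker coset_eq_zero_iff pair_diff_closed by blast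
    then have "h v = h u" using u v G.diff_eq_zero[of "h v" "h u"] by (simp add: h_diff)
    then show ?thesis by (simp add: \<phi>_def v_def)
  qed
  have surj: "\<exists>u\<in>carrier (pair_ring A B). x = coset u" if "x \<in> carrier (tensor_ring A B)" for x
    using that unfolding tensor_ring_def FactRing_def A_RCOSETS_def' by (auto simp: a_r_coset_def)
  have "abelian_group_hom (tensor_ring A B) G \<phi>"
  proof (rule abelian_group_homI'[OF T.is_abelian_group G])
    fix x assume "x \<in> carrier (tensor_ring A B)"
    then show "\<phi> x \<in> carrier G" using surj \<phi>_coset by fastforce
  next
    fix x y assume x: "x \<in> carrier (tensor_ring A B)" and y: "y \<in> carrier (tensor_ring A B)"
    obtain u where u: "u \<in> carrier (pair_ring A B)" "x = coset u" using surj[OF x] ..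
    obtain v where v: "v \<in> carrier (pair_ring A B)" "y = coset v" using surj[OF y] ..
    note uv = u(1) v(1) and xy = u(2) v(2)
    have "coset (u \<oplus>\<^bsub>pair_ring A B\<^esub> v) = x \<oplus>\<^bsub>tensor_ring A B\<^esub> y"
      using ring_hom_add[OF coset_hom uv] xy by simp
    then show "\<phi> (x \<oplus>\<^bsub>tensor_ring A B\<^esub> y) = \<phi> x \<oplus>\<^bsub>G\<^esub> \<phi> y"
      using \<phi>_coset[OF P.a_closed[OF uv]] uv xy \<phi>_coset by simp
  qed
  moreover have "\<phi> (pure_tensor A B a b) = f a b" if "a \<in> carrier A" "b \<in> carrier B" for a b
    using that \<phi>_coset[of "frag_of (a, b)"] by (simp add: pure_tensor_def frag_of_closed gen)
  ultimately show ?thesis by blast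
qed

text \<open>Multiplicativity of the additive lift is additive in each factor, so two nested
  inductions reduce it to pure tensors, where it is the hypothesis on f.\<close>

lemma tensor_lift_ring:
  assumes G: "ring G"
    and closed: "\<And>a b. \<lbrakk>a \<in> carrier A; b \<in> carrier B\<rbrakk> \<Longrightarrow> f a b \<in> carrier G"
    and left: "\<And>a a' b. \<lbrakk>a \<in> carrier A; a' \<in> carrier A; b \<in> carrier B\<rbrakk>
      \<Longrightarrow> f (a \<oplus>\<^bsub>A\<^esub> a') b = f a b \<oplus>\<^bsub>G\<^esub> f a' b"
    and right: "\<And>a b b'. \<lbrakk>a \<in> carrier A; b \<in> carrier B; b' \<in> carrier B\<rbrakk>
      \<Longrightarrow> f a (b \<oplus>\<^bsub>B\<^esub> b') = f a b \<oplus>\<^bsub>G\<^esub> f a b'"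
    and mult: "\<And>a a' b b'. \<lbrakk>a \<in> carrier A; a' \<in> carrier A; b \<in> carrier B; b' \<in> carrier B\<rbrakk>
      \<Longrightarrow> f (a \<otimes>\<^bsub>A\<^esub> a') (b \<otimes>\<^bsub>B\<^esub> b') = f a b \<otimes>\<^bsub>G\<^esub> f a' b'"
    and one: "f \<one>\<^bsub>A\<^esub> \<one>\<^bsub>B\<^esub> = \<one>\<^bsub>G\<^esub>"
  shows "\<exists>\<phi>. \<phi> \<in> ring_hom (tensor_ring A B) G \<and>
    (\<forall>a\<in>carrier A. \<forall>b\<in>carrier B. \<phi> (pure_tensor A B a b) = f a b)"
proof -
  interpret G: ring G by (rule G)
  have "\<exists>\<phi>. abelian_group_hom (tensor_ring A B) G \<phi> \<and>
    (\<forall>a\<in>carrier A. \<forall>b\<in>carrier B. \<phi> (pure_tensor A B a b) = f a b)"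
    using G.is_abelian_group by (rule tensor_lift) (fact closed left right)+
  then obtain \<phi> where hom: "abelian_group_hom (tensor_ring A B) G \<phi>"
    and \<phi>: "\<And>a b. \<lbrakk>a \<in> carrier A; b \<in> carrier B\<rbrakk> \<Longrightarrow> \<phi> (pure_tensor A B a b) = f a b"
    by blast
  interpret \<phi>: abelian_group_hom "tensor_ring A B" G \<phi> by (rule hom)
  have "\<phi> \<in> ring_hom (tensor_ring A B) G"
  proof (rule ring_hom_memI)
    fix x y assume x: "x \<in> carrier (tensor_ring A B)" and y: "y \<in> carrier (tensor_ring A B)"
    show "\<phi> (x \<otimes>\<^bsub>tensor_ring A B\<^esub> y) = \<phi> x \<otimes>\<^bsub>G\<^esub> \<phi> y"
      using x
    proof (induction x rule: tensor_induct)
      case (pure a b)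
      from y show ?case
      proof (induction y rule: tensor_induct)
        case (pure a' b')
        then show ?case using \<open>a \<in> _\<close> \<open>b \<in> _\<close> by (simp add: pure_mult \<phi> mult)
      next
        case (diff x y)
        then show ?case using pure
          by (simp add: a_minus_def T.r_distr G.r_distr T.r_minus G.r_minus)
      qed
    next
      case (diff u v)
      then show ?case using y
        by (simp add: a_minus_def T.l_distr G.l_distr T.l_minus G.l_minus)
    qed
  next
    show "\<phi> \<one>\<^bsub>tensor_ring A B\<^esub> = \<one>\<^bsub>G\<^esub>"
      using \<phi>[OF A.one_closed B.one_closed] by (simp add: pure_one one)
  qed auto
  then show ?thesis using \<phi> by blast
qed

end

section \<open>Torsion-free rings inside their tensor products with the rationals\<close>

locale torsion_free_ring = ring +
  assumes torsion_free: "\<lbrakk>x \<in> carrier R; (k::int) > 0; [k] \<cdot> x = \<zero>\<rbrakk> \<Longrightarrow> x = \<zero>"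

lemma rat_mult_denom:
  "q * of_int (snd (quotient_of q)) = of_int (fst (quotient_of q))"
  using quotient_of_div[of q "fst (quotient_of q)" "snd (quotient_of q)"] quotient_of_denom_pos'[of q]
  by (metis nonzero_eq_divide_eq of_int_eq_0_iff order_less_irrefl prod.collapse)

lemma rat_common_denom:
  fixes q :: rat
  shows "\<exists>m>0. \<exists>k. q * of_int m = of_int k"
  using rat_mult_denom quotient_of_denom_pos' by blast

context torsion_free_ring
begin

lemma ring_pair_rat: "ring_pair R rat_ring"
  by (intro ring_pair.intro ring_axioms ring_rat_ring)

text \<open>Multiplication by \<open>\<lfloor>k * q\<rfloor>\<close> stands in for multiplication by \<open>k * q\<close>. It is additive in q on
  any finite set of rationals once k is sufficiently divisible, so the elements which it kills for
  all sufficiently divisible k form a subgroup containing the relations. This avoids constructing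
  the localisation of the ring.\<close>

lemma pure_one_eq_zero:
  assumes z: "z \<in> carrier R" and zero: "pure_tensor R rat_ring z 1 = \<zero>\<^bsub>tensor_ring R rat_ring\<^esub>"
  shows "z = \<zero>"
proof -
  interpret Q: ring_pair R rat_ring by (rule ring_pair_rat)
  have "\<exists>h. h \<in> hom (free_Abelian_group (carrier R \<times> (UNIV::rat set))) (add_monoid R) \<and>
    (\<forall>x\<in>carrier R. \<forall>q. h (frag_of (x, q)) = [\<lfloor>of_int k * q\<rfloor>] \<cdot> x)" for k :: int
  proof -
    have "(\<lambda>(x, q). [\<lfloor>of_int k * q\<rfloor>] \<cdot> x) ` (carrier R \<times> UNIV) \<subseteq> carrier (add_monoid R)"
      by auto
    from comm_group.free_Abelian_group_universal[OF a_comm_group this] obtain h where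
      "h \<in> hom (free_Abelian_group (carrier R \<times> (UNIV::rat set))) (add_monoid R)"
      "\<And>x. x \<in> carrier R \<times> UNIV \<Longrightarrow> h (frag_of x) = (\<lambda>(x, q). [\<lfloor>of_int k * q\<rfloor>] \<cdot> x) x"
      by blast
    then show ?thesis by (intro exI[of _ h]) simp
  qed
  then obtain h where h: "\<And>k. h k \<in> hom (free_Abelian_group (carrier R \<times> (UNIV::rat set))) (add_monoid R)"
    and gen: "\<And>k x q. x \<in> carrier R \<Longrightarrow> h k (frag_of (x, q)) = [\<lfloor>of_int k * q\<rfloor>] \<cdot> x"
    by metis
  have h_hom: "abelian_group_hom (pair_ring R rat_ring) R (h k)" for k
    by (rule abelian_group_homI'[OF Q.P.is_abelian_group is_abelian_group])
       (use h[of k] in \<open>auto simp: hom_def pair_ring_simps Pi_def\<close>)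
  have h_diff: "h k (u - v) = h k u \<ominus> h k v"
    if "u \<in> carrier (pair_ring R rat_ring)" "v \<in> carrier (pair_ring R rat_ring)" for u v k
    using abelian_group_hom.hom_diff[OF h_hom that] that
    by (simp add: a_minus_def Q.pair_minus pair_ring_simps(3))
  define J where "J = {u \<in> carrier (pair_ring R rat_ring). \<exists>m>0. \<forall>k. m dvd k \<longrightarrow> h k u = \<zero>}"
  have "Idl\<^bsub>pair_ring R rat_ring\<^esub> (tensor_relations R rat_ring) \<subseteq> J"
  proof (rule Q.tensor_ideal_subset)
    show "tensor_relations R rat_ring \<subseteq> J"
    proof
      fix r assume rel: "r \<in> tensor_relations R rat_ring"
      then have rc: "r \<in> carrier (pair_ring R rat_ring)" using Q.relations_closed by blast
      consider (l) x y q where "r = frag_of (x \<oplus> y, q) - frag_of (x, q) - frag_of (y, q)"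
          "x \<in> carrier R" "y \<in> carrier R"
        | (r) x p q where "r = frag_of (x, p + q) - frag_of (x, p) - frag_of (x, q)" "x \<in> carrier R"
        using rel unfolding tensor_relations_def rat_ring_simps by blast
      then have "\<exists>m>0. \<forall>k. m dvd k \<longrightarrow> h k r = \<zero>"
      proof cases
        \<comment> \<open>Additivity in the ring argument holds for every k, so the divisibility
          bound can be 1.\<close>
        case l
        then show ?thesis
          by (intro exI[of _ 1])
             (simp add: h_diff Q.frag_of_closed Q.pair_diff_closed gen zmult_distrib add_diff_diff_cancel)
      next
        case r
        obtain m a where m: "m > 0" "p * of_int m = of_int a" using rat_common_denom by blast
        obtain m' b where m': "m' > 0" "q * of_int m' = of_int b" using rat_common_denom by blast
        \<comment> \<open>The product of the two denominators divides k, so k p and k q are integers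
          and the floors are exact.\<close>
        have "h k r = \<zero>" if "m * m' dvd k" for k
        proof -
          from that obtain j where "k = m * m' * j" by (rule dvdE)
          then have "of_int k * p = of_int (m' * j * a)" "of_int k * q = of_int (m * j * b)"
            using m m' by (simp_all add: mult.commute mult.left_commute flip: m(2) m'(2))
          then have "\<lfloor>of_int k * (p + q)\<rfloor> = \<lfloor>of_int k * p\<rfloor> + \<lfloor>of_int k * q\<rfloor>"
            by (simp only: distrib_left floor_of_int flip: of_int_add)
          then show ?thesis using r
            by (simp add: h_diff Q.frag_of_closed Q.pair_diff_closed gen zmult_add add_diff_diff_cancel)
        qed
        then show ?thesis using m m' by (intro exI[of _ "m * m'"]) auto
      qed
      then show "r \<in> J" using rc by (simp add: J_def)
    qed
    show "0 \<in> J"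
      using Q.pair_zero_closed abelian_group_hom.hom_zero[OF h_hom]
      by (auto simp: J_def pair_ring_simps intro: exI[of _ 1])
  next
    fix u v assume "u \<in> J" "v \<in> J"
    then have uv: "u \<in> carrier (pair_ring R rat_ring)" "v \<in> carrier (pair_ring R rat_ring)"
      and "\<exists>m>0. \<forall>k. m dvd k \<longrightarrow> h k u = \<zero>" "\<exists>m>0. \<forall>k. m dvd k \<longrightarrow> h k v = \<zero>"
      unfolding J_def by blast+
    then obtain m m' where m: "m > 0" "\<forall>k. m dvd k \<longrightarrow> h k u = \<zero>"
      and m': "m' > 0" "\<forall>k. m' dvd k \<longrightarrow> h k v = \<zero>" by blast
    have "h k (u - v) = \<zero>" if "m * m' dvd k" for k
    proof -
      have "h k u = \<zero>" "h k v = \<zero>"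
        using m(2) m'(2) dvd_mult_left[OF that] dvd_mult_right[OF that] by blast+
      then show ?thesis using uv by (simp add: h_diff a_minus_def)
    qed
    then have "\<exists>m>0. \<forall>k. m dvd k \<longrightarrow> h k (u - v) = \<zero>"
      using m(1) m'(1) by (intro exI[of _ "m * m'"]) auto
    then show "u - v \<in> J" using uv by (simp add: J_def Q.pair_diff_closed)
  qed
  moreover have "frag_of (z, 1) \<in> Idl\<^bsub>pair_ring R rat_ring\<^esub> (tensor_relations R rat_ring)"
  proof (rule Q.coset_eq_zero_iff[THEN iffD1])
    show "frag_of (z, 1) \<in> carrier (pair_ring R rat_ring)" using z by (simp add: Q.frag_of_closed)
  qed (use zero in \<open>simp only: pure_tensor_def\<close>)
  ultimately have "frag_of (z, 1) \<in> J" by (rule subsetD)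
  then obtain m where "m > 0" "\<forall>k. m dvd k \<longrightarrow> h k (frag_of (z, 1)) = \<zero>"
    unfolding J_def by blast
  then have "m > 0" "h m (frag_of (z, 1)) = \<zero>" by auto
  \<comment> \<open>Taking k = m is decisive: the floor of m * 1 is m, so the integer m itself
    annihilates z.\<close>
  then have "[m] \<cdot> z = \<zero>" using gen z by simp
  then show ?thesis using torsion_free[OF z \<open>m > 0\<close>] by simp
qed

text \<open>A pure tensor is cleared by the denominator of its rational factor, and a difference by
  the product of two denominators.\<close>

lemma ext_rat_cases:
  assumes "a \<in> carrier (tensor_ring R rat_ring)"
  shows "\<exists>m>0. \<exists>z\<in>carrier R. [(m::int)] \<cdot>\<^bsub>tensor_ring R rat_ring\<^esub> a = pure_tensor R rat_ring z 1"
proof -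
  interpret Q: ring_pair R rat_ring by (rule ring_pair_rat)
  show ?thesis using assms
  proof (induction a rule: Q.tensor_induct)
    case (pure x q)
    obtain m k where m: "m > 0" "q * of_int m = of_int k" using rat_common_denom by blast
    have "[m] \<cdot>\<^bsub>tensor_ring R rat_ring\<^esub> pure_tensor R rat_ring x q = pure_tensor R rat_ring x (of_int k * 1)"
      using pure m by (simp add: Q.pure_zmult(2) mult.commute)
    also have "\<dots> = [k] \<cdot>\<^bsub>tensor_ring R rat_ring\<^esub> pure_tensor R rat_ring x 1"
      using pure by (simp add: Q.pure_zmult(2))
    also have "\<dots> = pure_tensor R rat_ring ([k] \<cdot> x) 1"
      using pure by (simp add: Q.pure_zmult(1))
    finally show ?case using m pure by blast
  next
    case (diff x y)
    from diff(3,4) obtain m m' :: int and z z' where *: "m > 0" "m' > 0" "z \<in> carrier R" "z' \<in> carrier R"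
      "[m] \<cdot>\<^bsub>tensor_ring R rat_ring\<^esub> x = pure_tensor R rat_ring z 1"
      "[m'] \<cdot>\<^bsub>tensor_ring R rat_ring\<^esub> y = pure_tensor R rat_ring z' 1" by blast
    interpret h: abelian_group_hom R "tensor_ring R rat_ring" "\<lambda>z. pure_tensor R rat_ring z 1"
      by (rule Q.pure_left_hom) simp
    have "[(m' * m)] \<cdot>\<^bsub>tensor_ring R rat_ring\<^esub> x = pure_tensor R rat_ring ([m'] \<cdot> z) 1"
      using diff * by (simp add: h.hom_zmult flip: Q.T.zmult_zmult)
    moreover have "[(m * m')] \<cdot>\<^bsub>tensor_ring R rat_ring\<^esub> y = pure_tensor R rat_ring ([m] \<cdot> z') 1"
      using diff * by (simp add: h.hom_zmult flip: Q.T.zmult_zmult)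
    ultimately have "[(m * m')] \<cdot>\<^bsub>tensor_ring R rat_ring\<^esub> (x \<ominus>\<^bsub>tensor_ring R rat_ring\<^esub> y)
        = pure_tensor R rat_ring ([m'] \<cdot> z \<ominus> [m] \<cdot> z') 1"
      using diff * by (simp add: h.hom_diff Q.T.zmult_diff mult.commute)
    then show ?case using * by (intro exI[of _ "m * m'"]) auto
  qed
qed

end

section \<open>Rational algebras and lattices\<close>

lemma (in ring) zmult_mult_left: "\<lbrakk>x \<in> carrier R; y \<in> carrier R\<rbrakk> \<Longrightarrow> [(k::int)] \<cdot> x \<otimes> y = [k] \<cdot> (x \<otimes> y)"
  by (rule add_pow_ldistr_int)

lemma (in ring) zmult_mult_right: "\<lbrakk>x \<in> carrier R; y \<in> carrier R\<rbrakk> \<Longrightarrow> x \<otimes> [(k::int)] \<cdot> y = [k] \<cdot> (x \<otimes> y)"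
  by (rule add_pow_rdistr_int)

lemma (in ring) zmult_unit_left: "x \<in> carrier R \<Longrightarrow> ([(k::int)] \<cdot> \<one>) \<otimes> x = [k] \<cdot> x"
  by (simp add: zmult_mult_left)

text \<open>The scalar map is a parameter because it is \<open>rat_in\<close> only for the algebra
  itself; for the extension of B and for the tensor product of Z with the rationals it is a
  different expression.\<close>

locale rat_hom = ring +
  fixes \<rho> :: "rat \<Rightarrow> 'a"
  assumes \<rho>: "\<rho> \<in> ring_hom rat_ring R"
begin

lemma \<rho>_closed [simp, intro]: "\<rho> q \<in> carrier R"
  using ring_hom_closed[OF \<rho>] by simp

lemma \<rho>_add: "\<rho> (p + q) = \<rho> p \<oplus> \<rho> q"
  using ring_hom_add[OF \<rho>, of p q] by simp

lemma \<rho>_mult: "\<rho> (p * q) = \<rho> p \<otimes> \<rho> q"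
  using ring_hom_mult[OF \<rho>, of p q] by simp

lemma \<rho>_one [simp]: "\<rho> 1 = \<one>"
  using ring_hom_one[OF \<rho>] by simp

sublocale \<rho>: abelian_group_hom rat_ring R \<rho>
  by (rule ring_hom_abelian_group_hom[OF ring_rat_ring ring_axioms \<rho>])

lemma \<rho>_zero [simp]: "\<rho> 0 = \<zero>"
  using \<rho>.hom_zero by simp

lemma \<rho>_of_int: "\<rho> (of_int k) = [k] \<cdot> \<one>"
  using \<rho>.hom_zmult[of 1 k] by simp

lemma zmult_eq_\<rho>: "x \<in> carrier R \<Longrightarrow> [(k::int)] \<cdot> x = \<rho> (of_int k) \<otimes> x"
  by (simp add: \<rho>_of_int zmult_unit_left)

lemma \<rho>_cancel: "\<lbrakk>x \<in> carrier R; q \<noteq> 0\<rbrakk> \<Longrightarrow> \<rho> (1 / q) \<otimes> (\<rho> q \<otimes> x) = x"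
  by (simp add: m_assoc[symmetric] \<rho>_mult[symmetric])

lemma zmult_cancel:
  assumes "[(k::int)] \<cdot> x = [k] \<cdot> y" "x \<in> carrier R" "y \<in> carrier R" "k \<noteq> 0"
  shows "x = y"
proof -
  have "x = \<rho> (1 / of_int k) \<otimes> ([k] \<cdot> x)"
    using assms(2,4) \<rho>_cancel[of x "of_int k"] by (simp add: zmult_eq_\<rho>)
  also have "\<dots> = \<rho> (1 / of_int k) \<otimes> ([k] \<cdot> y)"
    by (simp only: assms(1))
  also have "\<dots> = y"
    using assms(3,4) \<rho>_cancel[of y "of_int k"] by (simp add: zmult_eq_\<rho>)
  finally show ?thesis .
qed

lemma zmult_eq_zero: "\<lbrakk>[(k::int)] \<cdot> x = \<zero>; x \<in> carrier R; k \<noteq> 0\<rbrakk> \<Longrightarrow> x = \<zero>"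
  using zmult_cancel[of k x \<zero>] by simp

lemma zmult_divide:
  assumes "x \<in> carrier R" "(k::int) \<noteq> 0"
  obtains y where "y \<in> carrier R" "[k] \<cdot> y = x"
proof
  show "\<rho> (1 / of_int k) \<otimes> x \<in> carrier R" using assms by simp
  show "[k] \<cdot> (\<rho> (1 / of_int k) \<otimes> x) = x"
    using assms \<rho>_cancel[of x "1 / of_int k"] by (simp add: zmult_eq_\<rho>)
qed

text \<open>Some positive multiple of q is an integer, integers are central, and multiplication by a
  nonzero integer can be cancelled.\<close>

lemma \<rho>_central: "x \<in> carrier R \<Longrightarrow> \<rho> q \<otimes> x = x \<otimes> \<rho> q"
proof -
  assume x: "x \<in> carrier R"
  obtain m k where m: "m > 0" "q * of_int m = of_int k" using rat_common_denom by blast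
  have "[m] \<cdot> \<rho> q = [k] \<cdot> \<one>"
    using \<rho>.hom_zmult[of q m] m by (simp add: mult.commute \<rho>_of_int)
  then have "[m] \<cdot> (\<rho> q \<otimes> x) = [m] \<cdot> (x \<otimes> \<rho> q)"
    using x zmult_mult_left[of "\<rho> q" x m] zmult_mult_right[of x "\<rho> q" m]
      zmult_mult_left[of \<one> x k] zmult_mult_right[of x \<one> k] by simp
  then show ?thesis using zmult_cancel x m by simp
qed

end

section \<open>Rational spans and lattices\<close>

locale rat_alg = ring B for B :: "('b, 'm) ring_scheme" (structure) +
  assumes rat_in_hom: "rat_in B \<in> ring_hom rat_ring B"
begin

sublocale rat_hom B "rat_in B"
  by unfold_locales (rule rat_in_hom)

lemma Span_Cons_iff: "x \<in> Span (rats_of B) (v # vs) \<longleftrightarrow> (\<exists>q. \<exists>w\<in>Span (rats_of B) vs. x = rat_in B q \<otimes> v \<oplus> w)"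
  by (auto simp: line_extension_mem_iff rats_of_def)

declare Span.simps [simp del]

lemma Span_Nil: "Span (rats_of B) [] = {\<zero>}"
  by (simp add: Span.simps)

lemma Span_closed: "set vs \<subseteq> carrier B \<Longrightarrow> x \<in> Span (rats_of B) vs \<Longrightarrow> x \<in> carrier B"
  by (induction vs arbitrary: x) (auto simp: Span_Nil Span_Cons_iff)

lemma Span_linear:
  assumes "set vs \<subseteq> carrier B" "x \<in> Span (rats_of B) vs" "y \<in> Span (rats_of B) vs"
  shows "rat_in B p \<otimes> x \<oplus> rat_in B q \<otimes> y \<in> Span (rats_of B) vs"
  using assms
proof (induction vs arbitrary: x y)
  case (Cons v vs)
  from Cons.prems(2) obtain r w where x: "x = rat_in B r \<otimes> v \<oplus> w" "w \<in> Span (rats_of B) vs"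
    unfolding Span_Cons_iff by blast
  from Cons.prems(3) obtain r' w' where y: "y = rat_in B r' \<otimes> v \<oplus> w'" "w' \<in> Span (rats_of B) vs"
    unfolding Span_Cons_iff by blast
  have c: "v \<in> carrier B" "w \<in> carrier B" "w' \<in> carrier B"
    using Cons.prems(1) x y Span_closed[of vs] by auto
  have "rat_in B p \<otimes> x \<oplus> rat_in B q \<otimes> y
      = rat_in B (p * r + q * r') \<otimes> v \<oplus> (rat_in B p \<otimes> w \<oplus> rat_in B q \<otimes> w')"
    using c x y by (simp add: \<rho>_add \<rho>_mult l_distr r_distr m_assoc a_ac)
  moreover have "rat_in B p \<otimes> w \<oplus> rat_in B q \<otimes> w' \<in> Span (rats_of B) vs"
    using Cons x y by auto
  ultimately show ?case unfolding Span_Cons_iff by blast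
qed (simp add: Span_Nil)

lemma zero_in_Span: "set vs \<subseteq> carrier B \<Longrightarrow> \<zero> \<in> Span (rats_of B) vs"
proof (induction vs)
  case (Cons v vs)
  then have "\<zero> = rat_in B 0 \<otimes> v \<oplus> \<zero>" "\<zero> \<in> Span (rats_of B) vs" by auto
  then show ?case unfolding Span_Cons_iff by blast
qed (simp add: Span_Nil)

lemma in_Span: "set vs \<subseteq> carrier B \<Longrightarrow> v \<in> set vs \<Longrightarrow> v \<in> Span (rats_of B) vs"
proof (induction vs)
  case (Cons u vs)
  show ?case
  proof (cases "v = u")
    case True
    then have "v = rat_in B 1 \<otimes> u \<oplus> \<zero>" using Cons.prems by simp
    moreover have "\<zero> \<in> Span (rats_of B) vs" using Cons.prems zero_in_Span by simp
    ultimately show ?thesis unfolding Span_Cons_iff by blast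
  next
    case False
    then have "v = rat_in B 0 \<otimes> u \<oplus> v" using Cons.prems by auto
    moreover have "v \<in> Span (rats_of B) vs" using Cons False by simp
    ultimately show ?thesis unfolding Span_Cons_iff by blast
  qed
qed simp

text \<open>The denominators of the coefficients are cleared one at a time along the list.\<close>

lemma Span_zmult_in_generate:
  "set vs \<subseteq> carrier B \<Longrightarrow> x \<in> Span (rats_of B) vs \<Longrightarrow> \<exists>m>0. [(m::int)] \<cdot> x \<in> generate (add_monoid B) (set vs)"
proof (induction vs arbitrary: x)
  case Nil
  then show ?case using generate.one[of "add_monoid B" "{}"] by (auto simp: Span_Nil intro: exI[of _ 1])
next
  case (Cons v vs)
  from Cons.prems(2) obtain q w where x: "x = rat_in B q \<otimes> v \<oplus> w" "w \<in> Span (rats_of B) vs"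
    unfolding Span_Cons_iff by blast
  obtain m where m: "m > 0" "[(m::int)] \<cdot> w \<in> generate (add_monoid B) (set vs)"
    using Cons x by auto
  obtain m' k where m': "m' > 0" "q * of_int m' = of_int k" using rat_common_denom by blast
  have c: "v \<in> carrier B" "w \<in> carrier B" using Cons.prems x Span_closed[of vs] by auto
  have mono: "generate (add_monoid B) (set vs) \<subseteq> generate (add_monoid B) (set (v # vs))"
    by (rule add.mono_generate) auto
  have "[m'] \<cdot> (rat_in B q \<otimes> v) = [k] \<cdot> v"
    using c m' by (simp add: zmult_eq_\<rho> m_assoc[symmetric] \<rho>_mult[symmetric] mult.commute)
  then have "[(m * m')] \<cdot> x = [(m * k)] \<cdot> v \<oplus> [m'] \<cdot> ([m] \<cdot> w)"
    using c x zmult_zmult[of "rat_in B q \<otimes> v" m m'] zmult_zmult[of v m k] zmult_zmult[of w m' m]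
    by (simp add: zmult_distrib mult.commute)
  moreover have "[(m * k)] \<cdot> v \<in> generate (add_monoid B) (set (v # vs))"
    by (rule generate_zmult[OF _ Cons.prems(1)]) (simp add: generate.incl)
  moreover have "[m'] \<cdot> ([m] \<cdot> w) \<in> generate (add_monoid B) (set (v # vs))"
    by (rule generate_zmult[OF subsetD[OF mono m(2)] Cons.prems(1)])
  ultimately have "[(m * m')] \<cdot> x \<in> generate (add_monoid B) (set (v # vs))"
    using generate.eng[of _ "add_monoid B"] by simp
  then show ?case using m(1) m'(1) by (intro exI[of _ "m * m'"]) auto
qed

text \<open>Clearing denominators replaces the condition on the rational span by one on integer
  multiples, so that arguments about lattices need only subgroups and multiplication by
  integers.\<close>

lemma is_lattice_iff:
  "is_lattice B L \<longleftrightarrow> (\<exists>S. finite S \<and> S \<subseteq> carrier B \<and> L = generate (add_monoid B) S) \<and>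
    (\<forall>x\<in>carrier B. \<exists>m>0. [(m::int)] \<cdot> x \<in> L)"
proof
  assume "is_lattice B L"
  then obtain vs where vs: "set vs \<subseteq> carrier B" "L = generate (add_monoid B) (set vs)"
    "Span (rats_of B) vs = carrier B" unfolding is_lattice_def by blast
  then show "(\<exists>S. finite S \<and> S \<subseteq> carrier B \<and> L = generate (add_monoid B) S) \<and>
    (\<forall>x\<in>carrier B. \<exists>m>0. [(m::int)] \<cdot> x \<in> L)"
    using Span_zmult_in_generate[OF vs(1)] by (auto intro!: exI[of _ "set vs"])
next
  assume *: "(\<exists>S. finite S \<and> S \<subseteq> carrier B \<and> L = generate (add_monoid B) S) \<and>
    (\<forall>x\<in>carrier B. \<exists>m>0. [(m::int)] \<cdot> x \<in> L)"
  then obtain S where S: "finite S" "S \<subseteq> carrier B" "L = generate (add_monoid B) S" by blast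
  obtain vs where vs: "set vs = S" using finite_list[OF S(1)] ..
  have gen: "L \<subseteq> Span (rats_of B) vs"
  proof
    fix x assume "x \<in> L"
    then have "x \<in> generate (add_monoid B) S" using S by simp
    then show "x \<in> Span (rats_of B) vs" using S(2)
    proof (induction x rule: generate_add_induct)
      case (gen s) then show ?case using in_Span vs S by simp
    next
      case zero show ?case using zero_in_Span vs S by simp
    next
      case (diff x y)
      then show ?case using Span_linear[of vs x y 1 "-1"] vs S \<rho>.hom_a_inv[of 1]
          zmult_eq_\<rho>[of y "-1"] zmult_neg[of y 1]
        by (simp add: a_minus_def)
    qed
  qed
  have "Span (rats_of B) vs = carrier B"
  proof
    show "Span (rats_of B) vs \<subseteq> carrier B" using Span_closed[of vs] vs S by auto
    show "carrier B \<subseteq> Span (rats_of B) vs"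
    proof
      fix x assume x: "x \<in> carrier B"
      then obtain m where m: "m > 0" "[(m::int)] \<cdot> x \<in> L" using * by blast
      then have "rat_in B (1 / of_int m) \<otimes> ([m] \<cdot> x) \<oplus> rat_in B 0 \<otimes> \<zero> \<in> Span (rats_of B) vs"
        using gen zero_in_Span vs S by (intro Span_linear) auto
      then show "x \<in> Span (rats_of B) vs"
        using x m \<rho>_cancel[of x "of_int m"] by (simp add: zmult_eq_\<rho>)
    qed
  qed
  then show "is_lattice B L" unfolding is_lattice_def using vs S by blast
qed

end

text \<open>The basis is recorded by coordinate functionals instead of linear independence, since
  additivity of \<open>c j\<close> is just what \<open>tensor_lift\<close> needs to extend
  coordinates to the tensor product. It is required for all indices j, also those beyond n.\<close>

locale rat_basis = rat_alg B for B :: "('b, 'm) ring_scheme" (structure) +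
  fixes n :: nat and e :: "nat \<Rightarrow> 'b" and c :: "nat \<Rightarrow> 'b \<Rightarrow> rat"
  assumes e_closed [simp, intro]: "j < n \<Longrightarrow> e j \<in> carrier B"
    and c_add: "\<lbrakk>x \<in> carrier B; y \<in> carrier B\<rbrakk> \<Longrightarrow> c j (x \<oplus> y) = c j x + c j y"
    and c_e: "\<lbrakk>j < n; k < n\<rbrakk> \<Longrightarrow> c j (e k) = (if j = k then 1 else 0)"
    and expand: "x \<in> carrier B \<Longrightarrow> x = (\<Oplus>j\<in>{..<n}. rat_in B (c j x) \<otimes> e j)"
begin

sublocale c: abelian_group_hom B rat_ring "c j" for j
  by (rule abelian_group_homI') (auto simp: c_add is_abelian_group ring.is_abelian_group ring_rat_ring)

lemma c_zmult: "x \<in> carrier B \<Longrightarrow> c j ([(k::int)] \<cdot> x) = of_int k * c j x"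
  using c.hom_zmult by simp

definition std_lattice :: "'b set" where
  "std_lattice = {x \<in> carrier B. \<forall>j<n. c j x \<in> \<int>}"

lemma std_expand:
  assumes "x \<in> std_lattice"
  obtains k :: "nat \<Rightarrow> int" where "x = (\<Oplus>j\<in>{..<n}. [(k j)] \<cdot> e j)" "\<And>j. j < n \<Longrightarrow> c j x = of_int (k j)"
proof -
  have "\<forall>j. \<exists>k. j < n \<longrightarrow> c j x = of_int k" using assms unfolding std_lattice_def by (auto elim: Ints_cases)
  then obtain k where k: "\<And>j. j < n \<Longrightarrow> c j x = of_int (k j)" by metis
  have "x = (\<Oplus>j\<in>{..<n}. rat_in B (c j x) \<otimes> e j)" using assms expand unfolding std_lattice_def by blast
  also have "\<dots> = (\<Oplus>j\<in>{..<n}. [(k j)] \<cdot> e j)"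
    by (rule finsum_cong') (auto simp: k zmult_eq_\<rho>)
  finally show ?thesis using k that by blast
qed

lemma e_in_std: "j < n \<Longrightarrow> e j \<in> std_lattice"
  by (auto simp: std_lattice_def c_e)

lemma std_subset: "std_lattice \<subseteq> carrier B"
  by (auto simp: std_lattice_def)

lemma std_diff: "\<lbrakk>x \<in> std_lattice; y \<in> std_lattice\<rbrakk> \<Longrightarrow> x \<ominus> y \<in> std_lattice"
  by (auto simp: std_lattice_def c.hom_diff rat_ring_minus)

lemma zmult_in_std:
  assumes x: "x \<in> carrier B"
  shows "\<exists>m>0. [(m::int)] \<cdot> x \<in> std_lattice"
proof -
  have "\<exists>m>0. \<forall>j<k. of_int m * c j x \<in> \<int>" for k
  proof (induction k)
    case 0 then show ?case by (auto intro: exI[of _ 1])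
  next
    case (Suc k)
    then obtain m where m: "m > 0" "\<forall>j<k. of_int m * c j x \<in> \<int>" by blast
    obtain m' l where m': "m' > 0" "c k x * of_int m' = of_int l" using rat_common_denom by blast
    have "of_int (m' * m) * c j x \<in> \<int>" if "j < Suc k" for j
    proof (cases "j = k")
      case True
      then have "of_int (m' * m) * c j x = of_int (m * l)" using m' by (simp add: algebra_simps)
      then show ?thesis by (metis Ints_of_int)
    next
      case False
      then have "of_int m' * (of_int m * c j x) \<in> \<int>" using m that by simp
      then show ?thesis by (simp add: mult.assoc)
    qed
    then show ?case using m(1) m'(1) by (intro exI[of _ "m' * m"]) auto
  qed
  then show ?thesis using x by (auto simp: std_lattice_def c_zmult)
qed

end

section \<open>Extension of scalars\<close>

lemma finsum_single:
  assumes "abelian_monoid G" "k < (N::nat)" "x \<in> carrier G"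
  shows "(\<Oplus>\<^bsub>G\<^esub>j\<in>{..<N}. if j = k then x else \<zero>\<^bsub>G\<^esub>) = x"
proof -
  interpret G: abelian_monoid G by fact
  show ?thesis using G.finsum_singleton[of k "{..<N}" "\<lambda>_. x"] assms
    by (simp add: eq_commute[of k])
qed

text \<open>The integers are dense for the topology given by the ideals k R. This lets elements of a
  completed lattice be approximated by elements of the lattice.\<close>

locale dense_ring = torsion_free_ring +
  assumes dense: "\<lbrakk>z \<in> carrier R; (k::int) > 0\<rbrakk> \<Longrightarrow> \<exists>t::int. \<exists>w\<in>carrier R. z = [t] \<cdot> \<one> \<oplus> [k] \<cdot> w"

section \<open>Extension of an algebra to Z and completion of its lattices\<close>

locale extension = B: rat_basis B n e c + Z: dense_ring Z
  for B :: "('b, 'm) ring_scheme" and n e c and Z :: "('z, 'w) ring_scheme"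
begin

abbreviation "A \<equiv> tensor_ring Z rat_ring"
abbreviation "T \<equiv> scalar_ext Z B"
abbreviation "emb \<equiv> scalar_ext_embed Z B"

text \<open>The pure tensors with integral second factor: those with x in L generate the completion
  of L, and every element of \<open>T\<close> has a positive multiple that is a sum of them.\<close>

definition elem :: "'b \<Rightarrow> 'z \<Rightarrow> ('b \<times> (('z \<times> rat) \<Rightarrow>\<^sub>0 int) set \<Rightarrow>\<^sub>0 int) set" where
  "elem x z = pure_tensor B A x (pure_tensor Z rat_ring z 1)"

sublocale Q: ring_pair Z rat_ring by (rule Z.ring_pair_rat)

sublocale S: ring_pair B A
  by (intro ring_pair.intro B.ring_axioms Q.T.ring_axioms)

sublocale T: ring T
  unfolding scalar_ext_def by (rule S.T.ring_axioms)

lemma elem_closed [simp, intro]: "x \<in> carrier B \<Longrightarrow> z \<in> carrier Z \<Longrightarrow> elem x z \<in> carrier T"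
  by (simp add: elem_def scalar_ext_def)

lemma elem_mult:
  "\<lbrakk>x \<in> carrier B; y \<in> carrier B; z \<in> carrier Z; w \<in> carrier Z\<rbrakk> \<Longrightarrow>
    elem x z \<otimes>\<^bsub>T\<^esub> elem y w = elem (x \<otimes>\<^bsub>B\<^esub> y) (z \<otimes>\<^bsub>Z\<^esub> w)"
  by (simp add: elem_def scalar_ext_def S.pure_mult Q.pure_mult)

lemma elem_add_left:
  "\<lbrakk>x \<in> carrier B; y \<in> carrier B; z \<in> carrier Z\<rbrakk> \<Longrightarrow> elem (x \<oplus>\<^bsub>B\<^esub> y) z = elem x z \<oplus>\<^bsub>T\<^esub> elem y z"
  by (simp add: elem_def scalar_ext_def S.pure_add_left)

lemma elem_add_right:
  "\<lbrakk>x \<in> carrier B; z \<in> carrier Z; w \<in> carrier Z\<rbrakk> \<Longrightarrow> elem x (z \<oplus>\<^bsub>Z\<^esub> w) = elem x z \<oplus>\<^bsub>T\<^esub> elem x w"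
  by (simp add: elem_def scalar_ext_def S.pure_add_right Q.pure_add_left)

lemma elem_left_hom: "z \<in> carrier Z \<Longrightarrow> abelian_group_hom B T (\<lambda>x. elem x z)"
  by (rule abelian_group_homI') (auto simp: elem_add_left B.is_abelian_group T.is_abelian_group)

lemma elem_right_hom: "x \<in> carrier B \<Longrightarrow> abelian_group_hom Z T (elem x)"
  by (rule abelian_group_homI') (auto simp: elem_add_right Z.is_abelian_group T.is_abelian_group)

lemma elem_zmult:
  assumes "x \<in> carrier B" "z \<in> carrier Z"
  shows "[(k::int)] \<cdot>\<^bsub>T\<^esub> elem x z = elem ([k] \<cdot>\<^bsub>B\<^esub> x) z" "[(k::int)] \<cdot>\<^bsub>T\<^esub> elem x z = elem x ([k] \<cdot>\<^bsub>Z\<^esub> z)"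
  using abelian_group_hom.hom_zmult[OF elem_left_hom] abelian_group_hom.hom_zmult[OF elem_right_hom] assms
  by auto

lemma emb_elem: "emb x = elem x \<one>\<^bsub>Z\<^esub>"
  using Q.pure_one by (simp add: scalar_ext_embed_def elem_def)

lemma emb_hom: "emb \<in> ring_hom B T"
proof (rule ring_hom_memI)
  show "emb \<one>\<^bsub>B\<^esub> = \<one>\<^bsub>T\<^esub>"
    unfolding scalar_ext_embed_def scalar_ext_def by (rule S.pure_one)
qed (auto simp: emb_elem elem_mult elem_add_left)

lemma emb_closed [simp, intro]: "x \<in> carrier B \<Longrightarrow> emb x \<in> carrier T"
  by (simp add: emb_elem)

lemma emb_mult: "\<lbrakk>x \<in> carrier B; y \<in> carrier B\<rbrakk> \<Longrightarrow> emb (x \<otimes>\<^bsub>B\<^esub> y) = emb x \<otimes>\<^bsub>T\<^esub> emb y"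
  using ring_hom_mult[OF emb_hom] by simp

lemma emb_one [simp]: "emb \<one>\<^bsub>B\<^esub> = \<one>\<^bsub>T\<^esub>"
  using ring_hom_one[OF emb_hom] .

sublocale emb: abelian_group_hom B T emb
  by (rule ring_hom_abelian_group_hom[OF B.ring_axioms T.ring_axioms emb_hom])

lemma emb_rat_hom: "(\<lambda>q. emb (rat_in B q)) \<in> ring_hom rat_ring T"
  by (rule ring_hom_memI) (auto simp: B.\<rho>_add B.\<rho>_mult emb_mult)

sublocale R: rat_hom T "\<lambda>q. emb (rat_in B q)"
  by unfold_locales (rule emb_rat_hom)

lemma rat_pure_hom: "pure_tensor Z rat_ring \<one>\<^bsub>Z\<^esub> \<in> ring_hom rat_ring A"
proof (rule ring_hom_memI)
  fix p q :: rat
  show "pure_tensor Z rat_ring \<one>\<^bsub>Z\<^esub> (p \<otimes>\<^bsub>rat_ring\<^esub> q)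
      = pure_tensor Z rat_ring \<one>\<^bsub>Z\<^esub> p \<otimes>\<^bsub>A\<^esub> pure_tensor Z rat_ring \<one>\<^bsub>Z\<^esub> q"
    by (simp add: Q.pure_mult)
  show "pure_tensor Z rat_ring \<one>\<^bsub>Z\<^esub> (p \<oplus>\<^bsub>rat_ring\<^esub> q)
      = pure_tensor Z rat_ring \<one>\<^bsub>Z\<^esub> p \<oplus>\<^bsub>A\<^esub> pure_tensor Z rat_ring \<one>\<^bsub>Z\<^esub> q"
    using Q.pure_add_right[of "\<one>\<^bsub>Z\<^esub>" p q] by simp
  show "pure_tensor Z rat_ring \<one>\<^bsub>Z\<^esub> \<one>\<^bsub>rat_ring\<^esub> = \<one>\<^bsub>A\<^esub>"
    using Q.pure_one by simp
qed simp

sublocale RA: rat_hom A "pure_tensor Z rat_ring \<one>\<^bsub>Z\<^esub>"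
  by unfold_locales (rule rat_pure_hom)

text \<open>Multiplying the second factor by the rational \<open>c j x\<close> is biadditive, so the
  functional on B extends to the tensor product.\<close>

lemma coordinate_hom:
  "\<exists>\<phi>. abelian_group_hom T A \<phi> \<and> (\<forall>x\<in>carrier B. \<forall>a\<in>carrier A.
    \<phi> (pure_tensor B A x a) = pure_tensor Z rat_ring \<one>\<^bsub>Z\<^esub> (c j x) \<otimes>\<^bsub>A\<^esub> a)"
  unfolding scalar_ext_def using Q.T.is_abelian_group
  by (rule S.tensor_lift) (auto simp: B.c_add RA.\<rho>_add Q.T.l_distr Q.T.r_distr)

definition coord :: "nat \<Rightarrow> ('b \<times> (('z \<times> rat) \<Rightarrow>\<^sub>0 int) set \<Rightarrow>\<^sub>0 int) set \<Rightarrow> (('z \<times> rat) \<Rightarrow>\<^sub>0 int) set" where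
  "coord j = (SOME \<phi>. abelian_group_hom T A \<phi> \<and> (\<forall>x\<in>carrier B. \<forall>a\<in>carrier A.
    \<phi> (pure_tensor B A x a) = pure_tensor Z rat_ring \<one>\<^bsub>Z\<^esub> (c j x) \<otimes>\<^bsub>A\<^esub> a))"

lemma coord_props: "abelian_group_hom T A (coord j)"
  "\<lbrakk>x \<in> carrier B; a \<in> carrier A\<rbrakk> \<Longrightarrow> coord j (pure_tensor B A x a) = pure_tensor Z rat_ring \<one>\<^bsub>Z\<^esub> (c j x) \<otimes>\<^bsub>A\<^esub> a"
  using someI_ex[OF coordinate_hom[of j]] unfolding coord_def by blast+

sublocale coord: abelian_group_hom T A "coord j" for j
  by (rule coord_props)

lemma coord_elem:
  "\<lbrakk>x \<in> carrier B; z \<in> carrier Z\<rbrakk> \<Longrightarrow> coord j (elem x z) = pure_tensor Z rat_ring z (c j x)"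
  by (simp add: elem_def coord_props Q.pure_mult)

definition comb :: "(nat \<Rightarrow> 'z) \<Rightarrow> ('b \<times> (('z \<times> rat) \<Rightarrow>\<^sub>0 int) set \<Rightarrow>\<^sub>0 int) set" where
  "comb z = (\<Oplus>\<^bsub>T\<^esub>j\<in>{..<n}. elem (e j) (z j))"

lemma comb_closed: "(\<And>j. j < n \<Longrightarrow> z j \<in> carrier Z) \<Longrightarrow> comb z \<in> carrier T"
  unfolding comb_def by (rule T.finsum_closed) auto

lemma coord_comb:
  assumes z: "\<And>j. j < n \<Longrightarrow> z j \<in> carrier Z" and k: "k < n"
  shows "coord k (comb z) = pure_tensor Z rat_ring (z k) 1"
proof -
  have "coord k (comb z) = (\<Oplus>\<^bsub>A\<^esub>j\<in>{..<n}. coord k (elem (e j) (z j)))"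
    unfolding comb_def by (rule coord.hom_finsum') (use z in auto)
  also have "\<dots> = (\<Oplus>\<^bsub>A\<^esub>j\<in>{..<n}. if j = k then pure_tensor Z rat_ring (z k) 1 else \<zero>\<^bsub>A\<^esub>)"
  proof (rule Q.T.finsum_cong')
    fix j assume "j \<in> {..<n}"
    moreover have "pure_tensor Z rat_ring x 0 = \<zero>\<^bsub>A\<^esub>" if "x \<in> carrier Z" for x
      using abelian_group_hom.hom_zero[OF Q.pure_right_hom[OF that]] by simp
    ultimately show "coord k (elem (e j) (z j)) = (if j = k then pure_tensor Z rat_ring (z k) 1 else \<zero>\<^bsub>A\<^esub>)"
      using z k by (auto simp: coord_elem B.c_e)
  qed (use z k in auto)
  also have "\<dots> = pure_tensor Z rat_ring (z k) 1"
    by (rule finsum_single) (use z k in \<open>auto simp: Q.T.abelian_monoid_axioms\<close>)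
  finally show ?thesis .
qed

lemma pure_one_inj:
  assumes "pure_tensor Z rat_ring z 1 = pure_tensor Z rat_ring w 1" "z \<in> carrier Z" "w \<in> carrier Z"
  shows "z = w"
proof -
  interpret h: abelian_group_hom Z A "\<lambda>z. pure_tensor Z rat_ring z 1"
    by (rule Q.pure_left_hom) simp
  have "pure_tensor Z rat_ring (z \<ominus>\<^bsub>Z\<^esub> w) 1 = \<zero>\<^bsub>A\<^esub>"
    unfolding h.hom_diff[OF assms(2,3)] assms(1) using assms(3) by (simp add: a_minus_def Q.T.r_neg)
  with Z.minus_closed[OF assms(2,3)] have "z \<ominus>\<^bsub>Z\<^esub> w = \<zero>\<^bsub>Z\<^esub>" by (rule Z.pure_one_eq_zero)
  then show ?thesis by (rule Z.diff_eq_zero[OF assms(2,3)])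
qed

text \<open>The extended coordinates return the coefficients tensored with 1, and Z is embedded in
  its tensor product with the rationals. Hence the completion of the standard lattice is free over
  Z.\<close>

lemma comb_inj:
  assumes "comb z = comb w" "\<And>j. j < n \<Longrightarrow> z j \<in> carrier Z" "\<And>j. j < n \<Longrightarrow> w j \<in> carrier Z" "j < n"
  shows "z j = w j"
  using pure_one_inj[of "z j" "w j"] coord_comb[of z j] coord_comb[of w j] assms by simp

lemma comb_add:
  assumes "\<And>j. j < n \<Longrightarrow> z j \<in> carrier Z" "\<And>j. j < n \<Longrightarrow> w j \<in> carrier Z"
  shows "comb (\<lambda>j. z j \<oplus>\<^bsub>Z\<^esub> w j) = comb z \<oplus>\<^bsub>T\<^esub> comb w"
proof -
  have "comb (\<lambda>j. z j \<oplus>\<^bsub>Z\<^esub> w j) = (\<Oplus>\<^bsub>T\<^esub>j\<in>{..<n}. elem (e j) (z j) \<oplus>\<^bsub>T\<^esub> elem (e j) (w j))"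
    unfolding comb_def by (rule T.finsum_cong') (use assms in \<open>simp_all add: elem_add_right\<close>)
  also have "\<dots> = comb z \<oplus>\<^bsub>T\<^esub> comb w"
    unfolding comb_def by (rule T.finsum_addf) (use assms in auto)
  finally show ?thesis .
qed

lemma comb_zmult:
  assumes "\<And>j. j < n \<Longrightarrow> z j \<in> carrier Z"
  shows "comb (\<lambda>j. [(k::int)] \<cdot>\<^bsub>Z\<^esub> z j) = [k] \<cdot>\<^bsub>T\<^esub> comb z"
proof -
  interpret h: abelian_group_hom T T "\<lambda>x. [k] \<cdot>\<^bsub>T\<^esub> x"
    by (rule abelian_group_homI') (auto simp: T.is_abelian_group T.zmult_distrib)
  have "[k] \<cdot>\<^bsub>T\<^esub> comb z = (\<Oplus>\<^bsub>T\<^esub>j\<in>{..<n}. [k] \<cdot>\<^bsub>T\<^esub> elem (e j) (z j))"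
    unfolding comb_def by (rule h.hom_finsum') (use assms in auto)
  also have "\<dots> = comb (\<lambda>j. [k] \<cdot>\<^bsub>Z\<^esub> z j)"
    unfolding comb_def by (rule T.finsum_cong') (use assms in \<open>simp_all add: elem_zmult(2)\<close>)
  finally show ?thesis ..
qed

lemma comb_diff:
  assumes "\<And>j. j < n \<Longrightarrow> z j \<in> carrier Z" "\<And>j. j < n \<Longrightarrow> w j \<in> carrier Z"
  shows "comb (\<lambda>j. z j \<ominus>\<^bsub>Z\<^esub> w j) = comb z \<ominus>\<^bsub>T\<^esub> comb w"
proof -
  have "comb (\<lambda>j. z j \<ominus>\<^bsub>Z\<^esub> w j) = comb (\<lambda>j. z j \<oplus>\<^bsub>Z\<^esub> [(-1::int)] \<cdot>\<^bsub>Z\<^esub> w j)"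
    unfolding comb_def
    by (rule T.finsum_cong') (use assms Z.zmult_neg[of _ 1] in \<open>auto simp: a_minus_def\<close>)
  also have "\<dots> = comb z \<ominus>\<^bsub>T\<^esub> comb w"
    using assms T.zmult_neg[of "comb w" 1] comb_closed[of w] by (simp add: comb_add comb_zmult a_minus_def)
  finally show ?thesis .
qed

lemma elem_std:
  assumes "x \<in> B.std_lattice" "z \<in> carrier Z"
  obtains w where "\<And>j. j < n \<Longrightarrow> w j \<in> carrier Z" "elem x z = comb w"
proof -
  obtain k :: "nat \<Rightarrow> int" where k: "x = (\<Oplus>\<^bsub>B\<^esub>j\<in>{..<n}. [(k j)] \<cdot>\<^bsub>B\<^esub> e j)" using B.std_expand[OF assms(1)] by metis
  interpret h: abelian_group_hom B T "\<lambda>x. elem x z" by (rule elem_left_hom) fact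
  have "elem x z = (\<Oplus>\<^bsub>T\<^esub>j\<in>{..<n}. elem ([(k j)] \<cdot>\<^bsub>B\<^esub> e j) z)"
    unfolding k by (rule h.hom_finsum') auto
  also have "\<dots> = comb (\<lambda>j. [(k j)] \<cdot>\<^bsub>Z\<^esub> z)"
    unfolding comb_def using assms by (intro T.finsum_cong') (auto simp flip: elem_zmult)
  finally show ?thesis using assms by (intro that) auto
qed

text \<open>Two denominators occur for a pure tensor: one makes the coefficient integral, the other
  moves the element of B into the standard lattice, where it can be expanded along the
  basis.\<close>

lemma T_cases:
  assumes "t \<in> carrier T"
  shows "\<exists>m::int. \<exists>z. m > 0 \<and> (\<forall>j<n. z j \<in> carrier Z) \<and> [m] \<cdot>\<^bsub>T\<^esub> t = comb z"
  using assms unfolding scalar_ext_def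
proof (induction t rule: S.tensor_induct)
  case (pure x a)
  obtain m z where m: "m > 0" "z \<in> carrier Z" "[(m::int)] \<cdot>\<^bsub>A\<^esub> a = pure_tensor Z rat_ring z 1"
    using Z.ext_rat_cases[OF pure(2)] by blast
  obtain m' where m': "m' > 0" "[(m'::int)] \<cdot>\<^bsub>B\<^esub> x \<in> B.std_lattice"
    using B.zmult_in_std[OF pure(1)] by blast
  obtain w where w: "\<And>j. j < n \<Longrightarrow> w j \<in> carrier Z" "elem ([m'] \<cdot>\<^bsub>B\<^esub> x) z = comb w"
    using elem_std[OF m'(2) m(2)] by metis
  have "[(m' * m)] \<cdot>\<^bsub>tensor_ring B A\<^esub> pure_tensor B A x a
      = [m'] \<cdot>\<^bsub>tensor_ring B A\<^esub> ([m] \<cdot>\<^bsub>tensor_ring B A\<^esub> pure_tensor B A x a)"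
    using pure by (simp add: S.T.zmult_zmult)
  also have "\<dots> = [m'] \<cdot>\<^bsub>tensor_ring B A\<^esub> (pure_tensor B A x ([m] \<cdot>\<^bsub>A\<^esub> a))"
    using pure by (simp only: S.pure_zmult(2))
  also have "\<dots> = pure_tensor B A ([m'] \<cdot>\<^bsub>B\<^esub> x) ([m] \<cdot>\<^bsub>A\<^esub> a)"
    using pure by (intro S.pure_zmult(1)) auto
  also have "\<dots> = comb w" using w m by (simp add: elem_def)
  finally show ?case using m m' w by (intro exI[of _ "m' * m"] exI[of _ w]) simp
next
  case (diff s t)
  from diff(3) obtain m z where s: "m > 0" "\<forall>j<n. z j \<in> carrier Z" "[(m::int)] \<cdot>\<^bsub>T\<^esub> s = comb z"
    unfolding scalar_ext_def by blast
  from diff(4) obtain m' w where t: "m' > 0" "\<forall>j<n. w j \<in> carrier Z" "[(m'::int)] \<cdot>\<^bsub>T\<^esub> t = comb w"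
    unfolding scalar_ext_def by blast
  have c: "s \<in> carrier T" "t \<in> carrier T" using diff unfolding scalar_ext_def by auto
  have "[(m * m')] \<cdot>\<^bsub>T\<^esub> (s \<ominus>\<^bsub>T\<^esub> t) = [m'] \<cdot>\<^bsub>T\<^esub> ([m] \<cdot>\<^bsub>T\<^esub> s) \<ominus>\<^bsub>T\<^esub> [m] \<cdot>\<^bsub>T\<^esub> ([m'] \<cdot>\<^bsub>T\<^esub> t)"
    using c by (simp add: T.zmult_diff T.zmult_zmult mult.commute)
  also have "\<dots> = comb (\<lambda>j. [m'] \<cdot>\<^bsub>Z\<^esub> z j \<ominus>\<^bsub>Z\<^esub> [m] \<cdot>\<^bsub>Z\<^esub> w j)"
    using s t by (simp add: comb_diff comb_zmult)
  finally show ?case unfolding scalar_ext_def[symmetric] using s t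
    by (intro exI[of _ "m * m'"] exI[of _ "\<lambda>j. [m'] \<cdot>\<^bsub>Z\<^esub> z j \<ominus>\<^bsub>Z\<^esub> [m] \<cdot>\<^bsub>Z\<^esub> w j"]) simp
qed

abbreviation "ext L \<equiv> lattice_ext Z B L"

lemma ext_def: "ext L = generate (add_monoid T) {elem x z | x z. x \<in> L \<and> z \<in> carrier Z}"
  unfolding lattice_ext_def elem_def ..

lemma ext_gens_closed: "L \<subseteq> carrier B \<Longrightarrow> {elem x z | x z. x \<in> L \<and> z \<in> carrier Z} \<subseteq> carrier T"
  by auto

lemma ext_closed: "L \<subseteq> carrier B \<Longrightarrow> ext L \<subseteq> carrier T"
  unfolding ext_def using T.add.generate_incl[OF ext_gens_closed] by simp

lemma ext_subgroup: "L \<subseteq> carrier B \<Longrightarrow> subgroup (ext L) (add_monoid T)"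
  unfolding ext_def using T.add.generate_is_subgroup[OF ext_gens_closed] by simp

lemma ext_add: "L \<subseteq> carrier B \<Longrightarrow> x \<in> ext L \<Longrightarrow> y \<in> ext L \<Longrightarrow> x \<oplus>\<^bsub>T\<^esub> y \<in> ext L"
  using subgroup.m_closed[OF ext_subgroup] by simp

lemma ext_zero: "L \<subseteq> carrier B \<Longrightarrow> \<zero>\<^bsub>T\<^esub> \<in> ext L"
  using subgroup.one_closed[OF ext_subgroup] by simp

lemma ext_minus: "L \<subseteq> carrier B \<Longrightarrow> x \<in> ext L \<Longrightarrow> \<ominus>\<^bsub>T\<^esub> x \<in> ext L"
  using subgroup.m_inv_closed[OF ext_subgroup] by (simp add: a_inv_def)

lemma ext_diff: "L \<subseteq> carrier B \<Longrightarrow> x \<in> ext L \<Longrightarrow> y \<in> ext L \<Longrightarrow> x \<ominus>\<^bsub>T\<^esub> y \<in> ext L"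
  by (simp add: a_minus_def ext_add ext_minus)

lemma ext_zmult: "L \<subseteq> carrier B \<Longrightarrow> x \<in> ext L \<Longrightarrow> [(k::int)] \<cdot>\<^bsub>T\<^esub> x \<in> ext L"
  unfolding ext_def by (rule T.generate_zmult[OF _ ext_gens_closed])

lemma elem_in_ext: "x \<in> L \<Longrightarrow> z \<in> carrier Z \<Longrightarrow> elem x z \<in> ext L"
  unfolding ext_def by (rule generate.incl) blast

lemma emb_in_ext: "x \<in> L \<Longrightarrow> emb x \<in> ext L"
  by (simp add: emb_elem elem_in_ext)

lemma ext_induct [consumes 2, case_names elem zero diff]:
  assumes "y \<in> ext L" "L \<subseteq> carrier B"
    "\<And>x z. \<lbrakk>x \<in> L; z \<in> carrier Z\<rbrakk> \<Longrightarrow> P (elem x z)" "P \<zero>\<^bsub>T\<^esub>"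
    "\<And>x y. \<lbrakk>x \<in> carrier T; y \<in> carrier T; P x; P y\<rbrakk> \<Longrightarrow> P (x \<ominus>\<^bsub>T\<^esub> y)"
  shows "P y"
  using assms(1)[unfolded ext_def] ext_gens_closed[OF assms(2)]
  by (rule T.generate_add_induct) (use assms(3-) in auto)

text \<open>The standard lattice is the one lattice whose completion is described by coordinates;
  every other lattice is compared with it.\<close>

lemma ext_std: "ext B.std_lattice = comb ` {z. \<forall>j<n. z j \<in> carrier Z}"
proof
  show "ext B.std_lattice \<subseteq> comb ` {z. \<forall>j<n. z j \<in> carrier Z}"
  proof
    fix y assume "y \<in> ext B.std_lattice"
    then have "\<exists>z. (\<forall>j<n. z j \<in> carrier Z) \<and> y = comb z" using B.std_subset
    proof (induction y rule: ext_induct)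
      case (elem x z)
      then show ?case using elem_std by metis
    next
      case zero
      show ?case using comb_zmult[of "\<lambda>_. \<zero>\<^bsub>Z\<^esub>" 0] comb_closed[of "\<lambda>_. \<zero>\<^bsub>Z\<^esub>"]
        by (intro exI[of _ "\<lambda>_. \<zero>\<^bsub>Z\<^esub>"]) auto
    next
      case (diff x y)
      then obtain z w where "\<forall>j<n. z j \<in> carrier Z" "x = comb z" "\<forall>j<n. w j \<in> carrier Z" "y = comb w"
        by blast
      then show ?case by (intro exI[of _ "\<lambda>j. z j \<ominus>\<^bsub>Z\<^esub> w j"]) (simp add: comb_diff)
    qed
    then show "y \<in> comb ` {z. \<forall>j<n. z j \<in> carrier Z}" by blast
  qed
  have fin: "(\<Oplus>\<^bsub>T\<^esub>j\<in>{..<k}. elem (e j) (z j)) \<in> ext B.std_lattice"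
    if "\<forall>j<n. z j \<in> carrier Z" "k \<le> n" for z and k :: nat
    using that(2)
  proof (induction k)
    case 0
    then show ?case using ext_zero[OF B.std_subset] by simp
  next
    case (Suc k)
    then have "(\<Oplus>\<^bsub>T\<^esub>j\<in>{..<Suc k}. elem (e j) (z j)) = elem (e k) (z k) \<oplus>\<^bsub>T\<^esub> (\<Oplus>\<^bsub>T\<^esub>j\<in>{..<k}. elem (e j) (z j))"
      using that by (simp add: lessThan_Suc Pi_def)
    then show ?case using Suc that by (auto intro!: ext_add B.std_subset elem_in_ext B.e_in_std)
  qed
  show "comb ` {z. \<forall>j<n. z j \<in> carrier Z} \<subseteq> ext B.std_lattice"
    unfolding comb_def using fin[of _ n] by blast
qed

lemma zmult_in_ext_std:
  assumes "t \<in> carrier T"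
  shows "\<exists>m>0. [(m::int)] \<cdot>\<^bsub>T\<^esub> t \<in> ext B.std_lattice"
  using T_cases[OF assms] unfolding ext_std by blast

text \<open>The coordinate p/q of x is also given by some w in Z, and injectivity of Z into the
  extension brings the equation q w = p back to Z. Over the l-adic integers this will exclude l from
  the denominator.\<close>

lemma emb_in_ext_std:
  assumes x: "x \<in> carrier B" and mem: "emb x \<in> ext B.std_lattice" and j: "j < n"
    and q: "c j x * of_int q = of_int p"
  shows "\<exists>w\<in>carrier Z. [q] \<cdot>\<^bsub>Z\<^esub> w = [p] \<cdot>\<^bsub>Z\<^esub> \<one>\<^bsub>Z\<^esub>"
proof -
  obtain w where w: "\<forall>j<n. w j \<in> carrier Z" "emb x = comb w" using mem unfolding ext_std by blast
  have "pure_tensor Z rat_ring \<one>\<^bsub>Z\<^esub> (c j x) = coord j (emb x)"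
    using x by (simp add: emb_elem coord_elem)
  also have "\<dots> = pure_tensor Z rat_ring (w j) 1" using w j by (simp add: coord_comb)
  finally have "[q] \<cdot>\<^bsub>A\<^esub> pure_tensor Z rat_ring \<one>\<^bsub>Z\<^esub> (c j x) = [q] \<cdot>\<^bsub>A\<^esub> pure_tensor Z rat_ring (w j) 1"
    by simp
  moreover have "[q] \<cdot>\<^bsub>A\<^esub> pure_tensor Z rat_ring \<one>\<^bsub>Z\<^esub> (c j x) = pure_tensor Z rat_ring \<one>\<^bsub>Z\<^esub> (of_int p)"
    using q by (simp add: Q.pure_zmult(2) mult.commute)
  moreover have "\<dots> = pure_tensor Z rat_ring ([p] \<cdot>\<^bsub>Z\<^esub> \<one>\<^bsub>Z\<^esub>) 1"
    using Q.pure_zmult[of "\<one>\<^bsub>Z\<^esub>" 1 p] by simp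
  moreover have "[q] \<cdot>\<^bsub>A\<^esub> pure_tensor Z rat_ring (w j) 1 = pure_tensor Z rat_ring ([q] \<cdot>\<^bsub>Z\<^esub> w j) 1"
    using w j by (simp add: Q.pure_zmult(1))
  ultimately have "pure_tensor Z rat_ring ([q] \<cdot>\<^bsub>Z\<^esub> w j) 1 = pure_tensor Z rat_ring ([p] \<cdot>\<^bsub>Z\<^esub> \<one>\<^bsub>Z\<^esub>) 1"
    by simp
  then show ?thesis using w j pure_one_inj by blast
qed

lemma ext_zmult_subset:
  assumes L: "L \<subseteq> carrier B" "\<And>x. x \<in> L' \<Longrightarrow> [(N::int)] \<cdot>\<^bsub>B\<^esub> x \<in> L" "L' \<subseteq> carrier B"
    and s: "s \<in> ext L'"
  shows "[N] \<cdot>\<^bsub>T\<^esub> s \<in> ext L"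
  using s L(3)
proof (induction s rule: ext_induct)
  case (elem x z)
  then show ?case using L elem_in_ext by (auto simp: elem_zmult(1))
qed (use L in \<open>auto simp: T.zmult_diff ext_diff ext_zero\<close>)

text \<open>For a generator x tensor z choose M with M x in the standard lattice and write z = t + N
  M w; this gives t x plus N times (M x tensor w). The modulus N M, not N, makes up for x lying
  outside the standard lattice.\<close>

lemma ext_decompose:
  assumes L: "L \<subseteq> carrier B" "subgroup L (add_monoid B)" and N: "(N::int) > 0" and y: "y \<in> ext L"
  shows "\<exists>x\<in>L. \<exists>s\<in>ext B.std_lattice. y = emb x \<oplus>\<^bsub>T\<^esub> [N] \<cdot>\<^bsub>T\<^esub> s"
  using y L(1)
proof (induction y rule: ext_induct)
  case (elem x z)
  then have x: "x \<in> carrier B" using L by auto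
  obtain M where M: "M > 0" "[(M::int)] \<cdot>\<^bsub>B\<^esub> x \<in> B.std_lattice" using B.zmult_in_std[OF x] by blast
  have "N * M > 0" using M N by simp
  from Z.dense[OF elem(2) this] obtain t :: int
    where "\<exists>w\<in>carrier Z. z = [t] \<cdot>\<^bsub>Z\<^esub> \<one>\<^bsub>Z\<^esub> \<oplus>\<^bsub>Z\<^esub> [(N * M)] \<cdot>\<^bsub>Z\<^esub> w" ..
  then obtain w where t: "w \<in> carrier Z" "z = [t] \<cdot>\<^bsub>Z\<^esub> \<one>\<^bsub>Z\<^esub> \<oplus>\<^bsub>Z\<^esub> [(N * M)] \<cdot>\<^bsub>Z\<^esub> w" ..
  have "elem x z = elem x ([t] \<cdot>\<^bsub>Z\<^esub> \<one>\<^bsub>Z\<^esub>) \<oplus>\<^bsub>T\<^esub> elem x ([(N * M)] \<cdot>\<^bsub>Z\<^esub> w)"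
    using x t by (simp add: elem_add_right)
  also have "elem x ([t] \<cdot>\<^bsub>Z\<^esub> \<one>\<^bsub>Z\<^esub>) = emb ([t] \<cdot>\<^bsub>B\<^esub> x)"
    using x elem_zmult[of x "\<one>\<^bsub>Z\<^esub>" t] by (simp add: emb_elem)
  also have "elem x ([(N * M)] \<cdot>\<^bsub>Z\<^esub> w) = [N] \<cdot>\<^bsub>T\<^esub> elem ([M] \<cdot>\<^bsub>B\<^esub> x) w"
    using x t elem_zmult[of x w] T.zmult_zmult[of "elem x w" N M] by simp
  finally show ?case
    using elem_in_ext[OF M(2) t(1)] B.add.subgroup_int_pow_closed[OF L(2) elem(1), of t] by blast
next
  case zero
  have "\<zero>\<^bsub>B\<^esub> \<in> L" using subgroup.one_closed[OF L(2)] by simp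
  moreover have "\<zero>\<^bsub>T\<^esub> = emb \<zero>\<^bsub>B\<^esub> \<oplus>\<^bsub>T\<^esub> [N] \<cdot>\<^bsub>T\<^esub> \<zero>\<^bsub>T\<^esub>" by simp
  ultimately show ?case using ext_zero[OF B.std_subset] by blast
next
  case (diff y y')
  then obtain x s x' s' where *: "x \<in> L" "s \<in> ext B.std_lattice" "y = emb x \<oplus>\<^bsub>T\<^esub> [N] \<cdot>\<^bsub>T\<^esub> s"
    "x' \<in> L" "s' \<in> ext B.std_lattice" "y' = emb x' \<oplus>\<^bsub>T\<^esub> [N] \<cdot>\<^bsub>T\<^esub> s'" by blast
  then have c: "x \<in> carrier B" "x' \<in> carrier B" "s \<in> carrier T" "s' \<in> carrier T"
    using L ext_closed[OF B.std_subset] by auto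
  have "y \<ominus>\<^bsub>T\<^esub> y' = emb (x \<ominus>\<^bsub>B\<^esub> x') \<oplus>\<^bsub>T\<^esub> [N] \<cdot>\<^bsub>T\<^esub> (s \<ominus>\<^bsub>T\<^esub> s')"
    using c * by (simp add: T.zmult_distrib T.zmult_minus a_minus_def T.minus_add T.a_ac)
  moreover have "x \<ominus>\<^bsub>B\<^esub> x' \<in> L"
    using subgroup.m_closed[OF L(2) *(1) subgroup.m_inv_closed[OF L(2) *(4)]]
    by (simp add: a_minus_def a_inv_def)
  ultimately show ?case using ext_diff[OF B.std_subset *(2,5)] by blast
qed

text \<open>Bilinearity reduces the claim to generators. With all three lattices equal to R it makes
  the completion of the order closed under products.\<close>

lemma ext_mult:
  assumes L: "L \<subseteq> carrier B" "L' \<subseteq> carrier B" "\<And>x y. x \<in> L \<Longrightarrow> y \<in> L' \<Longrightarrow> x \<otimes>\<^bsub>B\<^esub> y \<in> L''" "L'' \<subseteq> carrier B"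
    and s: "s \<in> ext L" "t \<in> ext L'"
  shows "s \<otimes>\<^bsub>T\<^esub> t \<in> ext L''"
  using s(1) L(1)
proof (induction s rule: ext_induct)
  case (elem x z)
  from s(2) L(2) show ?case
  proof (induction t rule: ext_induct)
    case (elem y w)
    then show ?case using \<open>x \<in> L\<close> \<open>z \<in> _\<close> L by (auto simp: elem_mult subset_iff intro!: elem_in_ext)
  next
    case zero
    have "elem x z \<in> carrier T" using elem L by auto
    then show ?case using ext_zero[OF L(4)] by simp
  next
    case (diff t t')
    have "elem x z \<in> carrier T" using elem L by auto
    then show ?case using diff ext_diff[OF L(4)] by (simp add: a_minus_def T.r_distr T.r_minus)
  qed
next
  case zero
  then show ?case using ext_zero[OF L(4)] s(2) ext_closed[OF L(2)] by auto
next
  case (diff x y)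
  moreover have "t \<in> carrier T" using s(2) ext_closed[OF L(2)] by auto
  ultimately show ?case using ext_diff[OF L(4)] by (simp add: a_minus_def T.l_distr T.l_minus)
qed

end

section \<open>The l-adic and the profinite integers\<close>

text \<open>Approximations compose along the prime factorisation: z = t + p w and w = t' + m w' give
  z = (t + p t') + p m w'.\<close>

lemma (in torsion_free_ring) dense_ring_prime:
  assumes "\<And>p z. \<lbrakk>prime (p::nat); z \<in> carrier R\<rbrakk> \<Longrightarrow> \<exists>t::int. \<exists>w\<in>carrier R. z = [t] \<cdot> \<one> \<oplus> [(int p)] \<cdot> w"
  shows "dense_ring R"
proof unfold_locales
  fix z and k :: int assume z: "z \<in> carrier R" and k: "k > 0"
  have "\<forall>z\<in>carrier R. \<exists>t::int. \<exists>w\<in>carrier R. z = [t] \<cdot> \<one> \<oplus> [(int m)] \<cdot> w" if "m > 0" for m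
    using that
  proof (induction m rule: prime_divisors_induct)
    case (unit m)
    show ?case
    proof
      fix z assume "z \<in> carrier R"
      then have "z = [(0::int)] \<cdot> \<one> \<oplus> [(int m)] \<cdot> z" using unit by simp
      then show "\<exists>t::int. \<exists>w\<in>carrier R. z = [t] \<cdot> \<one> \<oplus> [(int m)] \<cdot> w" using \<open>z \<in> _\<close> by blast
    qed
  next
    case (factor p m)
    show ?case
    proof
      fix z assume z: "z \<in> carrier R"
      from assms[OF factor(1) z] obtain t :: int where "\<exists>w\<in>carrier R. z = [t] \<cdot> \<one> \<oplus> [(int p)] \<cdot> w" ..
      then obtain w where w: "w \<in> carrier R" "z = [t] \<cdot> \<one> \<oplus> [(int p)] \<cdot> w" ..
      have "\<forall>z\<in>carrier R. \<exists>t::int. \<exists>w\<in>carrier R. z = [t] \<cdot> \<one> \<oplus> [(int m)] \<cdot> w" using factor by simp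
      from bspec[OF this w(1)] obtain t' :: int where "\<exists>w'\<in>carrier R. w = [t'] \<cdot> \<one> \<oplus> [(int m)] \<cdot> w'" ..
      then obtain w' where w': "w' \<in> carrier R" "w = [t'] \<cdot> \<one> \<oplus> [(int m)] \<cdot> w'" ..
      have "z = [(t + int p * t')] \<cdot> \<one> \<oplus> [(int (p * m))] \<cdot> w'"
        unfolding w(2) w'(2) using w'(1)
        by (simp add: zmult_distrib zmult_zmult zmult_add a_assoc)
      then show "\<exists>t::int. \<exists>w\<in>carrier R. z = [t] \<cdot> \<one> \<oplus> [(int (p * m))] \<cdot> w" using w'(1) by blast
    qed
  qed simp
  from this[of "nat k"] z k show "\<exists>t::int. \<exists>w\<in>carrier R. z = [t] \<cdot> \<one> \<oplus> [k] \<cdot> w" by simp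
qed

section \<open>The ring of l-adic integers\<close>

lemma residue_ring_simps:
  "carrier (residue_ring m) = {0..m - 1}" "x \<otimes>\<^bsub>residue_ring m\<^esub> y = (x * y) mod m"
  "x \<oplus>\<^bsub>residue_ring m\<^esub> y = (x + y) mod m" "\<one>\<^bsub>residue_ring m\<^esub> = 1" "\<zero>\<^bsub>residue_ring m\<^esub> = 0"
  by (simp_all add: residue_ring_def)

lemma padic_simps:
  "x \<otimes>\<^bsub>padic_int l\<^esub> y = (\<lambda>n. (x n * y n) mod int l ^ Suc n)"
  "x \<oplus>\<^bsub>padic_int l\<^esub> y = (\<lambda>n. (x n + y n) mod int l ^ Suc n)"
  "\<one>\<^bsub>padic_int l\<^esub> = (\<lambda>n. 1)" "\<zero>\<^bsub>padic_int l\<^esub> = (\<lambda>n. 0)"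
  by (simp_all add: padic_int_def residue_ring_simps)

text \<open>Coherence already forces the bounds on the components, as each one is a remainder of the
  next.\<close>

lemma padic_carrier_iff:
  "prime l \<Longrightarrow> x \<in> carrier (padic_int l) \<longleftrightarrow> (\<forall>n. x (Suc n) mod int l ^ Suc n = x n)"
proof -
  assume l: "prime l"
  have "0 \<le> x n \<and> x n \<le> int l ^ Suc n - 1" if "\<forall>n. x (Suc n) mod int l ^ Suc n = x n" for n
    using that l prime_gt_0_nat[OF l] pos_mod_bound[of "int l ^ Suc n" "x (Suc n)"]
      pos_mod_sign[of "int l ^ Suc n" "x (Suc n)"] by (metis of_nat_0_less_iff zero_less_power zle_diff1_eq)
  then show ?thesis unfolding padic_int_def residue_ring_simps by auto
qed

lemma padic_coherent:
  assumes "prime l" "x \<in> carrier (padic_int l)" "k \<le> m"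
  shows "x m mod int l ^ Suc k = x k"
  using assms(3)
proof (induction m rule: dec_induct)
  case base
  have "x k = x (Suc k) mod int l ^ Suc k" using assms by (simp add: padic_carrier_iff)
  then show ?case by (metis mod_mod_trivial)
next
  case (step m)
  have "int l ^ Suc k dvd int l ^ Suc m" using step by (intro le_imp_power_dvd) simp
  then have "x (Suc m) mod int l ^ Suc k = x (Suc m) mod int l ^ Suc m mod int l ^ Suc k"
    by (simp only: mod_mod_cancel)
  then show ?case using step assms by (simp add: padic_carrier_iff del: power_Suc)
qed

text \<open>An l-adic integer may be given by representatives that are compatible only up to
  congruence and are reduced afterwards; negation and division produce such sequences.\<close>

lemma padic_mod_closed:
  assumes "prime l" "\<And>n. [f (Suc n) = f n] (mod int l ^ Suc n)"
  shows "(\<lambda>n. f n mod int l ^ Suc n) \<in> carrier (padic_int l)"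
proof -
  have "f (Suc n) mod int l ^ Suc (Suc n) mod int l ^ Suc n = f n mod int l ^ Suc n" for n
  proof -
    have "f (Suc n) mod int l ^ Suc (Suc n) mod int l ^ Suc n = f (Suc n) mod int l ^ Suc n"
      by (rule mod_mod_cancel) simp
    then show ?thesis using assms(2)[of n] by (simp only: cong_def)
  qed
  then show ?thesis using assms(1) by (simp add: padic_carrier_iff del: power_Suc)
qed

lemma padic_cong:
  assumes "prime l" "x \<in> carrier (padic_int l)"
  shows "[x (Suc n) = x n] (mod int l ^ Suc n)"
  using padic_coherent[OF assms, of n "Suc n"] padic_coherent[OF assms, of n n]
  by (simp only: cong_def le_refl le_SucI)

lemma padic_ring:
  assumes l: "prime l"
  shows "ring (padic_int l)"
proof (rule ringI)
  note cong = padic_cong[OF l]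
  have red: "x n mod int l ^ Suc n = x n" if "x \<in> carrier (padic_int l)" for x n
    using padic_coherent[OF l that, of n n] by simp
  have one_mod: "1 mod int l ^ Suc n = 1" for n
    using prime_gt_1_nat[OF l] by (intro mod_pos_pos_trivial) (auto simp del: power_Suc intro: one_less_power)
  show "abelian_group (padic_int l)"
  proof (rule abelian_groupI)
    fix x y assume "x \<in> carrier (padic_int l)" "y \<in> carrier (padic_int l)"
    then show "x \<oplus>\<^bsub>padic_int l\<^esub> y \<in> carrier (padic_int l)"
      unfolding padic_simps by (intro padic_mod_closed l cong_add cong)
  next
    fix x assume x: "x \<in> carrier (padic_int l)"
    show "\<zero>\<^bsub>padic_int l\<^esub> \<oplus>\<^bsub>padic_int l\<^esub> x = x" unfolding padic_simps using red[OF x] by simp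
    have "(\<lambda>n. (- x n) mod int l ^ Suc n) \<in> carrier (padic_int l)"
      using cong[OF x] by (intro padic_mod_closed l) (simp only: cong_minus_minus_iff)
    moreover have "(\<lambda>n. (- x n) mod int l ^ Suc n) \<oplus>\<^bsub>padic_int l\<^esub> x = \<zero>\<^bsub>padic_int l\<^esub>"
      unfolding padic_simps by (simp add: mod_add_left_eq del: power_Suc)
    ultimately show "\<exists>y\<in>carrier (padic_int l). y \<oplus>\<^bsub>padic_int l\<^esub> x = \<zero>\<^bsub>padic_int l\<^esub>" by blast
  qed (use l in \<open>auto simp: padic_simps padic_carrier_iff mod_simps add_ac\<close>)
  show "monoid (padic_int l)"
  proof (rule monoidI)
    fix x y assume "x \<in> carrier (padic_int l)" "y \<in> carrier (padic_int l)"
    then show "x \<otimes>\<^bsub>padic_int l\<^esub> y \<in> carrier (padic_int l)"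
      unfolding padic_simps by (intro padic_mod_closed l cong_mult cong)
  next
    show "\<one>\<^bsub>padic_int l\<^esub> \<in> carrier (padic_int l)"
      using l one_mod by (simp add: padic_carrier_iff padic_simps del: power_Suc)
  next
    fix x assume x: "x \<in> carrier (padic_int l)"
    show "\<one>\<^bsub>padic_int l\<^esub> \<otimes>\<^bsub>padic_int l\<^esub> x = x" "x \<otimes>\<^bsub>padic_int l\<^esub> \<one>\<^bsub>padic_int l\<^esub> = x"
      unfolding padic_simps using red[OF x] by simp_all
  qed (auto simp: padic_simps mod_simps mult_ac)
qed (auto simp: padic_simps mod_simps algebra_simps)

lemma padic_zmult:
  assumes l: "prime l" and x: "x \<in> carrier (padic_int l)"
  shows "[(k::int)] \<cdot>\<^bsub>padic_int l\<^esub> x = (\<lambda>n. (k * x n) mod int l ^ Suc n)"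
proof -
  interpret ring "padic_int l" by (rule padic_ring[OF l])
  have nat: "[(int j)] \<cdot>\<^bsub>padic_int l\<^esub> x = (\<lambda>n. (int j * x n) mod int l ^ Suc n)" for j
  proof (induction j)
    case 0
    then show ?case by (simp add: padic_simps)
  next
    case (Suc j)
    have "[(int j + 1)] \<cdot>\<^bsub>padic_int l\<^esub> x = [(int j)] \<cdot>\<^bsub>padic_int l\<^esub> x \<oplus>\<^bsub>padic_int l\<^esub> x"
      using x by (subst zmult_add) auto
    then show ?case using Suc
      by (simp add: padic_simps mod_simps algebra_simps del: power_Suc)
  qed
  show ?thesis
  proof (cases "k \<ge> 0")
    case True
    then show ?thesis using nat[of "nat k"] by simp
  next
    case False
    have "(\<lambda>n. (k * x n) mod int l ^ Suc n) \<oplus>\<^bsub>padic_int l\<^esub> [(int (nat (- k)))] \<cdot>\<^bsub>padic_int l\<^esub> x = \<zero>\<^bsub>padic_int l\<^esub>"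
      unfolding nat using False by (simp add: padic_simps mod_simps del: power_Suc)
    moreover have "(\<lambda>n. (k * x n) mod int l ^ Suc n) \<in> carrier (padic_int l)"
      using padic_cong[OF l x] by (intro padic_mod_closed l cong_mult) auto
    ultimately have "\<ominus>\<^bsub>padic_int l\<^esub> ([(int (nat (- k)))] \<cdot>\<^bsub>padic_int l\<^esub> x) = (\<lambda>n. (k * x n) mod int l ^ Suc n)"
      using x by (intro minus_equality) auto
    then show ?thesis using False zmult_neg[OF x, of "int (nat (- k))"] by simp
  qed
qed

text \<open>Division by l costs one power of precision, hence the index shift: the component modulo
  l^(n+2), divided by l, is well defined modulo l^(n+1).\<close>

lemma padic_div_self:
  assumes l: "prime l" and x: "x \<in> carrier (padic_int l)" and x0: "x 0 = 0"
  shows "\<exists>w\<in>carrier (padic_int l). [(int l)] \<cdot>\<^bsub>padic_int l\<^esub> w = x"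
proof
  have l0: "int l > 0" using prime_gt_0_nat[OF l] by simp
  have dvd: "int l dvd x n" for n
    using padic_coherent[OF l x, of 0 n] x0 by (simp add: mod_eq_0_iff_dvd)
  show w: "(\<lambda>n. x (Suc n) div int l) \<in> carrier (padic_int l)"
    unfolding padic_carrier_iff[OF l]
  proof
    fix n
    have "x (Suc n) = x (Suc (Suc n)) mod (int l * int l ^ Suc n)"
      using x unfolding padic_carrier_iff[OF l] power_Suc[of "int l" "Suc n", symmetric] by metis
    also have "\<dots> = int l * ((x (Suc (Suc n)) div int l) mod int l ^ Suc n)"
      using dvd[of "Suc (Suc n)"] by (metis dvd_mult_div_cancel mult_mod_right)
    finally show "x (Suc (Suc n)) div int l mod int l ^ Suc n = x (Suc n) div int l"
      using l0 by simp
  qed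
  show "[(int l)] \<cdot>\<^bsub>padic_int l\<^esub> (\<lambda>n. x (Suc n) div int l) = x"
    unfolding padic_zmult[OF l w] using dvd x by (simp add: padic_carrier_iff[OF l] del: power_Suc)
qed

text \<open>The inverses of m modulo the powers of l are chosen independently. The quotients are
  nevertheless compatible, because m can be cancelled from the congruence between their
  multiples.\<close>

lemma padic_div_coprime:
  assumes l: "prime l" and x: "x \<in> carrier (padic_int l)" and m: "coprime m (int l)"
  shows "\<exists>w\<in>carrier (padic_int l). [m] \<cdot>\<^bsub>padic_int l\<^esub> w = x"
proof -
  have cop: "coprime m (int l ^ Suc n)" for n using m by (simp del: power_Suc)
  have "\<exists>u. [m * u = 1] (mod int l ^ Suc n)" for n by (rule cong_solve_coprime_int[OF cop])
  then obtain u where u: "\<And>n. [m * u n = 1] (mod int l ^ Suc n)" by metis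
  have mu: "[m * (u n * x n) = x n] (mod int l ^ Suc n)" for n
    using cong_scalar_right[OF u[of n], of "x n"] by (simp add: mult.assoc)
  have "[u (Suc n) * x (Suc n) = u n * x n] (mod int l ^ Suc n)" for n
  proof -
    have "[m * (u (Suc n) * x (Suc n)) = x (Suc n)] (mod int l ^ Suc n)"
      by (rule cong_dvd_modulus[OF mu]) simp
    then have "[m * (u (Suc n) * x (Suc n)) = m * (u n * x n)] (mod int l ^ Suc n)"
      using padic_cong[OF l x] mu by (blast intro: cong_trans cong_sym)
    then show ?thesis using cong_mult_lcancel[OF cop] by blast
  qed
  then have w: "(\<lambda>n. u n * x n mod int l ^ Suc n) \<in> carrier (padic_int l)"
    by (rule padic_mod_closed[OF l])
  have "[m] \<cdot>\<^bsub>padic_int l\<^esub> (\<lambda>n. u n * x n mod int l ^ Suc n) = x"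
  proof
    fix n
    have "m * (u n * x n mod int l ^ Suc n) mod int l ^ Suc n = x n mod int l ^ Suc n"
      using mu[of n] by (simp add: cong_def mod_simps del: power_Suc)
    then show "([m] \<cdot>\<^bsub>padic_int l\<^esub> (\<lambda>n. u n * x n mod int l ^ Suc n)) n = x n"
      unfolding padic_zmult[OF l w] using padic_coherent[OF l x, of n n] by simp
  qed
  with w show ?thesis by blast
qed

lemma padic_zmult_one:
  assumes l: "prime l"
  shows "([(k::int)] \<cdot>\<^bsub>padic_int l\<^esub> \<one>\<^bsub>padic_int l\<^esub>) n = k mod int l ^ Suc n"
proof -
  interpret ring "padic_int l" by (rule padic_ring[OF l])
  show ?thesis using padic_zmult[OF l one_closed, of k] by (simp add: padic_simps del: power_Suc)
qed

lemma padic_minus_int: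
  assumes l: "prime l" and x: "x \<in> carrier (padic_int l)"
  shows "(x \<ominus>\<^bsub>padic_int l\<^esub> [t] \<cdot>\<^bsub>padic_int l\<^esub> \<one>\<^bsub>padic_int l\<^esub>) n = (x n - t) mod int l ^ Suc n"
proof -
  interpret ring "padic_int l" by (rule padic_ring[OF l])
  have "x \<ominus>\<^bsub>padic_int l\<^esub> [t] \<cdot>\<^bsub>padic_int l\<^esub> \<one>\<^bsub>padic_int l\<^esub> = x \<oplus>\<^bsub>padic_int l\<^esub> [(- t)] \<cdot>\<^bsub>padic_int l\<^esub> \<one>\<^bsub>padic_int l\<^esub>"
    by (simp add: a_minus_def zmult_neg)
  then show ?thesis
    using padic_zmult_one[OF l, of "- t" n] unfolding padic_simps(2) by (simp add: mod_simps del: power_Suc)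
qed

text \<open>If p = l, then t is the residue of x modulo l and the difference is divisible by l; if
  not, p is invertible and any t will do. This freedom allows a single integer to serve all primes
  at once in the profinite case.\<close>

lemma padic_prime_div:
  assumes l: "prime l" and p: "prime p" and x: "x \<in> carrier (padic_int l)" and t: "l = p \<Longrightarrow> t = x 0"
  shows "\<exists>w\<in>carrier (padic_int l). x = [t] \<cdot>\<^bsub>padic_int l\<^esub> \<one>\<^bsub>padic_int l\<^esub> \<oplus>\<^bsub>padic_int l\<^esub> [(int p)] \<cdot>\<^bsub>padic_int l\<^esub> w"
proof -
  interpret ring "padic_int l" by (rule padic_ring[OF l])
  let ?y = "x \<ominus>\<^bsub>padic_int l\<^esub> [t] \<cdot>\<^bsub>padic_int l\<^esub> \<one>\<^bsub>padic_int l\<^esub>"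
  have y: "?y \<in> carrier (padic_int l)" using x by simp
  have "\<exists>w\<in>carrier (padic_int l). [(int p)] \<cdot>\<^bsub>padic_int l\<^esub> w = ?y"
  proof (cases "l = p")
    case True
    have "?y 0 = 0" unfolding padic_minus_int[OF l x] using t[OF True] by simp
    then show ?thesis using padic_div_self[OF l y] True by simp
  next
    case False
    then have "coprime (int p) (int l)" using l p by (simp add: primes_coprime)
    then show ?thesis by (rule padic_div_coprime[OF l y])
  qed
  then obtain w where w: "w \<in> carrier (padic_int l)" "[(int p)] \<cdot>\<^bsub>padic_int l\<^esub> w = ?y" ..
  have "x = [t] \<cdot>\<^bsub>padic_int l\<^esub> \<one>\<^bsub>padic_int l\<^esub> \<oplus>\<^bsub>padic_int l\<^esub> ?y"
    using x zmult_closed[OF one_closed, of t] by (simp add: a_minus_def a_lcomm r_neg)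
  with w show ?thesis by metis
qed

text \<open>Write k as m times l^a with l not dividing m. Vanishing of k x at index n + a leaves
  l^(n+1) dividing that component, whose reduction is the component of x at n.\<close>

lemma padic_torsion_free:
  assumes l: "prime l"
  shows "torsion_free_ring (padic_int l)"
proof -
  interpret ring "padic_int l" by (rule padic_ring[OF l])
  show ?thesis
  proof unfold_locales
    fix x and k :: int assume x: "x \<in> carrier (padic_int l)" and k: "k > 0"
      and zero: "[k] \<cdot>\<^bsub>padic_int l\<^esub> x = \<zero>\<^bsub>padic_int l\<^esub>"
    have "prime (int l)" using l by simp
    then obtain a m where km: "k = m * int l ^ a" "\<not> int l dvd m"
      using multiplicity_decompose'[of k "int l"] k by (metis less_irrefl mult.commute not_prime_unit)
    have cop: "coprime (int l ^ i) m" for i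
      using km(2) \<open>prime (int l)\<close> prime_imp_power_coprime coprime_commute by blast
    have "x n = 0" for n
    proof -
      have "(k * x (n + a)) mod int l ^ Suc (n + a) = 0"
        using zero unfolding padic_zmult[OF l x] padic_simps by meson
      then have "int l ^ a * int l ^ Suc n dvd int l ^ a * (m * x (n + a))"
        unfolding mod_eq_0_iff_dvd km by (simp add: power_add mult_ac)
      then have "int l ^ Suc n dvd m * x (n + a)" using prime_gt_0_nat[OF l] by simp
      then have "int l ^ Suc n dvd x (n + a)" using cop coprime_dvd_mult_right_iff by blast
      then show ?thesis using padic_coherent[OF l x, of n "n + a"] by (simp del: power_Suc)
    qed
    then show "x = \<zero>\<^bsub>padic_int l\<^esub>" by (auto simp: padic_simps)
  qed
qed

lemma padic_dense:
  assumes l: "prime l"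
  shows "dense_ring (padic_int l)"
  by (rule torsion_free_ring.dense_ring_prime[OF padic_torsion_free[OF l]])
     (use padic_prime_div[OF l] in blast)

text \<open>Reduction modulo l: if l divided q, the equation would force l to divide p too.\<close>

lemma padic_fraction:
  assumes l: "prime l" and w: "w \<in> carrier (padic_int l)"
    and eq: "[q] \<cdot>\<^bsub>padic_int l\<^esub> w = [p] \<cdot>\<^bsub>padic_int l\<^esub> \<one>\<^bsub>padic_int l\<^esub>" and "coprime p q"
  shows "\<not> int l dvd q"
proof
  assume lq: "int l dvd q"
  interpret ring "padic_int l" by (rule padic_ring[OF l])
  have "(q * w 0) mod int l = p mod int l"
    using fun_cong[OF eq, of 0] unfolding padic_zmult_one[OF l] by (simp add: padic_zmult[OF l w])
  moreover have "(q * w 0) mod int l = 0" using lq by simp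
  ultimately have "int l dvd p" by (simp add: mod_eq_0_iff_dvd)
  with lq \<open>coprime p q\<close> have "is_unit (int l)" by (metis coprime_def)
  then show False using prime_gt_1_nat[OF l] by simp
qed

section \<open>Products of rings and the profinite integers\<close>

lemma product_ring_simps:
  "carrier (product_ring I A) = (\<Pi>\<^sub>E i\<in>I. carrier (A i))"
  "f \<otimes>\<^bsub>product_ring I A\<^esub> g = (\<lambda>i\<in>I. f i \<otimes>\<^bsub>A i\<^esub> g i)"
  "f \<oplus>\<^bsub>product_ring I A\<^esub> g = (\<lambda>i\<in>I. f i \<oplus>\<^bsub>A i\<^esub> g i)"
  "\<one>\<^bsub>product_ring I A\<^esub> = (\<lambda>i\<in>I. \<one>\<^bsub>A i\<^esub>)" "\<zero>\<^bsub>product_ring I A\<^esub> = (\<lambda>i\<in>I. \<zero>\<^bsub>A i\<^esub>)"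
  by (simp_all add: product_ring_def)

lemma product_ring_ring:
  assumes ring: "\<And>i. i \<in> I \<Longrightarrow> ring (A i)"
  shows "ring (product_ring I A)"
proof -
  have ax1: "\<ominus>\<^bsub>A i\<^esub> x \<in> carrier (A i)" "\<ominus>\<^bsub>A i\<^esub> x \<oplus>\<^bsub>A i\<^esub> x = \<zero>\<^bsub>A i\<^esub>"
    "\<zero>\<^bsub>A i\<^esub> \<oplus>\<^bsub>A i\<^esub> x = x" "\<one>\<^bsub>A i\<^esub> \<otimes>\<^bsub>A i\<^esub> x = x" "x \<otimes>\<^bsub>A i\<^esub> \<one>\<^bsub>A i\<^esub> = x"
    if "i \<in> I" "x \<in> carrier (A i)" for i x
  proof -
    interpret ring "A i" using that(1) by (rule ring)
    show "\<ominus>\<^bsub>A i\<^esub> x \<in> carrier (A i)" "\<ominus>\<^bsub>A i\<^esub> x \<oplus>\<^bsub>A i\<^esub> x = \<zero>\<^bsub>A i\<^esub>"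
      "\<zero>\<^bsub>A i\<^esub> \<oplus>\<^bsub>A i\<^esub> x = x" "\<one>\<^bsub>A i\<^esub> \<otimes>\<^bsub>A i\<^esub> x = x" "x \<otimes>\<^bsub>A i\<^esub> \<one>\<^bsub>A i\<^esub> = x"
      using that(2) by (simp_all add: l_neg)
  qed
  have ax2: "x \<oplus>\<^bsub>A i\<^esub> y \<in> carrier (A i)" "x \<otimes>\<^bsub>A i\<^esub> y \<in> carrier (A i)" "x \<oplus>\<^bsub>A i\<^esub> y = y \<oplus>\<^bsub>A i\<^esub> x"
    if "i \<in> I" "x \<in> carrier (A i)" "y \<in> carrier (A i)" for i x y
  proof -
    interpret ring "A i" using that(1) by (rule ring)
    show "x \<oplus>\<^bsub>A i\<^esub> y \<in> carrier (A i)" "x \<otimes>\<^bsub>A i\<^esub> y \<in> carrier (A i)" "x \<oplus>\<^bsub>A i\<^esub> y = y \<oplus>\<^bsub>A i\<^esub> x"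
      using that(2,3) a_comm by simp_all
  qed
  have ax3: "x \<oplus>\<^bsub>A i\<^esub> y \<oplus>\<^bsub>A i\<^esub> z = x \<oplus>\<^bsub>A i\<^esub> (y \<oplus>\<^bsub>A i\<^esub> z)" "x \<otimes>\<^bsub>A i\<^esub> y \<otimes>\<^bsub>A i\<^esub> z = x \<otimes>\<^bsub>A i\<^esub> (y \<otimes>\<^bsub>A i\<^esub> z)"
    "(x \<oplus>\<^bsub>A i\<^esub> y) \<otimes>\<^bsub>A i\<^esub> z = x \<otimes>\<^bsub>A i\<^esub> z \<oplus>\<^bsub>A i\<^esub> y \<otimes>\<^bsub>A i\<^esub> z"
    "z \<otimes>\<^bsub>A i\<^esub> (x \<oplus>\<^bsub>A i\<^esub> y) = z \<otimes>\<^bsub>A i\<^esub> x \<oplus>\<^bsub>A i\<^esub> z \<otimes>\<^bsub>A i\<^esub> y"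
    if "i \<in> I" "x \<in> carrier (A i)" "y \<in> carrier (A i)" "z \<in> carrier (A i)" for i x y z
  proof -
    interpret ring "A i" using that(1) by (rule ring)
    show "x \<oplus>\<^bsub>A i\<^esub> y \<oplus>\<^bsub>A i\<^esub> z = x \<oplus>\<^bsub>A i\<^esub> (y \<oplus>\<^bsub>A i\<^esub> z)" "x \<otimes>\<^bsub>A i\<^esub> y \<otimes>\<^bsub>A i\<^esub> z = x \<otimes>\<^bsub>A i\<^esub> (y \<otimes>\<^bsub>A i\<^esub> z)"
      "(x \<oplus>\<^bsub>A i\<^esub> y) \<otimes>\<^bsub>A i\<^esub> z = x \<otimes>\<^bsub>A i\<^esub> z \<oplus>\<^bsub>A i\<^esub> y \<otimes>\<^bsub>A i\<^esub> z"
      "z \<otimes>\<^bsub>A i\<^esub> (x \<oplus>\<^bsub>A i\<^esub> y) = z \<otimes>\<^bsub>A i\<^esub> x \<oplus>\<^bsub>A i\<^esub> z \<otimes>\<^bsub>A i\<^esub> y"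
      using that(2-4) by (simp_all add: a_assoc m_assoc l_distr r_distr)
  qed
  have mem: "f i \<in> carrier (A i)" if "f \<in> carrier (product_ring I A)" "i \<in> I" for f i
    using that by (auto simp: product_ring_simps)
  have res: "restrict f I = f" if "f \<in> carrier (product_ring I A)" for f
    using that by (simp add: product_ring_simps PiE_restrict)
  have zero: "\<zero>\<^bsub>A i\<^esub> \<in> carrier (A i)" "\<one>\<^bsub>A i\<^esub> \<in> carrier (A i)" if "i \<in> I" for i
    using ring[OF that] by (simp_all add: ring.ring_simprules ring.is_monoid monoid.one_closed)
  show ?thesis
  proof (rule ringI)
    show "abelian_group (product_ring I A)"
    proof (rule abelian_groupI)
      fix f assume f: "f \<in> carrier (product_ring I A)"
      have "(\<lambda>i\<in>I. \<ominus>\<^bsub>A i\<^esub> f i) \<in> carrier (product_ring I A)"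
        unfolding product_ring_simps restrict_PiE_iff using mem[OF f] ax1(1) by simp
      moreover have "(\<lambda>i\<in>I. \<ominus>\<^bsub>A i\<^esub> f i) \<oplus>\<^bsub>product_ring I A\<^esub> f = \<zero>\<^bsub>product_ring I A\<^esub>"
        unfolding product_ring_simps by (rule restrict_ext) (simp add: mem[OF f] ax1(2))
      ultimately show "\<exists>g\<in>carrier (product_ring I A). g \<oplus>\<^bsub>product_ring I A\<^esub> f = \<zero>\<^bsub>product_ring I A\<^esub>" by blast
      have "\<zero>\<^bsub>product_ring I A\<^esub> \<oplus>\<^bsub>product_ring I A\<^esub> f = restrict f I"
        unfolding product_ring_simps by (rule restrict_ext) (simp add: mem[OF f] ax1(3))
      then show "\<zero>\<^bsub>product_ring I A\<^esub> \<oplus>\<^bsub>product_ring I A\<^esub> f = f" using res[OF f] by simp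
    next
      fix f g assume fg: "f \<in> carrier (product_ring I A)" "g \<in> carrier (product_ring I A)"
      show "f \<oplus>\<^bsub>product_ring I A\<^esub> g \<in> carrier (product_ring I A)"
        unfolding product_ring_simps restrict_PiE_iff using mem[OF fg(1)] mem[OF fg(2)] ax2(1) by simp
      show "f \<oplus>\<^bsub>product_ring I A\<^esub> g = g \<oplus>\<^bsub>product_ring I A\<^esub> f"
        unfolding product_ring_simps
        by (rule restrict_ext) (rule ax2(3), auto simp: mem fg)
      fix h assume h: "h \<in> carrier (product_ring I A)"
      show "f \<oplus>\<^bsub>product_ring I A\<^esub> g \<oplus>\<^bsub>product_ring I A\<^esub> h = f \<oplus>\<^bsub>product_ring I A\<^esub> (g \<oplus>\<^bsub>product_ring I A\<^esub> h)"
        unfolding product_ring_simps by (rule restrict_ext) (simp add: mem fg h ax3(1))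
    next
      show "\<zero>\<^bsub>product_ring I A\<^esub> \<in> carrier (product_ring I A)"
        unfolding product_ring_simps restrict_PiE_iff using zero(1) by simp
    qed
    show "monoid (product_ring I A)"
    proof (rule monoidI)
      fix f assume f: "f \<in> carrier (product_ring I A)"
      have "\<one>\<^bsub>product_ring I A\<^esub> \<otimes>\<^bsub>product_ring I A\<^esub> f = restrict f I"
        unfolding product_ring_simps by (rule restrict_ext) (simp add: mem[OF f] ax1(4))
      then show "\<one>\<^bsub>product_ring I A\<^esub> \<otimes>\<^bsub>product_ring I A\<^esub> f = f" using res[OF f] by simp
      have "f \<otimes>\<^bsub>product_ring I A\<^esub> \<one>\<^bsub>product_ring I A\<^esub> = restrict f I"
        unfolding product_ring_simps by (rule restrict_ext) (simp add: mem[OF f] ax1(5))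
      then show "f \<otimes>\<^bsub>product_ring I A\<^esub> \<one>\<^bsub>product_ring I A\<^esub> = f" using res[OF f] by simp
    next
      fix f g assume fg: "f \<in> carrier (product_ring I A)" "g \<in> carrier (product_ring I A)"
      show "f \<otimes>\<^bsub>product_ring I A\<^esub> g \<in> carrier (product_ring I A)"
        unfolding product_ring_simps restrict_PiE_iff using mem[OF fg(1)] mem[OF fg(2)] ax2(2) by simp
      fix h assume h: "h \<in> carrier (product_ring I A)"
      show "f \<otimes>\<^bsub>product_ring I A\<^esub> g \<otimes>\<^bsub>product_ring I A\<^esub> h = f \<otimes>\<^bsub>product_ring I A\<^esub> (g \<otimes>\<^bsub>product_ring I A\<^esub> h)"
        unfolding product_ring_simps by (rule restrict_ext) (simp add: mem fg h ax3(2))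
    next
      show "\<one>\<^bsub>product_ring I A\<^esub> \<in> carrier (product_ring I A)"
        unfolding product_ring_simps restrict_PiE_iff using zero(2) by simp
    qed
  next
    fix f g h assume fgh: "f \<in> carrier (product_ring I A)" "g \<in> carrier (product_ring I A)"
      "h \<in> carrier (product_ring I A)"
    show "(f \<oplus>\<^bsub>product_ring I A\<^esub> g) \<otimes>\<^bsub>product_ring I A\<^esub> h
        = f \<otimes>\<^bsub>product_ring I A\<^esub> h \<oplus>\<^bsub>product_ring I A\<^esub> g \<otimes>\<^bsub>product_ring I A\<^esub> h"
      unfolding product_ring_simps by (rule restrict_ext) (simp add: mem fgh ax3(3))
    show "h \<otimes>\<^bsub>product_ring I A\<^esub> (f \<oplus>\<^bsub>product_ring I A\<^esub> g)
        = h \<otimes>\<^bsub>product_ring I A\<^esub> f \<oplus>\<^bsub>product_ring I A\<^esub> h \<otimes>\<^bsub>product_ring I A\<^esub> g"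
      unfolding product_ring_simps by (rule restrict_ext) (simp add: mem fgh ax3(4))
  qed
qed

lemma product_ring_proj:
  "i \<in> I \<Longrightarrow> (\<lambda>f. f i) \<in> ring_hom (product_ring I A) (A i)"
  by (rule ring_hom_memI) (auto simp: product_ring_simps)

lemma zhat_ring: "ring zhat"
  unfolding zhat_def by (rule product_ring_ring) (simp add: padic_ring)

lemma zhat_carrier: "carrier zhat = (\<Pi>\<^sub>E l\<in>{l. prime l}. carrier (padic_int l))"
  by (simp add: zhat_def product_ring_simps)

lemma zhat_proj: "prime l \<Longrightarrow> (\<lambda>f. f l) \<in> ring_hom zhat (padic_int l)"
  unfolding zhat_def by (rule product_ring_proj) simp

lemma zhat_proj_hom: "prime l \<Longrightarrow> abelian_group_hom zhat (padic_int l) (\<lambda>f. f l)"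
  by (rule ring_hom_abelian_group_hom[OF zhat_ring padic_ring zhat_proj])

lemma zhat_eqI:
  assumes "f \<in> carrier zhat" "g \<in> carrier zhat" "\<And>l. prime l \<Longrightarrow> f l = g l"
  shows "f = g"
  using assms unfolding zhat_carrier by (intro PiE_ext[of f _ _ g]) auto

lemma zhat_torsion_free: "torsion_free_ring zhat"
proof -
  interpret ring zhat by (rule zhat_ring)
  show ?thesis
  proof unfold_locales
    fix x and k :: int assume x: "x \<in> carrier zhat" and k: "k > 0" and zero: "[k] \<cdot>\<^bsub>zhat\<^esub> x = \<zero>\<^bsub>zhat\<^esub>"
    show "x = \<zero>\<^bsub>zhat\<^esub>"
    proof (rule zhat_eqI[OF x])
      fix l :: nat assume l: "prime l"
      interpret h: abelian_group_hom zhat "padic_int l" "\<lambda>f. f l" by (rule zhat_proj_hom[OF l])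
      have "[k] \<cdot>\<^bsub>padic_int l\<^esub> x l = \<zero>\<^bsub>padic_int l\<^esub>"
        using h.hom_zmult[OF x, of k] zero by simp
      then show "x l = \<zero>\<^bsub>zhat\<^esub> l"
        using torsion_free_ring.torsion_free[OF padic_torsion_free[OF l] h.hom_closed[OF x] k] by simp
    qed simp
  qed
qed

lemma zhat_dense: "dense_ring zhat"
proof (rule torsion_free_ring.dense_ring_prime[OF zhat_torsion_free])
  fix p :: nat and x assume p: "prime p" and x: "x \<in> carrier zhat"
  interpret ring zhat by (rule zhat_ring)
  \<comment> \<open>The residue modulo p of the component at p, which is the only component that
    constrains t.\<close>
  define t where "t = x p 0"
  have "\<forall>l\<in>{l. prime l}. \<exists>w. w \<in> carrier (padic_int l) \<and>
      x l = [t] \<cdot>\<^bsub>padic_int l\<^esub> \<one>\<^bsub>padic_int l\<^esub> \<oplus>\<^bsub>padic_int l\<^esub> [(int p)] \<cdot>\<^bsub>padic_int l\<^esub> w"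
  proof
    fix l :: nat assume "l \<in> {l. prime l}"
    then have l: "prime l" by simp
    have "x l \<in> carrier (padic_int l)" using x l by (auto simp: zhat_carrier)
    from padic_prime_div[OF l p this, of t]
    show "\<exists>w. w \<in> carrier (padic_int l) \<and>
      x l = [t] \<cdot>\<^bsub>padic_int l\<^esub> \<one>\<^bsub>padic_int l\<^esub> \<oplus>\<^bsub>padic_int l\<^esub> [(int p)] \<cdot>\<^bsub>padic_int l\<^esub> w"
      unfolding t_def by blast
  qed
  from bchoice[OF this] obtain w where w: "\<And>l. prime l \<Longrightarrow> w l \<in> carrier (padic_int l)"
    "\<And>l. prime l \<Longrightarrow> x l = [t] \<cdot>\<^bsub>padic_int l\<^esub> \<one>\<^bsub>padic_int l\<^esub> \<oplus>\<^bsub>padic_int l\<^esub> [(int p)] \<cdot>\<^bsub>padic_int l\<^esub> w l"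
    by blast
  define w' where "w' = (\<lambda>l\<in>{l. prime l}. w l)"
  have w': "w' \<in> carrier zhat" using w(1) by (auto simp: w'_def zhat_carrier)
  have "x = [t] \<cdot>\<^bsub>zhat\<^esub> \<one>\<^bsub>zhat\<^esub> \<oplus>\<^bsub>zhat\<^esub> [(int p)] \<cdot>\<^bsub>zhat\<^esub> w'"
  proof (rule zhat_eqI[OF x])
    fix l :: nat assume l: "prime l"
    interpret h: abelian_group_hom zhat "padic_int l" "\<lambda>f. f l" by (rule zhat_proj_hom[OF l])
    show "x l = ([t] \<cdot>\<^bsub>zhat\<^esub> \<one>\<^bsub>zhat\<^esub> \<oplus>\<^bsub>zhat\<^esub> [(int p)] \<cdot>\<^bsub>zhat\<^esub> w') l"
      using w(2)[OF l] l w' ring_hom_one[OF zhat_proj[OF l]]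
      by (simp add: h.hom_add h.hom_zmult w'_def)
  qed (use w' in simp)
  then show "\<exists>t::int. \<exists>w\<in>carrier zhat. x = [t] \<cdot>\<^bsub>zhat\<^esub> \<one>\<^bsub>zhat\<^esub> \<oplus>\<^bsub>zhat\<^esub> [(int p)] \<cdot>\<^bsub>zhat\<^esub> w"
    using w' by blast
qed

lemma zhat_proj_surj:
  assumes l: "prime l" and w: "w \<in> carrier (padic_int l)"
  shows "\<exists>f\<in>carrier zhat. f l = w"
proof
  have "ring (padic_int p)" if "prime p" for p :: nat using padic_ring that by blast
  then show "(\<lambda>p\<in>{p. prime p}. if p = l then w else \<zero>\<^bsub>padic_int p\<^esub>) \<in> carrier zhat"
    using w by (auto simp: zhat_carrier ring.ring_simprules(2))
qed (use l in simp)

section \<open>Localisation of lattices\<close>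

lemma (in abelian_group) add_diff_cancel_left:
  assumes "x \<in> carrier G" "y \<in> carrier G"
  shows "x \<oplus> y \<ominus> x = y"
proof -
  have "x \<oplus> y \<ominus> x = y \<oplus> (x \<oplus> \<ominus> x)" using assms by (simp add: a_minus_def a_ac)
  then show ?thesis using assms by (simp add: r_neg)
qed

context rat_alg
begin

lemma lattice_subset: "is_lattice B L \<Longrightarrow> L \<subseteq> carrier B"
  unfolding is_lattice_iff using add.generate_incl by auto

lemma lattice_subgroup: "is_lattice B L \<Longrightarrow> subgroup L (add_monoid B)"
  unfolding is_lattice_iff using add.generate_is_subgroup by auto

lemma subgroup_zmult: "\<lbrakk>subgroup L (add_monoid B); x \<in> L\<rbrakk> \<Longrightarrow> [(k::int)] \<cdot> x \<in> L"
  using add.subgroup_int_pow_closed by simp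

lemma subgroup_add: "\<lbrakk>subgroup L (add_monoid B); x \<in> L; y \<in> L\<rbrakk> \<Longrightarrow> x \<oplus> y \<in> L"
  using subgroup.m_closed by fastforce

lemma subgroup_diff: "\<lbrakk>subgroup L (add_monoid B); x \<in> L; y \<in> L\<rbrakk> \<Longrightarrow> x \<ominus> y \<in> L"
  using subgroup.m_closed[of L "add_monoid B" x "\<ominus> y"] subgroup.m_inv_closed[of L "add_monoid B" y]
  by (simp add: a_minus_def a_inv_def)

lemma subgroup_zero: "subgroup L (add_monoid B) \<Longrightarrow> \<zero> \<in> L"
  using subgroup.one_closed by fastforce

text \<open>A lattice has finitely many generators, so the product of their individual multipliers
  works for all of them and hence for the lattice.\<close>

lemma lattice_absorbs:
  assumes L: "is_lattice B L" and M: "subgroup M (add_monoid B)" "\<forall>x\<in>carrier B. \<exists>m>0. [(m::int)] \<cdot> x \<in> M"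
  shows "\<exists>N>0. \<forall>x\<in>L. [(N::int)] \<cdot> x \<in> M"
proof -
  obtain S where S: "finite S" "S \<subseteq> carrier B" "L = generate (add_monoid B) S"
    using L unfolding is_lattice_iff by blast
  have "\<exists>N>0. \<forall>s\<in>S. [(N::int)] \<cdot> s \<in> M" using S(1,2)
  proof (induction S)
    case empty then show ?case by (auto intro: exI[of _ 1])
  next
    case (insert s S)
    then obtain N where N: "N > 0" "\<forall>s\<in>S. [(N::int)] \<cdot> s \<in> M" by auto
    obtain m where m: "m > 0" "[(m::int)] \<cdot> s \<in> M" using M(2) insert.prems by blast
    have "[(m * N)] \<cdot> t \<in> M" if t: "t \<in> insert s S" for t
    proof (cases "t = s")
      case True
      have "[N] \<cdot> ([m] \<cdot> s) \<in> M" by (rule subgroup_zmult[OF M(1) m(2)])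
      then show ?thesis using True insert.prems by (simp add: zmult_zmult mult.commute)
    next
      case False
      then have "t \<in> S" using t by simp
      then have "[m] \<cdot> ([N] \<cdot> t) \<in> M" using N by (intro subgroup_zmult[OF M(1), of "[N] \<cdot> t"]) auto
      moreover have "t \<in> carrier B" using t insert.prems by auto
      ultimately show ?thesis by (simp add: zmult_zmult)
    qed
    then show ?case using m(1) N(1) by (intro exI[of _ "m * N"]) auto
  qed
  then obtain N where N: "N > 0" "\<forall>s\<in>S. [(N::int)] \<cdot> s \<in> M" by blast
  have "[N] \<cdot> x \<in> M" if "x \<in> L" for x
    using that[unfolded S(3)] S(2)
  proof (induction x rule: generate_add_induct)
    case (gen s) then show ?case using N by blast
  next
    case zero show ?case using subgroup_zero[OF M(1)] by simp
  next
    case (diff x y)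
    then show ?case using subgroup_diff[OF M(1)] by (simp add: zmult_diff)
  qed
  then show ?thesis using N(1) by blast
qed

lemma lattice_commensurable:
  assumes "is_lattice B L" "is_lattice B M"
  shows "\<exists>N>0. \<forall>x\<in>L. [(N::int)] \<cdot> x \<in> M"
  by (rule lattice_absorbs[OF assms(1) lattice_subgroup[OF assms(2)]])
     (use assms(2) in \<open>simp add: is_lattice_iff\<close>)

text \<open>The integers m with m x in M form an ideal. Its positive generator d has no prime
  divisor l, because some multiplier is prime to l; hence d = 1.\<close>

lemma subgroup_local_global:
  assumes M: "subgroup M (add_monoid B)" and x: "x \<in> carrier B"
    and loc: "\<And>l. prime (l::nat) \<Longrightarrow> \<exists>m. \<not> int l dvd m \<and> [m] \<cdot> x \<in> M"
  shows "x \<in> M"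
proof -
  define d where "d = (LEAST d. d > 0 \<and> [(int d)] \<cdot> x \<in> M)"
  \<comment> \<open>Any nonzero multiplier shows that d exists; one not divisible by 2 cannot be
    0.\<close>
  obtain m where m: "\<not> int 2 dvd m" "[m] \<cdot> x \<in> M" using loc[of 2] two_is_prime_nat by blast
  have "[(int (nat \<bar>m\<bar>))] \<cdot> x \<in> M"
    using m(2) subgroup_zmult[OF M m(2), of "-1"] x by (cases "m \<ge> 0") (simp_all add: zmult_zmult)
  moreover have "nat \<bar>m\<bar> > 0" using m(1) by (cases "m = 0") auto
  ultimately have "nat \<bar>m\<bar> > 0 \<and> [(int (nat \<bar>m\<bar>))] \<cdot> x \<in> M" by blast
  then have "d > 0 \<and> [(int d)] \<cdot> x \<in> M" unfolding d_def by (rule LeastI)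
  then have d: "d > 0" "[(int d)] \<cdot> x \<in> M" by auto
  \<comment> \<open>Division with remainder: a nonzero remainder would be a smaller positive
    multiplier.\<close>
  have dvd: "int d dvd m" if "[m] \<cdot> x \<in> M" for m
  proof (rule ccontr)
    assume "\<not> int d dvd m"
    then have "m mod int d \<noteq> 0" by (simp add: mod_eq_0_iff_dvd)
    then have r: "m mod int d > 0" using d(1) pos_mod_sign[of "int d" m] by linarith
    have "m mod int d = m - (m div int d) * int d" by (simp add: minus_div_mult_eq_mod)
    then have "[(m mod int d)] \<cdot> x = [m] \<cdot> x \<ominus> [(m div int d)] \<cdot> ([(int d)] \<cdot> x)"
      using x zmult_add[of x m "- (m div int d * int d)"] by (simp add: zmult_zmult zmult_neg a_minus_def)
    also have "\<dots> \<in> M" by (rule subgroup_diff[OF M that subgroup_zmult[OF M d(2)]])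
    finally have "[(int (nat (m mod int d)))] \<cdot> x \<in> M" using r by simp
    then have "nat (m mod int d) > 0 \<and> [(int (nat (m mod int d)))] \<cdot> x \<in> M" using r by simp
    then have "d \<le> nat (m mod int d)" unfolding d_def by (rule Least_le)
    moreover have "m mod int d < int d" using d(1) by simp
    ultimately show False using r by linarith
  qed
  have "d = 1"
  proof (rule ccontr)
    assume "d \<noteq> 1"
    then obtain l where l: "prime l" "l dvd d" using prime_factor_nat by blast
    then obtain m where "\<not> int l dvd m" "[m] \<cdot> x \<in> M" using loc by blast
    with dvd l show False by (meson dvd_trans int_dvd_int_iff)
  qed
  then show ?thesis using d x by simp
qed

end

context rat_basis
begin

lemma std_generate: "std_lattice = generate (add_monoid B) (e ` {..<n})"
proof
  have sub: "e ` {..<n} \<subseteq> carrier B" by auto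
  then have sg: "subgroup (generate (add_monoid B) (e ` {..<n})) (add_monoid B)"
    using add.generate_is_subgroup by simp
  show "std_lattice \<subseteq> generate (add_monoid B) (e ` {..<n})"
  proof
    fix x assume "x \<in> std_lattice"
    then obtain k :: "nat \<Rightarrow> int" where k: "x = (\<Oplus>j\<in>{..<n}. [(k j)] \<cdot> e j)" using std_expand by metis
    have "(\<Oplus>j\<in>{..<i}. [(k j)] \<cdot> e j) \<in> generate (add_monoid B) (e ` {..<n})" if "i \<le> n" for i
      using that
    proof (induction i)
      case 0 show ?case using subgroup_zero[OF sg] by simp
    next
      case (Suc i)
      then have "(\<Oplus>j\<in>{..<Suc i}. [(k j)] \<cdot> e j) = [(k i)] \<cdot> e i \<oplus> (\<Oplus>j\<in>{..<i}. [(k j)] \<cdot> e j)"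
        by (simp add: lessThan_Suc Pi_def)
      also have "\<dots> \<in> generate (add_monoid B) (e ` {..<n})"
        using Suc by (intro subgroup_add[OF sg] subgroup_zmult[OF sg]) (auto intro: generate.incl)
      finally show ?case .
    qed
    then show "x \<in> generate (add_monoid B) (e ` {..<n})" using k by blast
  qed
  show "generate (add_monoid B) (e ` {..<n}) \<subseteq> std_lattice"
  proof
    fix x assume "x \<in> generate (add_monoid B) (e ` {..<n})"
    then show "x \<in> std_lattice" using sub
    proof (induction x rule: generate_add_induct)
      case (gen s) then show ?case using e_in_std by auto
    next
      case zero
      have "\<zero> = [(0::int)] \<cdot> \<zero>" by simp
      have "c j \<zero> = 0" for j using c.hom_zero by simp
      then show ?case by (simp add: std_lattice_def)
    qed (rule std_diff)
  qed
qed

lemma std_is_lattice: "is_lattice B std_lattice"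
  unfolding is_lattice_iff using zmult_in_std std_generate by (auto intro!: exI[of _ "e ` {..<n}"])

lemma extension_zhat: "extension B n e c zhat"
  by (intro extension.intro rat_basis_axioms zhat_dense)

lemma extension_padic: "prime l \<Longrightarrow> extension B n e c (padic_int l)"
  by (intro extension.intro rat_basis_axioms padic_dense)

sublocale H: extension B n e c zhat
  by (rule extension_zhat)

text \<open>Defined for every l, outside the locale that fixes a prime, so that statements can
  quantify over all primes. It is chosen by its values on \<open>elem\<close>; existence is shown
  for prime l.\<close>

definition proj where
  "proj l = (SOME \<phi>. \<phi> \<in> ring_hom (scalar_ext zhat B) (scalar_ext (padic_int l) B) \<and>
    (\<forall>x\<in>carrier B. \<forall>z\<in>carrier zhat. \<phi> (extension.elem B zhat x z) = extension.elem B (padic_int l) x (z l)))"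

end

section \<open>Comparison of profinite and l-adic completions\<close>

locale place = rat_basis +
  fixes l :: nat
  assumes prime_l: "prime l"
begin

sublocale L: extension B n e c "padic_int l"
  by (rule extension_padic[OF prime_l])

text \<open>The universal property is used twice, as the extension is a double tensor product: the
  projection of profinite integers is extended to rational coefficients, and the result to
  B.\<close>

lemma proj_exists:
  "\<exists>\<phi>. \<phi> \<in> ring_hom H.T L.T \<and> (\<forall>x\<in>carrier B. \<forall>z\<in>carrier zhat. \<phi> (H.elem x z) = L.elem x (z l))"
proof -
  have zc: "z l \<in> carrier (padic_int l)" if "z \<in> carrier zhat" for z
    using ring_hom_closed[OF zhat_proj[OF prime_l] that] .
  have "\<exists>\<gamma>. \<gamma> \<in> ring_hom H.A L.A \<and>
    (\<forall>z\<in>carrier zhat. \<forall>q\<in>carrier rat_ring. \<gamma> (pure_tensor zhat rat_ring z q) = pure_tensor (padic_int l) rat_ring (z l) q)"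
    using L.Q.T.ring_axioms
  proof (rule H.Q.tensor_lift_ring)
    fix z z' and q assume "z \<in> carrier zhat" "z' \<in> carrier zhat" "q \<in> carrier rat_ring"
    then show "pure_tensor (padic_int l) rat_ring ((z \<oplus>\<^bsub>zhat\<^esub> z') l) q
        = pure_tensor (padic_int l) rat_ring (z l) q \<oplus>\<^bsub>L.A\<^esub> pure_tensor (padic_int l) rat_ring (z' l) q"
      using ring_hom_add[OF zhat_proj[OF prime_l]] L.Q.pure_add_left zc by simp
  next
    fix z q q' assume "z \<in> carrier zhat" "q \<in> carrier rat_ring" "q' \<in> carrier rat_ring"
    then show "pure_tensor (padic_int l) rat_ring (z l) (q \<oplus>\<^bsub>rat_ring\<^esub> q')
        = pure_tensor (padic_int l) rat_ring (z l) q \<oplus>\<^bsub>L.A\<^esub> pure_tensor (padic_int l) rat_ring (z l) q'"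
      using L.Q.pure_add_right zc by blast
  next
    fix z z' and q q' assume "z \<in> carrier zhat" "z' \<in> carrier zhat" "q \<in> carrier rat_ring" "q' \<in> carrier rat_ring"
    then show "pure_tensor (padic_int l) rat_ring ((z \<otimes>\<^bsub>zhat\<^esub> z') l) (q \<otimes>\<^bsub>rat_ring\<^esub> q')
        = pure_tensor (padic_int l) rat_ring (z l) q \<otimes>\<^bsub>L.A\<^esub> pure_tensor (padic_int l) rat_ring (z' l) q'"
      using ring_hom_mult[OF zhat_proj[OF prime_l]] L.Q.pure_mult zc by simp
  next
    show "pure_tensor (padic_int l) rat_ring (\<one>\<^bsub>zhat\<^esub> l) \<one>\<^bsub>rat_ring\<^esub> = \<one>\<^bsub>L.A\<^esub>"
      using ring_hom_one[OF zhat_proj[OF prime_l]] L.Q.pure_one by simp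
  qed (use zc L.Q.pure_closed in blast)
  then obtain \<gamma> where \<gamma>: "\<gamma> \<in> ring_hom H.A L.A"
    and \<gamma>_pure: "\<And>z q. z \<in> carrier zhat \<Longrightarrow> \<gamma> (pure_tensor zhat rat_ring z q) = pure_tensor (padic_int l) rat_ring (z l) q"
    by auto
  note \<gamma>c = ring_hom_closed[OF \<gamma>]
  have "\<exists>\<phi>. \<phi> \<in> ring_hom (tensor_ring B H.A) L.T \<and>
    (\<forall>x\<in>carrier B. \<forall>a\<in>carrier H.A. \<phi> (pure_tensor B H.A x a) = pure_tensor B L.A x (\<gamma> a))"
    using L.T.ring_axioms
  proof (rule H.S.tensor_lift_ring)
    fix x y a assume "x \<in> carrier B" "y \<in> carrier B" "a \<in> carrier H.A"
    then show "pure_tensor B L.A (x \<oplus> y) (\<gamma> a) = pure_tensor B L.A x (\<gamma> a) \<oplus>\<^bsub>L.T\<^esub> pure_tensor B L.A y (\<gamma> a)"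
      unfolding scalar_ext_def using L.S.pure_add_left \<gamma>c by blast
  next
    fix x a a' assume "x \<in> carrier B" "a \<in> carrier H.A" "a' \<in> carrier H.A"
    then show "pure_tensor B L.A x (\<gamma> (a \<oplus>\<^bsub>H.A\<^esub> a')) = pure_tensor B L.A x (\<gamma> a) \<oplus>\<^bsub>L.T\<^esub> pure_tensor B L.A x (\<gamma> a')"
      unfolding scalar_ext_def using L.S.pure_add_right \<gamma>c ring_hom_add[OF \<gamma>] by simp
  next
    fix x y a a' assume "x \<in> carrier B" "y \<in> carrier B" "a \<in> carrier H.A" "a' \<in> carrier H.A"
    then show "pure_tensor B L.A (x \<otimes> y) (\<gamma> (a \<otimes>\<^bsub>H.A\<^esub> a'))
        = pure_tensor B L.A x (\<gamma> a) \<otimes>\<^bsub>L.T\<^esub> pure_tensor B L.A y (\<gamma> a')"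
      unfolding scalar_ext_def using L.S.pure_mult \<gamma>c ring_hom_mult[OF \<gamma>] by simp
  next
    show "pure_tensor B L.A \<one> (\<gamma> \<one>\<^bsub>H.A\<^esub>) = \<one>\<^bsub>L.T\<^esub>"
      unfolding scalar_ext_def using L.S.pure_one ring_hom_one[OF \<gamma>] by simp
  qed (use \<gamma>c L.S.pure_closed in \<open>simp add: scalar_ext_def\<close>)
  then obtain \<phi> where \<phi>: "\<phi> \<in> ring_hom H.T L.T"
    "\<And>x a. x \<in> carrier B \<Longrightarrow> a \<in> carrier H.A \<Longrightarrow> \<phi> (pure_tensor B H.A x a) = pure_tensor B L.A x (\<gamma> a)"
    unfolding scalar_ext_def[symmetric] by blast
  have "\<phi> (H.elem x z) = L.elem x (z l)" if "x \<in> carrier B" "z \<in> carrier zhat" for x z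
    using that by (simp add: H.elem_def L.elem_def \<phi>(2) \<gamma>_pure)
  with \<phi>(1) show ?thesis by blast
qed

lemma proj_hom: "proj l \<in> ring_hom H.T L.T"
  and proj_elem: "\<lbrakk>x \<in> carrier B; z \<in> carrier zhat\<rbrakk> \<Longrightarrow> proj l (H.elem x z) = L.elem x (z l)"
  using someI_ex[OF proj_exists] unfolding proj_def by blast+

sublocale proj: abelian_group_hom H.T L.T "proj l"
  by (rule ring_hom_abelian_group_hom[OF H.T.ring_axioms L.T.ring_axioms proj_hom])

lemma proj_mult: "\<lbrakk>x \<in> carrier H.T; y \<in> carrier H.T\<rbrakk> \<Longrightarrow> proj l (x \<otimes>\<^bsub>H.T\<^esub> y) = proj l x \<otimes>\<^bsub>L.T\<^esub> proj l y"
  by (rule ring_hom_mult[OF proj_hom])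

lemma proj_one: "proj l \<one>\<^bsub>H.T\<^esub> = \<one>\<^bsub>L.T\<^esub>"
  by (rule ring_hom_one[OF proj_hom])

lemma proj_emb: "x \<in> carrier B \<Longrightarrow> proj l (H.emb x) = L.emb x"
  using proj_elem[of x "\<one>\<^bsub>zhat\<^esub>"] ring_hom_one[OF zhat_proj[OF prime_l]]
  by (simp add: H.emb_elem L.emb_elem)

lemma proj_comb:
  assumes "\<And>j. j < n \<Longrightarrow> z j \<in> carrier zhat"
  shows "proj l (H.comb z) = L.comb (\<lambda>j. z j l)"
proof -
  have "proj l (H.comb z) = (\<Oplus>\<^bsub>L.T\<^esub>j\<in>{..<n}. proj l (H.elem (e j) (z j)))"
    unfolding H.comb_def by (rule proj.hom_finsum') (use assms in auto)
  also have "\<dots> = L.comb (\<lambda>j. z j l)"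
    unfolding L.comb_def
    by (rule L.T.finsum_cong') (use assms ring_hom_closed[OF zhat_proj[OF prime_l]] in \<open>auto simp: proj_elem\<close>)
  finally show ?thesis .
qed

text \<open>Every l-adic integer is a component of a profinite one, so each generator of the local
  completion lifts to a generator of the profinite completion.\<close>

lemma proj_ext:
  assumes M: "M \<subseteq> carrier B"
  shows "proj l ` H.ext M = L.ext M"
proof -
  have "proj l ` {H.elem x z | x z. x \<in> M \<and> z \<in> carrier zhat} = {L.elem x z | x z. x \<in> M \<and> z \<in> carrier (padic_int l)}"
    (is "?A = ?B")
  proof
    show "?A \<subseteq> ?B"
      using M ring_hom_closed[OF zhat_proj[OF prime_l]] by (auto simp: proj_elem subset_iff) blast
    show "?B \<subseteq> ?A"
    proof
      fix y assume "y \<in> ?B"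
      then obtain x z where y: "y = L.elem x z" "x \<in> M" "z \<in> carrier (padic_int l)" by blast
      then obtain w where w: "w \<in> carrier zhat" "w l = z" using zhat_proj_surj[OF prime_l] by blast
      then have "y = proj l (H.elem x w)" using y M by (auto simp: proj_elem)
      then show "y \<in> ?A" using y w by blast
    qed
  qed
  then show ?thesis
    unfolding H.ext_def L.ext_def using proj.hom_generate[OF H.ext_gens_closed[OF M]] by simp
qed

lemma proj_in_ext: "M \<subseteq> carrier B \<Longrightarrow> y \<in> H.ext M \<Longrightarrow> proj l y \<in> L.ext M"
  using proj_ext by blast

text \<open>The multiplier is the product of the denominators of all coordinates; each of them is
  prime to l by \<open>padic_fraction\<close>.\<close>

lemma emb_in_ext_std_local:
  assumes x: "x \<in> carrier B" "L.emb x \<in> L.ext std_lattice"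
  shows "\<exists>m. \<not> int l dvd m \<and> [m] \<cdot> x \<in> std_lattice"
proof (intro exI conjI)
  let ?m = "\<Prod>j<n. snd (quotient_of (c j x))"
  have q: "\<not> int l dvd snd (quotient_of (c j x))" if j: "j < n" for j
  proof -
    have "c j x * of_int (snd (quotient_of (c j x))) = of_int (fst (quotient_of (c j x)))"
      by (rule rat_mult_denom)
    from L.emb_in_ext_std[OF x j this] obtain w where "w \<in> carrier (padic_int l)"
      "[(snd (quotient_of (c j x)))] \<cdot>\<^bsub>padic_int l\<^esub> w
        = [(fst (quotient_of (c j x)))] \<cdot>\<^bsub>padic_int l\<^esub> \<one>\<^bsub>padic_int l\<^esub>" ..
    then show ?thesis
      using padic_fraction[OF prime_l] quotient_of_coprime[of "c j x"] by (metis prod.collapse)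
  qed
  show "\<not> int l dvd ?m"
    using q prime_l prime_dvd_prod_iff[of "{..<n}" "int l"] by auto
  have "of_int ?m * c j x \<in> \<int>" if j: "j < n" for j
  proof -
    have "?m = snd (quotient_of (c j x)) * (\<Prod>i\<in>{..<n} - {j}. snd (quotient_of (c i x)))"
      using j by (intro prod.remove) auto
    moreover have "c j x * of_int (snd (quotient_of (c j x))) = of_int (fst (quotient_of (c j x)))"
      by (rule rat_mult_denom)
    ultimately have "of_int ?m * c j x
        = of_int (fst (quotient_of (c j x)) * (\<Prod>i\<in>{..<n} - {j}. snd (quotient_of (c i x))))"
      by (simp add: mult.commute mult.left_commute)
    then show ?thesis by (metis Ints_of_int)
  qed
  then show "[(?m)] \<cdot> x \<in> std_lattice" using x by (auto simp: std_lattice_def c_zmult)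
qed

text \<open>Reduces to the standard lattice. Choose N with N times the standard lattice inside M and
  decompose x as y + N s with y in M. Then s comes from w = (x - y)/N in B, and a multiplier prime
  to l moves w into the standard lattice.\<close>

lemma emb_in_ext_local:
  assumes M: "is_lattice B M" and x: "x \<in> carrier B" "L.emb x \<in> L.ext M"
  shows "\<exists>m. \<not> int l dvd m \<and> [m] \<cdot> x \<in> M"
proof -
  note sg = lattice_subgroup[OF M] and sub = lattice_subset[OF M]
  obtain N where N: "N > 0" "\<forall>x\<in>std_lattice. [(N::int)] \<cdot> x \<in> M"
    using lattice_commensurable[OF std_is_lattice M] by blast
  from L.ext_decompose[OF sub sg N(1) x(2)] obtain y s where y: "y \<in> M"
    and s: "s \<in> L.ext std_lattice" and eq: "L.emb x = L.emb y \<oplus>\<^bsub>L.T\<^esub> [N] \<cdot>\<^bsub>L.T\<^esub> s" by blast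
  have yc: "y \<in> carrier B" and sc: "s \<in> carrier L.T" using y sub s L.ext_closed[OF std_subset] by auto
  obtain w where w: "w \<in> carrier B" "[N] \<cdot> w = x \<ominus> y"
    using zmult_divide[of "x \<ominus> y" N] x yc N by auto
  have "[N] \<cdot>\<^bsub>L.T\<^esub> L.emb w = L.emb x \<ominus>\<^bsub>L.T\<^esub> L.emb y"
    using w x yc L.emb.hom_zmult[OF w(1), of N] by (simp add: L.emb.hom_diff)
  also have "\<dots> = [N] \<cdot>\<^bsub>L.T\<^esub> s"
    unfolding eq using yc sc by (intro L.T.add_diff_cancel_left) auto
  finally have "L.emb w = s" by (rule L.R.zmult_cancel) (use w(1) sc N(1) in simp_all)
  then obtain m where m: "\<not> int l dvd m" "[m] \<cdot> w \<in> std_lattice"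
    using emb_in_ext_std_local[OF w(1)] s by blast
  have "x = y \<oplus> [N] \<cdot> w" using w x yc by (simp add: a_minus_def a_lcomm r_neg)
  then have "[m] \<cdot> x = [m] \<cdot> y \<oplus> [N] \<cdot> ([m] \<cdot> w)"
    using w(1) yc by (simp add: zmult_distrib zmult_zmult mult.commute)
  also have "\<dots> \<in> M" using N(2) m(2) by (intro subgroup_add[OF sg subgroup_zmult[OF sg y]]) blast
  finally show ?thesis using m by blast
qed

end

section \<open>Local-global principles in the adelic algebra\<close>

context rat_basis
begin

lemma placeI: "prime l \<Longrightarrow> place B n e c l"
  by unfold_locales

text \<open>Density of B in the adelic algebra. An integral multiple k y is decomposed with modulus
  k N, and the factor k is divided out again.\<close>

lemma ext_approx:
  assumes N: "(N::int) > 0" and y: "y \<in> carrier H.T"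
  shows "\<exists>x\<in>carrier B. \<exists>s\<in>H.ext std_lattice. y = H.emb x \<oplus>\<^bsub>H.T\<^esub> [N] \<cdot>\<^bsub>H.T\<^esub> s"
proof -
  obtain k where k: "k > 0" "[(k::int)] \<cdot>\<^bsub>H.T\<^esub> y \<in> H.ext std_lattice" using H.zmult_in_ext_std[OF y] by blast
  have "k * N > 0" using k N by simp
  from H.ext_decompose[OF std_subset lattice_subgroup[OF std_is_lattice] this k(2)] obtain x s
    where x: "x \<in> std_lattice" and s: "s \<in> H.ext std_lattice"
      and eq: "[k] \<cdot>\<^bsub>H.T\<^esub> y = H.emb x \<oplus>\<^bsub>H.T\<^esub> [(k * N)] \<cdot>\<^bsub>H.T\<^esub> s" by blast
  have sc: "s \<in> carrier H.T" using s H.ext_closed[OF std_subset] by auto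
  obtain w where w: "w \<in> carrier B" "[k] \<cdot> w = x"
    using zmult_divide[of x k] x std_subset k by auto
  have "[k] \<cdot>\<^bsub>H.T\<^esub> y = [k] \<cdot>\<^bsub>H.T\<^esub> (H.emb w \<oplus>\<^bsub>H.T\<^esub> [N] \<cdot>\<^bsub>H.T\<^esub> s)"
    unfolding eq using sc w H.emb.hom_zmult[OF w(1), of k] by (simp add: H.T.zmult_distrib H.T.zmult_zmult)
  then have "y = H.emb w \<oplus>\<^bsub>H.T\<^esub> [N] \<cdot>\<^bsub>H.T\<^esub> s"
    by (rule H.R.zmult_cancel) (use y w sc k in auto)
  then show ?thesis using w s by blast
qed

lemma emb_in_ext:
  assumes M: "is_lattice B M" and x: "x \<in> carrier B" and mem: "H.emb x \<in> H.ext M"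
  shows "x \<in> M"
proof (rule subgroup_local_global[OF lattice_subgroup[OF M] x])
  fix l :: nat assume "prime l"
  then interpret place B n e c l by (rule placeI)
  show "\<exists>m. \<not> int l dvd m \<and> [m] \<cdot> x \<in> M"
    using emb_in_ext_local[OF M x] proj_in_ext[OF lattice_subset[OF M] mem] x by (simp add: proj_emb)
qed

text \<open>Density splits y into an element x of B and an error inside the completion of M. Only x
  remains to be tested, and for it the local conditions give multipliers prime to each l.\<close>

lemma ext_local_global:
  assumes M: "is_lattice B M" and y: "y \<in> carrier H.T"
    and loc: "\<And>l. prime l \<Longrightarrow> proj l y \<in> lattice_ext (padic_int l) B M"
  shows "y \<in> H.ext M"
proof -
  note sg = lattice_subgroup[OF M] and sub = lattice_subset[OF M]
  obtain N where N: "N > 0" "\<forall>x\<in>std_lattice. [(N::int)] \<cdot> x \<in> M"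
    using lattice_commensurable[OF std_is_lattice M] by blast
  from ext_approx[OF N(1) y] obtain x s where x: "x \<in> carrier B" and s: "s \<in> H.ext std_lattice"
    and eq: "y = H.emb x \<oplus>\<^bsub>H.T\<^esub> [N] \<cdot>\<^bsub>H.T\<^esub> s" by blast
  have sc: "s \<in> carrier H.T" using s H.ext_closed[OF std_subset] by auto
  have s_in: "[N] \<cdot>\<^bsub>H.T\<^esub> s \<in> H.ext M"
    by (rule H.ext_zmult_subset[OF sub _ std_subset s]) (use N in blast)
  have "x \<in> M"
  proof (rule subgroup_local_global[OF sg x])
    fix l :: nat assume l: "prime l"
    then interpret place B n e c l by (rule placeI)
    have "L.emb x = proj l y \<ominus>\<^bsub>L.T\<^esub> proj l ([N] \<cdot>\<^bsub>H.T\<^esub> s)"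
      unfolding eq using x sc by (simp add: proj_emb a_minus_def L.T.a_assoc L.T.r_neg)
    also have "\<dots> \<in> L.ext M"
      by (rule L.ext_diff[OF sub loc[OF l] proj_in_ext[OF sub s_in]])
    finally show "\<exists>m. \<not> int l dvd m \<and> [m] \<cdot> x \<in> M" by (rule emb_in_ext_local[OF M x])
  qed
  then show ?thesis unfolding eq by (intro H.ext_add[OF sub] H.emb_in_ext s_in)
qed

text \<open>After clearing a denominator the coordinates are profinite integers, and these vanish if
  all their components do.\<close>

lemma proj_eq_zero:
  assumes y: "y \<in> carrier H.T" and zero: "\<And>l. prime l \<Longrightarrow> proj l y = \<zero>\<^bsub>scalar_ext (padic_int l) B\<^esub>"
  shows "y = \<zero>\<^bsub>H.T\<^esub>"
proof -
  obtain k z where k: "k > 0" and z: "\<forall>j<n. z j \<in> carrier zhat" and kz: "[(k::int)] \<cdot>\<^bsub>H.T\<^esub> y = H.comb z"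
    using H.T_cases[OF y] by blast
  have zero_comb: "H.comb (\<lambda>_. \<zero>\<^bsub>zhat\<^esub>) = \<zero>\<^bsub>H.T\<^esub>"
    using H.comb_zmult[of "\<lambda>_. \<zero>\<^bsub>zhat\<^esub>" 0] by simp
  have "z j = \<zero>\<^bsub>zhat\<^esub>" if j: "j < n" for j
  proof (rule zhat_eqI)
    fix l :: nat assume l: "prime l"
    then interpret place B n e c l by (rule placeI)
    have zl: "z j l \<in> carrier (padic_int l)" "\<zero>\<^bsub>zhat\<^esub> l = \<zero>\<^bsub>padic_int l\<^esub>" if "j < n" for j
      using z that ring_hom_closed[OF zhat_proj[OF l]] abelian_group_hom.hom_zero[OF zhat_proj_hom[OF l]] by auto
    have "L.comb (\<lambda>j. z j l) = L.comb (\<lambda>_. \<zero>\<^bsub>zhat\<^esub> l)"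
      using proj.hom_zmult[OF y, of k] zero[OF l] kz proj_comb[of z] z zero_comb proj_comb[of "\<lambda>_. \<zero>\<^bsub>zhat\<^esub>"] by simp
    then show "z j l = \<zero>\<^bsub>zhat\<^esub> l" using zl j by (rule_tac L.comb_inj) auto
  qed (use z j in auto)
  then have "H.comb z = H.comb (\<lambda>_. \<zero>\<^bsub>zhat\<^esub>)"
    unfolding H.comb_def by (intro H.T.finsum_cong') auto
  then show ?thesis using kz zero_comb y k by (intro H.R.zmult_eq_zero[of k y]) auto
qed

lemma proj_eqI:
  assumes "x \<in> carrier H.T" "y \<in> carrier H.T" "\<And>l. prime l \<Longrightarrow> proj l x = proj l y"
  shows "x = y"
proof -
  have "x \<ominus>\<^bsub>H.T\<^esub> y = \<zero>\<^bsub>H.T\<^esub>"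
  proof (rule proj_eq_zero)
    fix l :: nat assume l: "prime l"
    then interpret place B n e c l by (rule placeI)
    show "proj l (x \<ominus>\<^bsub>H.T\<^esub> y) = \<zero>\<^bsub>L.T\<^esub>"
      using assms(1,2) assms(3)[OF l] by (simp add: a_minus_def L.T.r_neg)
  qed (use assms in simp)
  then show ?thesis by (rule H.T.diff_eq_zero[OF assms(1,2)])
qed

text \<open>The common denominator k plays the part of the restricted product condition: after
  multiplication by k all coordinates are l-adic integers, and for each basis vector they form one
  profinite integer.\<close>

lemma proj_glue:
  assumes x: "\<And>l. prime l \<Longrightarrow> x l \<in> carrier (scalar_ext (padic_int l) B)" and k: "(k::int) > 0"
    and kx: "\<And>l. prime l \<Longrightarrow> [k] \<cdot>\<^bsub>scalar_ext (padic_int l) B\<^esub> x l \<in> lattice_ext (padic_int l) B std_lattice"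
  shows "\<exists>y\<in>carrier H.T. \<forall>l. prime l \<longrightarrow> proj l y = x l"
proof -
  have "\<exists>w. (\<forall>j<n. w j \<in> carrier (padic_int l)) \<and>
      [k] \<cdot>\<^bsub>scalar_ext (padic_int l) B\<^esub> x l = extension.comb B n e (padic_int l) w" if l: "prime l" for l
  proof -
    from l interpret place B n e c l by (rule placeI)
    show ?thesis using kx[OF l] unfolding L.ext_std by auto
  qed
  then have "\<forall>l. \<exists>w. prime l \<longrightarrow> (\<forall>j<n. w j \<in> carrier (padic_int l)) \<and>
      [k] \<cdot>\<^bsub>scalar_ext (padic_int l) B\<^esub> x l = extension.comb B n e (padic_int l) w" by simp
  from choice[OF this] obtain w where w: "\<And>l. prime l \<Longrightarrow> (\<forall>j<n. w l j \<in> carrier (padic_int l)) \<and>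
      [k] \<cdot>\<^bsub>scalar_ext (padic_int l) B\<^esub> x l = extension.comb B n e (padic_int l) (w l)" by blast
  define z where "z j = (\<lambda>l\<in>{l. prime l}. w l j)" for j
  have z: "z j \<in> carrier zhat" if "j < n" for j
    using w that by (auto simp: z_def zhat_carrier)
  obtain y where y: "y \<in> carrier H.T" "[k] \<cdot>\<^bsub>H.T\<^esub> y = H.comb z"
    using H.R.zmult_divide[of "H.comb z" k] H.comb_closed[of z] z k by (metis less_irrefl)
  have "proj l y = x l" if l: "prime l" for l
  proof -
    from l interpret place B n e c l by (rule placeI)
    have "L.comb (\<lambda>j. z j l) = L.comb (w l)"
      unfolding L.comb_def by (intro L.T.finsum_cong') (use w[OF l] l in \<open>auto simp: z_def\<close>)
    then have "[k] \<cdot>\<^bsub>L.T\<^esub> proj l y = [k] \<cdot>\<^bsub>L.T\<^esub> x l"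
      using proj.hom_zmult[OF y(1), of k] proj_comb[of z] z w[OF l] y(2) by simp
    then show ?thesis by (rule L.R.zmult_cancel) (use x[OF l] y k in auto)
  qed
  then show ?thesis using y(1) by blast
qed

end

section \<open>Left ideals and ideles\<close>

lemma (in monoid) r_coset_unit_iff:
  assumes "x \<in> Units G" "S \<subseteq> carrier G"
  shows "t \<in> S #> x \<longleftrightarrow> t \<in> carrier G \<and> t \<otimes> inv x \<in> S"
proof
  assume "t \<in> S #> x"
  then obtain h where h: "h \<in> S" "t = h \<otimes> x" unfolding r_coset_def by blast
  then have "h \<in> carrier G" using assms(2) by blast
  then show "t \<in> carrier G \<and> t \<otimes> inv x \<in> S"
    using h assms(1) by (simp add: m_assoc Units_closed Units_r_inv)
next
  assume t: "t \<in> carrier G \<and> t \<otimes> inv x \<in> S"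
  then have "t = (t \<otimes> inv x) \<otimes> x" using assms(1) by (simp add: m_assoc Units_closed Units_l_inv)
  with t show "t \<in> S #> x" unfolding r_coset_def by blast
qed

lemma (in monoid) r_coset_r_coset:
  "\<lbrakk>S \<subseteq> carrier G; x \<in> carrier G; y \<in> carrier G\<rbrakk> \<Longrightarrow> S #> x #> y = S #> (x \<otimes> y)"
  unfolding r_coset_def by (auto simp: m_assoc subset_iff)

lemma ring_hom_Units:
  assumes "ring A" "ring B" "h \<in> ring_hom A B" "x \<in> Units A"
  shows "h x \<in> Units B" "h (inv\<^bsub>A\<^esub> x) = inv\<^bsub>B\<^esub> (h x)"
proof -
  interpret A: ring A by fact
  interpret B: ring B by fact
  have c: "x \<in> carrier A" "inv\<^bsub>A\<^esub> x \<in> carrier A" using assms(4) by auto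
  have e: "h x \<otimes>\<^bsub>B\<^esub> h (inv\<^bsub>A\<^esub> x) = \<one>\<^bsub>B\<^esub>" "h (inv\<^bsub>A\<^esub> x) \<otimes>\<^bsub>B\<^esub> h x = \<one>\<^bsub>B\<^esub>"
    using assms(4) ring_hom_mult[OF assms(3) c] ring_hom_mult[OF assms(3) c(2,1)] ring_hom_one[OF assms(3)]
    by (simp_all add: A.Units_r_inv A.Units_l_inv)
  have hc: "h x \<in> carrier B" "h (inv\<^bsub>A\<^esub> x) \<in> carrier B" using c ring_hom_closed[OF assms(3)] by auto
  show "h x \<in> Units B" unfolding Units_def using e hc by blast
  show "h (inv\<^bsub>A\<^esub> x) = inv\<^bsub>B\<^esub> (h x)" by (rule B.inv_unique'[OF hc e(1) e(2)])
qed

context rat_alg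
begin

text \<open>A finitely generated abelian group is finite modulo K: the coefficient of each new
  generator is reduced modulo K.\<close>

lemma generate_mod_finite:
  assumes "finite S" "S \<subseteq> carrier B" "(K::int) > 0"
  shows "\<exists>F. finite F \<and> F \<subseteq> carrier B \<and>
    (\<forall>x\<in>generate (add_monoid B) S. \<exists>f\<in>F. \<exists>y\<in>generate (add_monoid B) S. x = f \<oplus> [K] \<cdot> y)"
  using assms(1,2)
proof (induction S)
  case empty
  have "generate (add_monoid B) {} = {\<zero>}"
  proof
    show "generate (add_monoid B) {} \<subseteq> {\<zero>}"
    proof
      fix x assume "x \<in> generate (add_monoid B) {}"
      then show "x \<in> {\<zero>}" using empty_subsetI
        by (induction x rule: generate_add_induct) (auto simp: a_minus_def)
    qed
    show "{\<zero>} \<subseteq> generate (add_monoid B) {}" using generate.one[of "add_monoid B"] by simp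
  qed
  then show ?case by (intro exI[of _ "{\<zero>}"]) simp
next
  case (insert s S)
  let ?G = "generate (add_monoid B) S" and ?G' = "generate (add_monoid B) (insert s S)"
  have sg: "subgroup ?G (add_monoid B)" "subgroup ?G' (add_monoid B)"
    using insert.prems add.generate_is_subgroup[of S] add.generate_is_subgroup[of "insert s S"] by auto
  have GG': "?G \<subseteq> ?G'" by (rule add.mono_generate) auto
  have s: "s \<in> carrier B" "s \<in> ?G'" using insert.prems by (auto intro: generate.incl)
  have Gc: "x \<in> carrier B" if "x \<in> ?G" for x
    using that insert.prems add.generate_incl[of S] by auto
  have split: "\<exists>a::int. \<exists>x'\<in>?G. x = [a] \<cdot> s \<oplus> x'" if "x \<in> ?G'" for x
    using that insert.prems
  proof (induction x rule: generate_add_induct)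
    case (gen t)
    show ?case
    proof (cases "t = s")
      case True
      have "t = [(1::int)] \<cdot> s \<oplus> \<zero>" using True s by simp
      then show ?thesis using subgroup_zero[OF sg(1)] by blast
    next
      case False
      then have "t \<in> ?G" using gen by (auto intro: generate.incl)
      moreover have "t = [(0::int)] \<cdot> s \<oplus> t" using Gc[OF \<open>t \<in> ?G\<close>] by simp
      ultimately show ?thesis by blast
    qed
  next
    case zero
    have "\<zero> = [(0::int)] \<cdot> s \<oplus> \<zero>" by simp
    then show ?case using subgroup_zero[OF sg(1)] by blast
  next
    case (diff x y)
    then obtain a x' b y' where *: "x' \<in> ?G" "x = [(a::int)] \<cdot> s \<oplus> x'" "y' \<in> ?G" "y = [(b::int)] \<cdot> s \<oplus> y'"
      by blast
    have "x \<ominus> y = [(a + - b)] \<cdot> s \<oplus> (x' \<ominus> y')"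
      unfolding * using s Gc[OF *(1)] Gc[OF *(3)] by (simp only: zmult_add zmult_neg a_minus_def minus_add a_ac
          a_closed a_inv_closed zmult_closed)
    then show ?case using subgroup_diff[OF sg(1) *(1) *(3)] by blast
  qed
  obtain F where F: "finite F" "F \<subseteq> carrier B" "\<forall>x\<in>?G. \<exists>f\<in>F. \<exists>y\<in>?G. x = f \<oplus> [K] \<cdot> y"
    using insert by auto
  define F' where "F' = (\<lambda>(a, f). [(a::int)] \<cdot> s \<oplus> f) ` ({0..<K} \<times> F)"
  have "\<exists>f\<in>F'. \<exists>y\<in>?G'. x = f \<oplus> [K] \<cdot> y" if x: "x \<in> ?G'" for x
  proof -
    obtain a :: int and x' where x': "x' \<in> ?G" "x = [a] \<cdot> s \<oplus> x'" using split[OF x] by blast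
    obtain f y where f: "f \<in> F" "y \<in> ?G" "x' = f \<oplus> [K] \<cdot> y" using F(3) x'(1) by blast
    have c: "f \<in> carrier B" "y \<in> carrier B" using f F(2) Gc by auto
    have "[a] \<cdot> s = [(a mod K)] \<cdot> s \<oplus> [K] \<cdot> ([(a div K)] \<cdot> s)"
      using zmult_add[OF s(1), of "a mod K" "K * (a div K)"] s(1) by (simp add: zmult_zmult)
    then have "x = ([(a mod K)] \<cdot> s \<oplus> f) \<oplus> [K] \<cdot> ([(a div K)] \<cdot> s \<oplus> y)"
      unfolding x'(2) f(3) using c s(1) by (simp add: zmult_distrib a_ac)
    moreover have "[(a mod K)] \<cdot> s \<oplus> f \<in> F'"
    proof -
      have "a mod K \<in> {0..<K}" using assms(3) by simp
      with f(1) show ?thesis unfolding F'_def by force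
    qed
    moreover have "[(a div K)] \<cdot> s \<oplus> y \<in> ?G'"
      by (rule subgroup_add[OF sg(2) subgroup_zmult[OF sg(2) s(2)]]) (use f GG' in blast)
    ultimately show ?thesis by blast
  qed
  moreover have "finite F'" "F' \<subseteq> carrier B" using F s by (auto simp: F'_def)
  ultimately show ?case by blast
qed

text \<open>The point is finite generation of I. Modulo M N L there are finitely many classes in L,
  with representatives F; if M b = f + M N y, then b - N y lies in I and M maps it to f. So N L
  together with the elements of I that M sends into F generate I, and these are finitely many as
  multiplication by M is injective.\<close>

lemma lattice_between:
  assumes L: "is_lattice B L" and I: "subgroup I (add_monoid B)" and N: "(N::int) > 0" and M: "(M::int) > 0"
    and NL: "\<And>x. x \<in> L \<Longrightarrow> [N] \<cdot> x \<in> I" and MI: "\<And>x. x \<in> I \<Longrightarrow> [M] \<cdot> x \<in> L"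
  shows "is_lattice B I"
proof -
  obtain S where S: "finite S" "S \<subseteq> carrier B" "L = generate (add_monoid B) S"
    using L unfolding is_lattice_iff by blast
  have Lc: "L \<subseteq> carrier B" by (rule lattice_subset[OF L])
  have Ic: "I \<subseteq> carrier B" using subgroup.subset[OF I] by simp
  obtain F where F: "finite F" "F \<subseteq> carrier B" "\<forall>x\<in>L. \<exists>f\<in>F. \<exists>y\<in>L. x = f \<oplus> [(M * N)] \<cdot> y"
    using generate_mod_finite[OF S(1,2), of "M * N"] N M S(3) by auto
  define G where "G = (\<lambda>s. [N] \<cdot> s) ` S \<union> {b \<in> I. [M] \<cdot> b \<in> F}"
  have "inj_on (\<lambda>b. [M] \<cdot> b) {b \<in> I. [M] \<cdot> b \<in> F}"
  proof (rule inj_onI)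
    fix x y assume "x \<in> {b \<in> I. [M] \<cdot> b \<in> F}" "y \<in> {b \<in> I. [M] \<cdot> b \<in> F}" and eq: "[M] \<cdot> x = [M] \<cdot> y"
    then have "x \<in> carrier B" "y \<in> carrier B" using Ic by auto
    then show "x = y" using zmult_cancel[OF eq] M by simp
  qed
  then have "finite {b \<in> I. [M] \<cdot> b \<in> F}"
    by (rule inj_on_finite[of _ _ F]) (use F(1) in auto)
  then have fin: "finite G" using S(1) by (simp add: G_def)
  have SL: "S \<subseteq> L" using S(3) by (auto intro: generate.incl)
  have GI: "G \<subseteq> I" using NL SL by (auto simp: G_def)
  have Gc: "G \<subseteq> carrier B" using GI Ic by blast
  have sgG: "subgroup (generate (add_monoid B) G) (add_monoid B)" using add.generate_is_subgroup Gc by simp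
  have NG: "[N] \<cdot> y \<in> generate (add_monoid B) G" if "y \<in> L" for y
    using that[unfolded S(3)] S(2)
  proof (induction y rule: generate_add_induct)
    case (gen s) then show ?case by (auto simp: G_def intro!: generate.incl)
  next
    case zero show ?case using subgroup_zero[OF sgG] by simp
  next
    case (diff x y) then show ?case using subgroup_diff[OF sgG] by (simp add: zmult_diff)
  qed
  have "I = generate (add_monoid B) G"
  proof
    show "generate (add_monoid B) G \<subseteq> I" using add.generate_subgroup_incl[OF GI I] by simp
    show "I \<subseteq> generate (add_monoid B) G"
    proof
      fix b assume b: "b \<in> I"
      then have bc: "b \<in> carrier B" using Ic by blast
      obtain f y where f: "f \<in> F" "y \<in> L" "[M] \<cdot> b = f \<oplus> [(M * N)] \<cdot> y" using F(3) MI[OF b] by blast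
      have c: "f \<in> carrier B" "y \<in> carrier B" using f F(2) Lc by auto
      define b' where "b' = b \<ominus> [N] \<cdot> y"
      have "b' \<in> I" unfolding b'_def by (rule subgroup_diff[OF I b NL[OF f(2)]])
      moreover have "[M] \<cdot> b' = f"
      proof -
        have "[M] \<cdot> b' = f \<oplus> [(M * N)] \<cdot> y \<ominus> [(M * N)] \<cdot> y"
          unfolding b'_def using bc c f(3) by (simp add: zmult_diff zmult_zmult)
        also have "\<dots> = f" using c by (simp add: a_minus_def a_assoc r_neg)
        finally show ?thesis .
      qed
      ultimately have "b' \<in> generate (add_monoid B) G"
        using f(1) by (auto simp: G_def intro!: generate.incl)
      moreover have "b = b' \<oplus> [N] \<cdot> y"
        unfolding b'_def using bc c by (simp add: a_minus_def a_assoc l_neg)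
      ultimately show "b \<in> generate (add_monoid B) G"
        using subgroup_add[OF sgG _ NG[OF f(2)]] by simp
    qed
  qed
  moreover have "\<exists>m>0. [(m::int)] \<cdot> x \<in> I" if x: "x \<in> carrier B" for x
  proof -
    obtain m where m: "m > 0" "[(m::int)] \<cdot> x \<in> L" using L x unfolding is_lattice_iff by blast
    then have "[(N * m)] \<cdot> x \<in> I" using NL[OF m(2)] x by (simp add: zmult_zmult)
    then show ?thesis using m N by (intro exI[of _ "N * m"]) simp
  qed
  ultimately show ?thesis unfolding is_lattice_iff using fin Gc by blast
qed

lemma lattice_r_coset:
  assumes L: "is_lattice B L" and \<alpha>: "\<alpha> \<in> Units B"
  shows "is_lattice B (L #> \<alpha>)"
proof -
  obtain S where S: "finite S" "S \<subseteq> carrier B" "L = generate (add_monoid B) S"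
    using L unfolding is_lattice_iff by blast
  interpret h: abelian_group_hom B B "\<lambda>x. x \<otimes> \<alpha>"
    by (rule abelian_group_homI') (use \<alpha> in \<open>auto simp: l_distr is_abelian_group\<close>)
  have "L #> \<alpha> = (\<lambda>x. x \<otimes> \<alpha>) ` L" unfolding r_coset_def by blast
  also have "\<dots> = generate (add_monoid B) ((\<lambda>x. x \<otimes> \<alpha>) ` S)" unfolding S(3) by (rule h.hom_generate[OF S(2)])
  finally have "L #> \<alpha> = generate (add_monoid B) ((\<lambda>x. x \<otimes> \<alpha>) ` S)" .
  moreover have "\<exists>m>0. [(m::int)] \<cdot> x \<in> L #> \<alpha>" if x: "x \<in> carrier B" for x
  proof -
    obtain m where m: "m > 0" "[(m::int)] \<cdot> (x \<otimes> inv \<alpha>) \<in> L"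
      using L x \<alpha> unfolding is_lattice_iff by (meson Units_inv_closed m_closed)
    then have "[m] \<cdot> x \<in> L #> \<alpha>"
      using x \<alpha> r_coset_unit_iff[OF \<alpha> lattice_subset[OF L]] by (simp add: zmult_mult_left)
    then show ?thesis using m by blast
  qed
  moreover have "finite ((\<lambda>x. x \<otimes> \<alpha>) ` S)" "(\<lambda>x. x \<otimes> \<alpha>) ` S \<subseteq> carrier B" using S \<alpha> by auto
  ultimately show ?thesis unfolding is_lattice_iff by blast
qed

end

context extension
begin

lemma ext_r_coset:
  assumes M: "M \<subseteq> carrier B" and \<alpha>: "\<alpha> \<in> carrier B"
  shows "ext (M #>\<^bsub>B\<^esub> \<alpha>) = ext M #>\<^bsub>T\<^esub> emb \<alpha>"
proof -
  interpret h: abelian_group_hom T T "\<lambda>x. x \<otimes>\<^bsub>T\<^esub> emb \<alpha>"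
    by (rule abelian_group_homI') (use \<alpha> in \<open>auto simp: T.l_distr T.is_abelian_group\<close>)
  have mult: "elem x z \<otimes>\<^bsub>T\<^esub> emb \<alpha> = elem (x \<otimes>\<^bsub>B\<^esub> \<alpha>) z" if "x \<in> M" "z \<in> carrier Z" for x z
    using that M \<alpha> by (auto simp: emb_elem elem_mult)
  have "ext M #>\<^bsub>T\<^esub> emb \<alpha> = (\<lambda>x. x \<otimes>\<^bsub>T\<^esub> emb \<alpha>) ` ext M" unfolding r_coset_def by blast
  also have "\<dots> = generate (add_monoid T) ((\<lambda>x. x \<otimes>\<^bsub>T\<^esub> emb \<alpha>) ` {elem x z | x z. x \<in> M \<and> z \<in> carrier Z})"
    unfolding ext_def by (rule h.hom_generate[OF ext_gens_closed[OF M]])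
  also have "(\<lambda>x. x \<otimes>\<^bsub>T\<^esub> emb \<alpha>) ` {elem x z | x z. x \<in> M \<and> z \<in> carrier Z}
      = {elem x z | x z. x \<in> M #>\<^bsub>B\<^esub> \<alpha> \<and> z \<in> carrier Z}" (is "?A = ?B")
  proof
    show "?A \<subseteq> ?B" unfolding r_coset_def using mult by blast
    show "?B \<subseteq> ?A"
    proof
      fix y assume "y \<in> ?B"
      then obtain x z where "y = elem (x \<otimes>\<^bsub>B\<^esub> \<alpha>) z" "x \<in> M" "z \<in> carrier Z" unfolding r_coset_def by blast
      then have "y = elem x z \<otimes>\<^bsub>T\<^esub> emb \<alpha>" "x \<in> M" "z \<in> carrier Z" using mult by auto
      then show "y \<in> ?A" by blast
    qed
  qed
  finally show ?thesis unfolding ext_def ..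
qed

end

context place
begin

text \<open>N is invertible in the l-adic integers, so x tensor z equals N x tensor z/N.\<close>

lemma ext_subset_of_coprime:
  assumes N: "\<not> int l dvd N" "\<And>x. x \<in> M \<Longrightarrow> [N] \<cdot> x \<in> M'" and M: "M \<subseteq> carrier B" "M' \<subseteq> carrier B"
  shows "L.ext M \<subseteq> L.ext M'"
proof
  fix y assume "y \<in> L.ext M"
  then show "y \<in> L.ext M'" using M(1)
  proof (induction y rule: L.ext_induct)
    case (elem x z)
    have "coprime (int l) N" using N(1) prime_l by (intro prime_imp_coprime) auto
    then have "coprime N (int l)" by (simp add: coprime_commute)
    then obtain w where w: "w \<in> carrier (padic_int l)" "[N] \<cdot>\<^bsub>padic_int l\<^esub> w = z"
      using padic_div_coprime[OF prime_l elem(2)] by blast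
    have x: "x \<in> carrier B" using elem M by blast
    have "L.elem x z = L.elem ([N] \<cdot> x) w"
      using L.elem_zmult[OF x w(1), of N] w(2) by simp
    then show ?case using L.elem_in_ext[OF N(2)[OF elem(1)] w(1)] by simp
  qed (use L.ext_zero L.ext_diff M(2) in blast)+
qed

end

section \<open>From left ideals to ideles\<close>

locale rat_order = rat_basis +
  fixes R :: "'a set"
  assumes order: "is_order B R"
begin

lemma R_lattice: "is_lattice B R"
  using order by (simp add: is_order_def)

lemma R_one: "\<one> \<in> R" and R_mult: "\<lbrakk>x \<in> R; y \<in> R\<rbrakk> \<Longrightarrow> x \<otimes> y \<in> R"
  using order subringE(3,6) by (auto simp: is_order_def)

lemma R_subset: "R \<subseteq> carrier B"
  by (rule lattice_subset[OF R_lattice])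

lemma extR_mult: "\<lbrakk>x \<in> H.ext R; y \<in> H.ext R\<rbrakk> \<Longrightarrow> x \<otimes>\<^bsub>H.T\<^esub> y \<in> H.ext R"
  by (rule H.ext_mult[OF R_subset R_subset R_mult R_subset])

lemma extR_one: "\<one>\<^bsub>H.T\<^esub> \<in> H.ext R"
  using H.emb_in_ext[OF R_one] by simp

lemma extR_closed: "H.ext R \<subseteq> carrier H.T"
  by (rule H.ext_closed[OF R_subset])

text \<open>The finitely many exceptional primes are cleared one by one; at all others the element
  is 1, and one integer m moving 1 into the standard lattice of B serves them together.\<close>

lemma uniform_denominator:
  assumes F: "finite F" "\<And>l. l \<in> F \<Longrightarrow> prime l"
    and x: "\<And>l. prime l \<Longrightarrow> x l \<in> carrier (scalar_ext (padic_int l) B)"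
    and one: "\<And>l. \<lbrakk>prime l; l \<notin> F\<rbrakk> \<Longrightarrow> x l = \<one>\<^bsub>scalar_ext (padic_int l) B\<^esub>"
  shows "\<exists>k>0. \<forall>l. prime l \<longrightarrow> [(k::int)] \<cdot>\<^bsub>scalar_ext (padic_int l) B\<^esub> x l \<in> lattice_ext (padic_int l) B std_lattice"
proof -
  have "\<exists>k>0. \<forall>l\<in>F. [(k::int)] \<cdot>\<^bsub>scalar_ext (padic_int l) B\<^esub> x l \<in> lattice_ext (padic_int l) B std_lattice"
    using F
  proof (induction F)
    case empty show ?case by (auto intro: exI[of _ 1])
  next
    case (insert p F)
    then obtain k where k: "k > 0" "\<And>l. l \<in> F \<Longrightarrow> [(k::int)] \<cdot>\<^bsub>scalar_ext (padic_int l) B\<^esub> x l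
      \<in> lattice_ext (padic_int l) B std_lattice" by auto
    have p: "prime p" using insert.prems by simp
    then interpret P: place B n e c p by (rule placeI)
    obtain m where m: "m > 0" "[(m::int)] \<cdot>\<^bsub>P.L.T\<^esub> x p \<in> P.L.ext std_lattice"
      using P.L.zmult_in_ext_std[OF x[OF p]] by blast
    have "[(k * m)] \<cdot>\<^bsub>scalar_ext (padic_int l) B\<^esub> x l \<in> lattice_ext (padic_int l) B std_lattice"
      if l: "l \<in> insert p F" for l
    proof -
      have pl: "prime l" using insert.prems l by simp
      then interpret place B n e c l by (rule placeI)
      show ?thesis
      proof (cases "l = p")
        case True
        have "[k] \<cdot>\<^bsub>L.T\<^esub> ([m] \<cdot>\<^bsub>L.T\<^esub> x l) \<in> L.ext std_lattice"
          by (rule L.ext_zmult[OF std_subset]) (use m True in simp)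
        then show ?thesis using x[OF pl] by (simp add: L.T.zmult_zmult)
      next
        case False
        then have "[m] \<cdot>\<^bsub>L.T\<^esub> ([k] \<cdot>\<^bsub>L.T\<^esub> x l) \<in> L.ext std_lattice"
          using k(2) l by (intro L.ext_zmult[OF std_subset, of _ m]) simp
        then show ?thesis using x[OF pl] by (simp add: L.T.zmult_zmult mult.commute)
      qed
    qed
    then show ?case using k(1) m(1) by (intro exI[of _ "k * m"]) simp
  qed
  then obtain k where k: "k > 0" "\<And>l. l \<in> F \<Longrightarrow> [(k::int)] \<cdot>\<^bsub>scalar_ext (padic_int l) B\<^esub> x l
      \<in> lattice_ext (padic_int l) B std_lattice" by auto
  obtain m where m: "m > 0" "[(m::int)] \<cdot> \<one> \<in> std_lattice" using zmult_in_std[OF one_closed] by blast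
  have "[(k * m)] \<cdot>\<^bsub>scalar_ext (padic_int l) B\<^esub> x l \<in> lattice_ext (padic_int l) B std_lattice"
    if l: "prime l" for l
  proof -
    from l interpret place B n e c l by (rule placeI)
    show ?thesis
    proof (cases "l \<in> F")
      case True
      then have "[m] \<cdot>\<^bsub>L.T\<^esub> ([k] \<cdot>\<^bsub>L.T\<^esub> x l) \<in> L.ext std_lattice"
        using k(2) by (intro L.ext_zmult[OF std_subset, of _ m]) simp
      then show ?thesis using x[OF l] by (simp add: L.T.zmult_zmult mult.commute)
    next
      case False
      have "[k] \<cdot>\<^bsub>L.T\<^esub> (L.emb ([m] \<cdot> \<one>)) \<in> L.ext std_lattice"
        by (rule L.ext_zmult[OF std_subset L.emb_in_ext[OF m(2)]])
      then show ?thesis using one[OF l False] L.emb.hom_zmult[OF one_closed, of m]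
        by (simp add: L.T.zmult_zmult)
    qed
  qed
  then show ?thesis using k(1) m(1) by (intro exI[of _ "k * m"]) simp
qed

lemma left_ideal_adelic_generator:
  assumes I: "left_ideal_of B R I"
  shows "\<exists>x\<in>Units H.T. H.ext I = H.ext R #>\<^bsub>H.T\<^esub> x"
proof -
  have IL: "is_lattice B I" using I by (simp add: left_ideal_of_def)
  note Ic = lattice_subset[OF IL]
  obtain N1 where N1: "N1 > 0" "\<forall>x\<in>I. [(N1::int)] \<cdot> x \<in> R" using lattice_commensurable[OF IL R_lattice] by blast
  obtain N2 where N2: "N2 > 0" "\<forall>x\<in>R. [(N2::int)] \<cdot> x \<in> I" using lattice_commensurable[OF R_lattice IL] by blast
  \<comment> \<open>At primes outside F both N1 and N2 are invertible, so the completions of I and R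
    coincide there and 1 is a generator.\<close>
  define F where "F = {l. prime l \<and> l dvd nat (N1 * N2)}"
  have Fin: "finite F"
    unfolding F_def by (rule finite_subset[of _ "{..nat (N1 * N2)}"]) (use N1 N2 in \<open>auto intro: dvd_imp_le\<close>)
  have "\<exists>x. prime l \<longrightarrow> x \<in> Units (scalar_ext (padic_int l) B) \<and>
      lattice_ext (padic_int l) B I = lattice_ext (padic_int l) B R #>\<^bsub>scalar_ext (padic_int l) B\<^esub> x \<and>
      (l \<notin> F \<longrightarrow> x = \<one>\<^bsub>scalar_ext (padic_int l) B\<^esub>)" for l
  proof (cases "prime l \<and> l \<notin> F")
    case True
    then have l: "prime l" by simp
    then interpret place B n e c l by (rule placeI)
    have "\<not> int l dvd N1 * N2"
      using True N1 N2 unfolding F_def by (auto simp: int_dvd_int_iff[symmetric] simp del: int_dvd_int_iff)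
    then have "\<not> int l dvd N1" "\<not> int l dvd N2" by auto
    then have "L.ext I = L.ext R"
      using ext_subset_of_coprime[of N1 I R] ext_subset_of_coprime[of N2 R I] N1 N2 Ic R_subset by blast
    moreover have "L.ext R #>\<^bsub>L.T\<^esub> \<one>\<^bsub>L.T\<^esub> = L.ext R"
      using L.T.r_coset_unit_iff[OF L.T.Units_one_closed L.ext_closed[OF R_subset]] L.ext_closed[OF R_subset]
      by auto
    ultimately show ?thesis by auto
  next
    case False
    then show ?thesis using I unfolding left_ideal_of_def by blast
  qed
  then have "\<forall>l. \<exists>x. prime l \<longrightarrow> x \<in> Units (scalar_ext (padic_int l) B) \<and>
      lattice_ext (padic_int l) B I = lattice_ext (padic_int l) B R #>\<^bsub>scalar_ext (padic_int l) B\<^esub> x \<and>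
      (l \<notin> F \<longrightarrow> x = \<one>\<^bsub>scalar_ext (padic_int l) B\<^esub>)" ..
  from choice[OF this] obtain x where x: "\<And>l. prime l \<Longrightarrow> x l \<in> Units (scalar_ext (padic_int l) B)"
      "\<And>l. prime l \<Longrightarrow> lattice_ext (padic_int l) B I = lattice_ext (padic_int l) B R #>\<^bsub>scalar_ext (padic_int l) B\<^esub> x l"
      "\<And>l. \<lbrakk>prime l; l \<notin> F\<rbrakk> \<Longrightarrow> x l = \<one>\<^bsub>scalar_ext (padic_int l) B\<^esub>" by blast
  \<comment> \<open>The inverses are glued separately. They too are 1 outside F, and comparing
    components shows that the two glued elements are inverse to each other.\<close>
  define y where "y l = inv\<^bsub>scalar_ext (padic_int l) B\<^esub> x l" for l
  have T_ring: "ring (scalar_ext (padic_int l) B)" if l: "prime l" for l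
  proof -
    from l interpret place B n e c l by (rule placeI)
    show ?thesis by (rule L.T.ring_axioms)
  qed
  have T_mon: "monoid (scalar_ext (padic_int l) B)" if "prime l" for l
    using T_ring[OF that] by (rule ring.is_monoid)
  have F: "\<And>l. l \<in> F \<Longrightarrow> prime l" by (simp add: F_def)
  have xc: "x l \<in> carrier (scalar_ext (padic_int l) B)" if "prime l" for l
    using x(1)[OF that] by (simp add: monoid.Units_closed T_mon that)
  have yc: "y l \<in> carrier (scalar_ext (padic_int l) B)" if "prime l" for l
    using x(1)[OF that] by (simp add: y_def monoid.Units_inv_closed T_mon that)
  have y1: "y l = \<one>\<^bsub>scalar_ext (padic_int l) B\<^esub>" if "prime l" "l \<notin> F" for l
    using x(3)[OF that] by (simp add: y_def monoid.inv_one T_mon that)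
  obtain k where "k > 0" "\<And>l. prime l \<Longrightarrow> [(k::int)] \<cdot>\<^bsub>scalar_ext (padic_int l) B\<^esub> x l
      \<in> lattice_ext (padic_int l) B std_lattice"
    using uniform_denominator[of F x] Fin F xc x(3) by blast
  then obtain X where X: "X \<in> carrier H.T" "\<And>l. prime l \<Longrightarrow> proj l X = x l"
    using proj_glue[of x k] xc by blast
  obtain k' where "k' > 0" "\<And>l. prime l \<Longrightarrow> [(k'::int)] \<cdot>\<^bsub>scalar_ext (padic_int l) B\<^esub> y l
      \<in> lattice_ext (padic_int l) B std_lattice"
    using uniform_denominator[of F y] Fin F yc y1 by blast
  then obtain Y where Y: "Y \<in> carrier H.T" "\<And>l. prime l \<Longrightarrow> proj l Y = y l"
    using proj_glue[of y k'] yc by blast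
  have XY: "X \<otimes>\<^bsub>H.T\<^esub> Y = \<one>\<^bsub>H.T\<^esub>"
  proof (rule proj_eqI)
    fix l :: nat assume l: "prime l"
    then interpret place B n e c l by (rule placeI)
    show "proj l (X \<otimes>\<^bsub>H.T\<^esub> Y) = proj l \<one>\<^bsub>H.T\<^esub>"
      using X Y l x(1)[OF l] by (simp add: proj_mult proj_one y_def L.T.Units_r_inv)
  qed (use X Y in auto)
  have YX: "Y \<otimes>\<^bsub>H.T\<^esub> X = \<one>\<^bsub>H.T\<^esub>"
  proof (rule proj_eqI)
    fix l :: nat assume l: "prime l"
    then interpret place B n e c l by (rule placeI)
    show "proj l (Y \<otimes>\<^bsub>H.T\<^esub> X) = proj l \<one>\<^bsub>H.T\<^esub>"
      using X Y l x(1)[OF l] by (simp add: proj_mult proj_one y_def L.T.Units_l_inv)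
  qed (use X Y in auto)
  have XU: "X \<in> Units H.T" unfolding Units_def using X(1) Y(1) XY YX by blast
  have invX: "inv\<^bsub>H.T\<^esub> X = Y" by (rule H.T.inv_unique'[OF X(1) Y(1) XY YX, symmetric])
  have "t \<in> H.ext I \<longleftrightarrow> t \<in> H.ext R #>\<^bsub>H.T\<^esub> X" if t: "t \<in> carrier H.T" for t
  proof -
    \<comment> \<open>Both memberships are decided place by place, and at each place the chosen
      local generator identifies them.\<close>
    have loc: "proj l t \<in> lattice_ext (padic_int l) B I \<longleftrightarrow> proj l (t \<otimes>\<^bsub>H.T\<^esub> Y) \<in> lattice_ext (padic_int l) B R"
      if l: "prime l" for l
    proof -
      from l interpret place B n e c l by (rule placeI)
      show ?thesis
        unfolding x(2)[OF l] L.T.r_coset_unit_iff[OF x(1)[OF l] L.ext_closed[OF R_subset]]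
        using t Y l by (simp add: proj_mult y_def)
    qed
    have "t \<in> H.ext I \<longleftrightarrow> (\<forall>l. prime l \<longrightarrow> proj l t \<in> lattice_ext (padic_int l) B I)"
      using ext_local_global[OF IL t] place.proj_in_ext[OF placeI Ic] by blast
    also have "\<dots> \<longleftrightarrow> (\<forall>l. prime l \<longrightarrow> proj l (t \<otimes>\<^bsub>H.T\<^esub> Y) \<in> lattice_ext (padic_int l) B R)"
      using loc by blast
    also have "\<dots> \<longleftrightarrow> t \<otimes>\<^bsub>H.T\<^esub> Y \<in> H.ext R"
      using ext_local_global[OF R_lattice H.T.m_closed[OF t Y(1)]] place.proj_in_ext[OF placeI R_subset] by blast
    also have "\<dots> \<longleftrightarrow> t \<in> H.ext R #>\<^bsub>H.T\<^esub> X"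
      unfolding H.T.r_coset_unit_iff[OF XU extR_closed] invX using t by blast
    finally show ?thesis .
  qed
  then have "H.ext I = H.ext R #>\<^bsub>H.T\<^esub> X"
    using H.ext_closed[OF Ic] H.T.r_coset_unit_iff[OF XU extR_closed] by blast
  with XU show ?thesis by blast
qed

end

section \<open>From ideles to left ideals, and the ambiguity of the idele\<close>

context rat_order
begin

lemma extR_absorbs:
  assumes y: "y \<in> carrier H.T"
  shows "\<exists>k>0. [(k::int)] \<cdot>\<^bsub>H.T\<^esub> y \<in> H.ext R"
proof -
  obtain N where N: "N > 0" "\<forall>x\<in>std_lattice. [(N::int)] \<cdot> x \<in> R"
    using lattice_commensurable[OF std_is_lattice R_lattice] by blast
  obtain k where k: "k > 0" "[(k::int)] \<cdot>\<^bsub>H.T\<^esub> y \<in> H.ext std_lattice" using H.zmult_in_ext_std[OF y] by blast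
  have "[N] \<cdot>\<^bsub>H.T\<^esub> ([k] \<cdot>\<^bsub>H.T\<^esub> y) \<in> H.ext R"
    by (rule H.ext_zmult_subset[OF R_subset _ std_subset k(2)]) (use N in blast)
  then show ?thesis using y N(1) k(1) by (intro exI[of _ "N * k"]) (simp add: H.T.zmult_zmult)
qed

text \<open>Integer multiples of x and of its inverse lie in the completion of R, which confines the
  intersection I between multiples of R and so makes it a lattice. Density of B shows that
  completing I gives back the whole coset; the components of x are local generators.\<close>

lemma unit_left_ideal:
  assumes x: "x \<in> Units H.T"
  shows "\<exists>I. left_ideal_of B R I \<and> H.ext I = H.ext R #>\<^bsub>H.T\<^esub> x"
proof -
  define X where "X = H.ext R #>\<^bsub>H.T\<^esub> x"
  define I where "I = {b \<in> carrier B. H.emb b \<in> X}"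
  have xc: "x \<in> carrier H.T" "inv\<^bsub>H.T\<^esub> x \<in> carrier H.T" using x by auto
  have X_iff: "t \<in> X \<longleftrightarrow> t \<in> carrier H.T \<and> t \<otimes>\<^bsub>H.T\<^esub> inv\<^bsub>H.T\<^esub> x \<in> H.ext R" for t
    unfolding X_def by (rule H.T.r_coset_unit_iff[OF x extR_closed])
  have X_diff: "s \<ominus>\<^bsub>H.T\<^esub> t \<in> X" if "s \<in> X" "t \<in> X" for s t
    using that xc H.ext_diff[OF R_subset] by (auto simp: X_iff a_minus_def H.T.l_distr H.T.l_minus)
  have X_add: "s \<oplus>\<^bsub>H.T\<^esub> t \<in> X" if "s \<in> X" "t \<in> X" for s t
    using that xc H.ext_add[OF R_subset] by (auto simp: X_iff H.T.l_distr)
  have X_zero: "\<zero>\<^bsub>H.T\<^esub> \<in> X" using xc H.ext_zero[OF R_subset] by (simp add: X_iff)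
  have X_zmult: "[(k::int)] \<cdot>\<^bsub>H.T\<^esub> t \<in> X" if "t \<in> X" for k t
    using that xc H.ext_zmult[OF R_subset] by (auto simp: X_iff H.T.zmult_mult_left)
  have X_left: "r \<otimes>\<^bsub>H.T\<^esub> t \<in> X" if "r \<in> H.ext R" "t \<in> X" for r t
    using that xc extR_mult extR_closed by (auto simp: X_iff H.T.m_assoc)
  obtain M where M: "M > 0" "[(M::int)] \<cdot>\<^bsub>H.T\<^esub> x \<in> H.ext R" using extR_absorbs[OF xc(1)] by blast
  obtain N where N: "N > 0" "[(N::int)] \<cdot>\<^bsub>H.T\<^esub> (inv\<^bsub>H.T\<^esub> x) \<in> H.ext R" using extR_absorbs[OF xc(2)] by blast
  have MX: "[M] \<cdot>\<^bsub>H.T\<^esub> t \<in> H.ext R" if "t \<in> X" for t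
  proof -
    have t: "t \<in> carrier H.T" "t \<otimes>\<^bsub>H.T\<^esub> inv\<^bsub>H.T\<^esub> x \<in> H.ext R" using that by (auto simp: X_iff)
    have "[M] \<cdot>\<^bsub>H.T\<^esub> t = (t \<otimes>\<^bsub>H.T\<^esub> inv\<^bsub>H.T\<^esub> x) \<otimes>\<^bsub>H.T\<^esub> [M] \<cdot>\<^bsub>H.T\<^esub> x"
      using t(1) x xc by (simp add: H.T.zmult_mult_right H.T.m_assoc H.T.Units_l_inv)
    then show ?thesis using extR_mult[OF t(2) M(2)] by simp
  qed
  have NX: "[N] \<cdot>\<^bsub>H.T\<^esub> r \<in> X" if r: "r \<in> H.ext R" for r
  proof -
    have rc: "r \<in> carrier H.T" using r extR_closed by blast
    have "[N] \<cdot>\<^bsub>H.T\<^esub> r \<otimes>\<^bsub>H.T\<^esub> inv\<^bsub>H.T\<^esub> x = r \<otimes>\<^bsub>H.T\<^esub> [N] \<cdot>\<^bsub>H.T\<^esub> (inv\<^bsub>H.T\<^esub> x)"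
      using rc xc by (simp add: H.T.zmult_mult_right H.T.zmult_mult_left)
    then show ?thesis using extR_mult[OF r N(2)] rc by (simp add: X_iff)
  qed
  have NR: "[N] \<cdot> b \<in> I" if b: "b \<in> R" for b
    using NX[OF H.emb_in_ext[OF b]] R_subset b by (auto simp: I_def H.emb.hom_zmult)
  have MI: "[M] \<cdot> b \<in> R" if b: "b \<in> I" for b
    using MX[of "H.emb b"] b emb_in_ext[OF R_lattice, of "[M] \<cdot> b"] by (simp add: I_def H.emb.hom_zmult)
  have I_sub: "I \<subseteq> carrier B" by (auto simp: I_def)
  have I_zero: "\<zero> \<in> I" using X_zero by (simp add: I_def)
  have I_sg: "subgroup I (add_monoid B)"
  proof (rule add.subgroupI)
    fix a assume "a \<in> I"
    then show "\<ominus> a \<in> I"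
      using X_diff[OF X_zero, of "H.emb a"] by (simp add: I_def a_minus_def)
  next
    fix a b assume "a \<in> I" "b \<in> I"
    then show "a \<oplus> b \<in> I" using X_add by (simp add: I_def)
  qed (use I_sub I_zero in auto)
  have IL: "is_lattice B I"
    by (rule lattice_between[OF R_lattice I_sg N(1) M(1) NR MI])
  have ext_I: "H.ext I = X"
  proof
    show "H.ext I \<subseteq> X"
    proof
      fix y assume "y \<in> H.ext I"
      then show "y \<in> X" using I_sub
      proof (induction y rule: H.ext_induct)
        case (elem b z)
        then have b: "b \<in> carrier B" "H.emb b \<in> X" by (auto simp: I_def)
        have "H.elem b z = H.elem \<one> z \<otimes>\<^bsub>H.T\<^esub> H.emb b"
          using b elem(2) H.Z.r_one by (simp add: H.emb_elem H.elem_mult)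
        then show ?case using X_left[OF H.elem_in_ext[OF R_one elem(2)] b(2)] by simp
      qed (use X_zero X_diff in auto)
    qed
    show "X \<subseteq> H.ext I"
    proof
      fix t assume t: "t \<in> X"
      then have tc: "t \<in> carrier H.T" by (simp add: X_iff)
      obtain N' where N': "N' > 0" "\<forall>x\<in>std_lattice. [(N'::int)] \<cdot> x \<in> R"
        using lattice_commensurable[OF std_is_lattice R_lattice] by blast
      \<comment> \<open>The error of the approximation is made divisible by N N': the factor N'
        moves it into the completion of R, and N moves that into both X and the completion of
        I.\<close>
      have "N * N' > 0" using N N' by simp
      from ext_approx[OF this tc] obtain b s where b: "b \<in> carrier B" and s: "s \<in> H.ext std_lattice"
        and eq: "t = H.emb b \<oplus>\<^bsub>H.T\<^esub> [(N * N')] \<cdot>\<^bsub>H.T\<^esub> s" by blast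
      have sc: "s \<in> carrier H.T" using s H.ext_closed[OF std_subset] by blast
      have s': "[N'] \<cdot>\<^bsub>H.T\<^esub> s \<in> H.ext R"
        by (rule H.ext_zmult_subset[OF R_subset _ std_subset s]) (use N' in blast)
      have eq': "t = H.emb b \<oplus>\<^bsub>H.T\<^esub> [N] \<cdot>\<^bsub>H.T\<^esub> ([N'] \<cdot>\<^bsub>H.T\<^esub> s)"
        unfolding eq using sc by (simp add: H.T.zmult_zmult)
      have "H.emb b = t \<ominus>\<^bsub>H.T\<^esub> [N] \<cdot>\<^bsub>H.T\<^esub> ([N'] \<cdot>\<^bsub>H.T\<^esub> s)"
        unfolding eq' using b sc by (simp add: a_minus_def H.T.a_assoc H.T.r_neg)
      then have "b \<in> I" using b X_diff[OF t NX[OF s']] by (simp add: I_def)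
      moreover have "[N] \<cdot>\<^bsub>H.T\<^esub> ([N'] \<cdot>\<^bsub>H.T\<^esub> s) \<in> H.ext I"
        by (rule H.ext_zmult_subset[OF I_sub NR R_subset s'])
      ultimately show "t \<in> H.ext I"
        unfolding eq' by (intro H.ext_add[OF I_sub] H.emb_in_ext)
    qed
  qed
  have "left_ideal_of B R I"
    unfolding left_ideal_of_def
  proof (intro conjI IL allI impI)
    fix l :: nat assume "prime l"
    then interpret place B n e c l by (rule placeI)
    show "\<exists>y\<in>Units L.T. L.ext I = L.ext R #>\<^bsub>L.T\<^esub> y"
    proof
      show "proj l x \<in> Units L.T"
        by (rule ring_hom_Units(1)[OF H.T.ring_axioms L.T.ring_axioms proj_hom x])
      have "L.ext I = proj l ` X" using proj_ext[OF I_sub] ext_I by simp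
      also have "\<dots> = proj l ` H.ext R #>\<^bsub>L.T\<^esub> proj l x"
        unfolding X_def r_coset_def using extR_closed xc by (auto simp: proj_mult subset_iff image_iff)
      finally show "L.ext I = L.ext R #>\<^bsub>L.T\<^esub> proj l x" using proj_ext[OF R_subset] by simp
    qed
  qed
  then show ?thesis using ext_I X_def by blast
qed

text \<open>A relation and not a function of I, since the idele is determined only up to a unit of
  the completed order on the left.\<close>

definition generated_by where
  "generated_by I x \<longleftrightarrow> left_ideal_of B R I \<and> x \<in> Units H.T \<and> H.ext I = H.ext R #>\<^bsub>H.T\<^esub> x"

lemma left_ideal_lattice: "left_ideal_of B R I \<Longrightarrow> is_lattice B I"
  by (simp add: left_ideal_of_def)

lemma ext_inj:
  assumes "is_lattice B I" "is_lattice B J" "H.ext I = H.ext J"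
  shows "I = J"
proof -
  have "x \<in> L' \<Longrightarrow> H.ext L' = H.ext L \<Longrightarrow> is_lattice B L \<Longrightarrow> is_lattice B L' \<Longrightarrow> x \<in> L" for x L L'
    using emb_in_ext[of L x] H.emb_in_ext[of x L'] lattice_subset[of L'] by auto
  then show ?thesis using assms by (metis subsetI subset_antisym)
qed

lemma generated_by_unique: "\<lbrakk>generated_by I x; generated_by J x\<rbrakk> \<Longrightarrow> I = J"
  unfolding generated_by_def using ext_inj left_ideal_lattice by metis

text \<open>Each of two generators lies in the coset of the other, because R contains 1; so their
  two quotients are mutually inverse elements of the completed order. Conversely a unit of that
  order maps it onto itself.\<close>

lemma generated_by_iff:
  assumes I: "generated_by I x"
  shows "generated_by I y \<longleftrightarrow> (\<exists>u\<in>Units (H.T \<lparr>carrier := H.ext R\<rparr>). y = u \<otimes>\<^bsub>H.T\<^esub> x)"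
proof -
  have x: "x \<in> Units H.T" "left_ideal_of B R I" "H.ext I = H.ext R #>\<^bsub>H.T\<^esub> x" using I by (auto simp: generated_by_def)
  then have xc: "x \<in> carrier H.T" "inv\<^bsub>H.T\<^esub> x \<in> carrier H.T" by auto
  have self: "y \<in> H.ext R #>\<^bsub>H.T\<^esub> y" if "y \<in> carrier H.T" for y
    using that extR_one unfolding r_coset_def by force
  show ?thesis
  proof
    assume "generated_by I y"
    then have y: "y \<in> Units H.T" "H.ext I = H.ext R #>\<^bsub>H.T\<^esub> y" by (auto simp: generated_by_def)
    then have yc: "y \<in> carrier H.T" "inv\<^bsub>H.T\<^esub> y \<in> carrier H.T" by auto
    have "y \<in> H.ext R #>\<^bsub>H.T\<^esub> x" "x \<in> H.ext R #>\<^bsub>H.T\<^esub> y" using self xc yc x(3) y(2) by auto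
    then have in_R: "y \<otimes>\<^bsub>H.T\<^esub> inv\<^bsub>H.T\<^esub> x \<in> H.ext R" "x \<otimes>\<^bsub>H.T\<^esub> inv\<^bsub>H.T\<^esub> y \<in> H.ext R"
      using H.T.r_coset_unit_iff[OF x(1) extR_closed] H.T.r_coset_unit_iff[OF y(1) extR_closed] by auto
    have "(x \<otimes>\<^bsub>H.T\<^esub> inv\<^bsub>H.T\<^esub> y) \<otimes>\<^bsub>H.T\<^esub> (y \<otimes>\<^bsub>H.T\<^esub> inv\<^bsub>H.T\<^esub> x) = x \<otimes>\<^bsub>H.T\<^esub> (inv\<^bsub>H.T\<^esub> y \<otimes>\<^bsub>H.T\<^esub> y) \<otimes>\<^bsub>H.T\<^esub> inv\<^bsub>H.T\<^esub> x"
      using xc yc by (simp add: H.T.m_assoc)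
    then have e1: "(x \<otimes>\<^bsub>H.T\<^esub> inv\<^bsub>H.T\<^esub> y) \<otimes>\<^bsub>H.T\<^esub> (y \<otimes>\<^bsub>H.T\<^esub> inv\<^bsub>H.T\<^esub> x) = \<one>\<^bsub>H.T\<^esub>"
      using x(1) y(1) xc by (simp add: H.T.Units_l_inv H.T.Units_r_inv)
    have "(y \<otimes>\<^bsub>H.T\<^esub> inv\<^bsub>H.T\<^esub> x) \<otimes>\<^bsub>H.T\<^esub> (x \<otimes>\<^bsub>H.T\<^esub> inv\<^bsub>H.T\<^esub> y) = y \<otimes>\<^bsub>H.T\<^esub> (inv\<^bsub>H.T\<^esub> x \<otimes>\<^bsub>H.T\<^esub> x) \<otimes>\<^bsub>H.T\<^esub> inv\<^bsub>H.T\<^esub> y"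
      using xc yc by (simp add: H.T.m_assoc)
    then have e2: "(y \<otimes>\<^bsub>H.T\<^esub> inv\<^bsub>H.T\<^esub> x) \<otimes>\<^bsub>H.T\<^esub> (x \<otimes>\<^bsub>H.T\<^esub> inv\<^bsub>H.T\<^esub> y) = \<one>\<^bsub>H.T\<^esub>"
      using x(1) y(1) yc by (simp add: H.T.Units_l_inv H.T.Units_r_inv)
    have "y \<otimes>\<^bsub>H.T\<^esub> inv\<^bsub>H.T\<^esub> x \<in> Units (H.T \<lparr>carrier := H.ext R\<rparr>)"
      unfolding Units_def using in_R e1 e2 by auto
    moreover have "y = (y \<otimes>\<^bsub>H.T\<^esub> inv\<^bsub>H.T\<^esub> x) \<otimes>\<^bsub>H.T\<^esub> x"
      using xc yc x(1) by (simp add: H.T.m_assoc H.T.Units_l_inv)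
    ultimately show "\<exists>u\<in>Units (H.T \<lparr>carrier := H.ext R\<rparr>). y = u \<otimes>\<^bsub>H.T\<^esub> x" by blast
  next
    assume "\<exists>u\<in>Units (H.T \<lparr>carrier := H.ext R\<rparr>). y = u \<otimes>\<^bsub>H.T\<^esub> x"
    then obtain u v where u: "u \<in> H.ext R" "v \<in> H.ext R" "v \<otimes>\<^bsub>H.T\<^esub> u = \<one>\<^bsub>H.T\<^esub>" "u \<otimes>\<^bsub>H.T\<^esub> v = \<one>\<^bsub>H.T\<^esub>"
      and y: "y = u \<otimes>\<^bsub>H.T\<^esub> x" unfolding Units_def by auto
    have uc: "u \<in> carrier H.T" "v \<in> carrier H.T" using u extR_closed by auto
    then have "u \<in> Units H.T" unfolding Units_def using u by blast
    then have "y \<in> Units H.T" using y x(1) by simp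
    moreover have "H.ext R #>\<^bsub>H.T\<^esub> u = H.ext R"
    proof
      show "H.ext R #>\<^bsub>H.T\<^esub> u \<subseteq> H.ext R" unfolding r_coset_def using extR_mult u by blast
      show "H.ext R \<subseteq> H.ext R #>\<^bsub>H.T\<^esub> u"
      proof
        fix r assume r: "r \<in> H.ext R"
        then have "r = (r \<otimes>\<^bsub>H.T\<^esub> v) \<otimes>\<^bsub>H.T\<^esub> u" using uc u(3) extR_closed by (simp add: H.T.m_assoc subset_iff)
        then show "r \<in> H.ext R #>\<^bsub>H.T\<^esub> u" unfolding r_coset_def using extR_mult[OF r u(2)] by blast
      qed
    qed
    then have "H.ext R #>\<^bsub>H.T\<^esub> y = H.ext R #>\<^bsub>H.T\<^esub> x"
      unfolding y using H.T.r_coset_r_coset[OF extR_closed uc(1) xc(1)] by simp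
    ultimately show "generated_by I y" using x by (simp add: generated_by_def)
  qed
qed

lemma generated_by_r_coset:
  assumes I: "generated_by I x" and \<alpha>: "\<alpha> \<in> Units B"
  shows "generated_by (I #> \<alpha>) (x \<otimes>\<^bsub>H.T\<^esub> H.emb \<alpha>)"
proof -
  have x: "x \<in> Units H.T" "left_ideal_of B R I" "H.ext I = H.ext R #>\<^bsub>H.T\<^esub> x" using I by (auto simp: generated_by_def)
  have IL: "is_lattice B I" by (rule left_ideal_lattice[OF x(2)])
  have \<alpha>c: "\<alpha> \<in> carrier B" using \<alpha> by auto
  have "H.ext (I #> \<alpha>) = H.ext R #>\<^bsub>H.T\<^esub> (x \<otimes>\<^bsub>H.T\<^esub> H.emb \<alpha>)"
    unfolding H.ext_r_coset[OF lattice_subset[OF IL] \<alpha>c] x(3)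
    using x(1) \<alpha>c by (intro H.T.r_coset_r_coset extR_closed) auto
  moreover have "x \<otimes>\<^bsub>H.T\<^esub> H.emb \<alpha> \<in> Units H.T"
    by (intro H.T.Units_m_closed x ring_hom_Units(1)[OF ring_axioms H.T.ring_axioms H.emb_hom \<alpha>])
  moreover have "left_ideal_of B R (I #> \<alpha>)"
    unfolding left_ideal_of_def
  proof (intro conjI allI impI lattice_r_coset IL \<alpha>)
    fix l :: nat assume l: "prime l"
    then interpret place B n e c l by (rule placeI)
    obtain y where y: "y \<in> Units L.T" "L.ext I = L.ext R #>\<^bsub>L.T\<^esub> y"
      using x(2) l unfolding left_ideal_of_def by blast
    show "\<exists>y\<in>Units L.T. L.ext (I #> \<alpha>) = L.ext R #>\<^bsub>L.T\<^esub> y"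
    proof
      show "y \<otimes>\<^bsub>L.T\<^esub> L.emb \<alpha> \<in> Units L.T"
        by (intro L.T.Units_m_closed y ring_hom_Units(1)[OF ring_axioms L.T.ring_axioms L.emb_hom \<alpha>])
      show "L.ext (I #> \<alpha>) = L.ext R #>\<^bsub>L.T\<^esub> (y \<otimes>\<^bsub>L.T\<^esub> L.emb \<alpha>)"
        unfolding L.ext_r_coset[OF lattice_subset[OF IL] \<alpha>c] y(2)
        using y(1) \<alpha>c by (intro L.T.r_coset_r_coset L.ext_closed R_subset) auto
    qed
  qed
  ultimately show ?thesis by (simp add: generated_by_def)
qed

text \<open>If I b lies in I, apply this to x, which is in the completion of I. Conversely, with x b
  \<open>inv x\<close> in the completed order, i b = (i \<open>inv x\<close>)(x b
  \<open>inv x\<close>) x lies in the completion of I, whose intersection with B is I.\<close>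

lemma generated_by_right_order:
  assumes I: "generated_by I x" and b: "b \<in> carrier B"
  shows "b \<in> right_order B I \<longleftrightarrow>
    H.emb b \<in> (\<lambda>r. inv\<^bsub>H.T\<^esub> x \<otimes>\<^bsub>H.T\<^esub> r \<otimes>\<^bsub>H.T\<^esub> x) ` H.ext R"
proof -
  have x: "x \<in> Units H.T" "left_ideal_of B R I" "H.ext I = H.ext R #>\<^bsub>H.T\<^esub> x" using I by (auto simp: generated_by_def)
  then have xc: "x \<in> carrier H.T" "inv\<^bsub>H.T\<^esub> x \<in> carrier H.T" by auto
  have IL: "is_lattice B I" by (rule left_ideal_lattice[OF x(2)])
  note Ic = lattice_subset[OF IL]
  let ?b = "x \<otimes>\<^bsub>H.T\<^esub> H.emb b \<otimes>\<^bsub>H.T\<^esub> inv\<^bsub>H.T\<^esub> x"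
  have bc: "H.emb b \<in> carrier H.T" using b by simp
  have memI: "t \<in> H.ext I \<longleftrightarrow> t \<in> carrier H.T \<and> t \<otimes>\<^bsub>H.T\<^esub> inv\<^bsub>H.T\<^esub> x \<in> H.ext R" for t
    unfolding x(3) by (rule H.T.r_coset_unit_iff[OF x(1) extR_closed])
  have "b \<in> right_order B I \<longleftrightarrow> ?b \<in> H.ext R"
  proof
    assume "b \<in> right_order B I"
    then have sub: "I #> b \<subseteq> I" by (simp add: right_order_def)
    have "H.ext (I #> b) \<subseteq> H.ext I"
      unfolding H.ext_def by (rule H.T.add.mono_generate) (use sub in blast)
    then have "H.ext I #>\<^bsub>H.T\<^esub> H.emb b \<subseteq> H.ext I" unfolding H.ext_r_coset[OF Ic b] .
    moreover have "x \<in> H.ext I" using x(1) xc extR_one by (simp add: memI H.T.Units_r_inv)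
    ultimately have "x \<otimes>\<^bsub>H.T\<^esub> H.emb b \<in> H.ext I" unfolding r_coset_def by blast
    then show "?b \<in> H.ext R" by (simp add: memI)
  next
    assume *: "?b \<in> H.ext R"
    have "i \<otimes> b \<in> I" if i: "i \<in> I" for i
    proof -
      have ic: "i \<in> carrier B" using i Ic by blast
      have ir: "H.emb i \<otimes>\<^bsub>H.T\<^esub> inv\<^bsub>H.T\<^esub> x \<in> H.ext R" using H.emb_in_ext[OF i] by (simp add: memI)
      have "H.emb i \<otimes>\<^bsub>H.T\<^esub> inv\<^bsub>H.T\<^esub> x \<otimes>\<^bsub>H.T\<^esub> ?b
          = H.emb i \<otimes>\<^bsub>H.T\<^esub> (inv\<^bsub>H.T\<^esub> x \<otimes>\<^bsub>H.T\<^esub> x) \<otimes>\<^bsub>H.T\<^esub> H.emb b \<otimes>\<^bsub>H.T\<^esub> inv\<^bsub>H.T\<^esub> x"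
        using ic bc xc by (simp add: H.T.m_assoc)
      also have "\<dots> = H.emb (i \<otimes> b) \<otimes>\<^bsub>H.T\<^esub> inv\<^bsub>H.T\<^esub> x"
        using ic b x(1) by (simp add: H.T.Units_l_inv H.emb_mult)
      finally have "H.emb (i \<otimes> b) \<in> H.ext I"
        using extR_mult[OF ir *] ic b by (simp add: memI)
      then show ?thesis using emb_in_ext[OF IL] ic b by simp
    qed
    then show "b \<in> right_order B I" using b unfolding right_order_def r_coset_def by blast
  qed
  also have "\<dots> \<longleftrightarrow> H.emb b \<in> (\<lambda>r. inv\<^bsub>H.T\<^esub> x \<otimes>\<^bsub>H.T\<^esub> r \<otimes>\<^bsub>H.T\<^esub> x) ` H.ext R"
  proof
    assume *: "?b \<in> H.ext R"
    have "inv\<^bsub>H.T\<^esub> x \<otimes>\<^bsub>H.T\<^esub> ?b \<otimes>\<^bsub>H.T\<^esub> x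
        = (inv\<^bsub>H.T\<^esub> x \<otimes>\<^bsub>H.T\<^esub> x) \<otimes>\<^bsub>H.T\<^esub> H.emb b \<otimes>\<^bsub>H.T\<^esub> (inv\<^bsub>H.T\<^esub> x \<otimes>\<^bsub>H.T\<^esub> x)"
      using xc bc by (simp add: H.T.m_assoc)
    also have "\<dots> = H.emb b" using x(1) bc by (simp add: H.T.Units_l_inv)
    finally show "H.emb b \<in> (\<lambda>r. inv\<^bsub>H.T\<^esub> x \<otimes>\<^bsub>H.T\<^esub> r \<otimes>\<^bsub>H.T\<^esub> x) ` H.ext R" 
      by (rule image_eqI[OF sym *])
  next
    assume "H.emb b \<in> (\<lambda>r. inv\<^bsub>H.T\<^esub> x \<otimes>\<^bsub>H.T\<^esub> r \<otimes>\<^bsub>H.T\<^esub> x) ` H.ext R"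
    then obtain r where r: "r \<in> H.ext R" "H.emb b = inv\<^bsub>H.T\<^esub> x \<otimes>\<^bsub>H.T\<^esub> r \<otimes>\<^bsub>H.T\<^esub> x" by blast
    have rc: "r \<in> carrier H.T" using r extR_closed by blast
    have "?b = (x \<otimes>\<^bsub>H.T\<^esub> inv\<^bsub>H.T\<^esub> x) \<otimes>\<^bsub>H.T\<^esub> r \<otimes>\<^bsub>H.T\<^esub> (x \<otimes>\<^bsub>H.T\<^esub> inv\<^bsub>H.T\<^esub> x)"
      unfolding r(2) using xc rc by (simp add: H.T.m_assoc)
    also have "\<dots> = r" using x(1) rc by (simp add: H.T.Units_r_inv)
    finally show "?b \<in> H.ext R" using r(1) by simp
  qed
  finally show ?thesis .
qed

end

section \<open>Quaternion algebras and quadratic fields\<close>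

lemma rat_algebra_rat_alg: "rat_algebra B \<Longrightarrow> rat_alg B"
  unfolding rat_algebra_def by (intro rat_alg.intro rat_alg_axioms.intro) auto

text \<open>Values on integers are forced and denominators can be cancelled. Consequently embeddings
  of K respect the rational scalars.\<close>

lemma (in rat_hom) rat_hom_unique:
  assumes "\<sigma> \<in> ring_hom rat_ring R"
  shows "\<sigma> q = \<rho> q"
proof -
  interpret \<sigma>: rat_hom R \<sigma> by unfold_locales (rule assms)
  obtain m k where m: "m > 0" "q * of_int m = of_int k" using rat_common_denom by blast
  have "[m] \<cdot> \<sigma> q = [m] \<cdot> \<rho> q"
    using \<sigma>.\<rho>.hom_zmult[of q m] \<rho>.hom_zmult[of q m] m by (simp add: mult.commute \<sigma>.\<rho>_of_int \<rho>_of_int)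
  then show ?thesis by (rule zmult_cancel) (use m in auto)
qed

text \<open>Were q nonzero, dividing by it would put w into the span of the remaining
  vectors.\<close>

lemma (in rat_alg) independent_zero:
  assumes "independent (rats_of B) (w # ws)" "s \<in> Span (rats_of B) ws" "rat_in B q \<otimes> w \<oplus> s = \<zero>"
  shows "q = 0 \<and> s = \<zero>"
proof -
  have w: "w \<in> carrier B" "w \<notin> Span (rats_of B) ws" and ws: "set ws \<subseteq> carrier B"
    using independent_backwards[OF assms(1)] independent_in_carrier[of "rats_of B" ws] by auto
  have s: "s \<in> carrier B" by (rule Span_closed[OF ws assms(2)])
  have "q = 0"
  proof (rule ccontr)
    assume q: "q \<noteq> 0"
    have "rat_in B q \<otimes> w = \<ominus> s"
      using assms(3) s w(1) by (metis \<rho>_closed m_closed minus_equality minus_minus)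
    then have "w = rat_in B (1 / q) \<otimes> \<ominus> s" using \<rho>_cancel[OF w(1) q] by simp
    also have "\<dots> = rat_in B (- (1 / q)) \<otimes> s \<oplus> rat_in B 0 \<otimes> s"
      using s \<rho>.hom_a_inv[of "1 / q"] by (simp add: rat_ring_minus r_minus l_minus)
    also have "\<dots> \<in> Span (rats_of B) ws" by (rule Span_linear[OF ws assms(2,2)])
    finally show False using w(2) by simp
  qed
  then show ?thesis using assms(3) s w(1) by simp
qed

section \<open>Multiplication in a quaternion algebra\<close>

locale quaternion = rat_alg B for B :: "('b, 'm) ring_scheme" (structure) +
  fixes u v :: 'b and a b :: rat
  assumes a: "a \<noteq> 0" and b: "b \<noteq> 0" and u [simp]: "u \<in> carrier B" and v [simp]: "v \<in> carrier B"
    and uu: "u \<otimes> u = rat_in B a" and vv: "v \<otimes> v = rat_in B b" and vu: "v \<otimes> u = \<ominus> (u \<otimes> v)"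
    and basis: "is_rat_basis B [\<one>, u, v, u \<otimes> v]"
begin

text \<open>Bracketed to the right so that it matches the unfolding of the span of the basis
  list.\<close>

definition quat :: "rat \<Rightarrow> rat \<Rightarrow> rat \<Rightarrow> rat \<Rightarrow> 'b" where
  "quat p q r s = rat_in B p \<oplus> (rat_in B q \<otimes> u \<oplus> (rat_in B r \<otimes> v \<oplus> rat_in B s \<otimes> (u \<otimes> v)))"

lemma quat_closed [simp]: "quat p q r s \<in> carrier B"
  by (simp add: quat_def)

lemma quat_add: "quat p q r s \<oplus> quat p' q' r' s' = quat (p + p') (q + q') (r + r') (s + s')"
  by (simp add: quat_def \<rho>_add l_distr a_ac)

lemma quat_cases:
  assumes "x \<in> carrier B"
  obtains p q r s where "x = quat p q r s"
proof -
  have "x \<in> Span (rats_of B) [\<one>, u, v, u \<otimes> v]" using basis assms by (simp add: is_rat_basis_def)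
  then show ?thesis unfolding Span_Cons_iff Span_Nil Bex_def using that by (auto simp: quat_def)
qed

lemma quat_eq_zero:
  assumes "quat p q r s = \<zero>"
  shows "p = 0 \<and> q = 0 \<and> r = 0 \<and> s = 0"
proof -
  have i: "independent (rats_of B) [\<one>, u, v, u \<otimes> v]" using basis by (simp add: is_rat_basis_def)
  note i' = independent_backwards(2)[OF i] and i'' = independent_backwards(2)[OF independent_backwards(2)[OF i]]
    and i''' = independent_backwards(2)[OF independent_backwards(2)[OF independent_backwards(2)[OF i]]]
  have S: "rat_in B s \<otimes> (u \<otimes> v) \<in> Span (rats_of B) [u \<otimes> v]"
    "rat_in B r \<otimes> v \<oplus> rat_in B s \<otimes> (u \<otimes> v) \<in> Span (rats_of B) [v, u \<otimes> v]"
    "rat_in B q \<otimes> u \<oplus> (rat_in B r \<otimes> v \<oplus> rat_in B s \<otimes> (u \<otimes> v)) \<in> Span (rats_of B) [u, v, u \<otimes> v]"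
  proof -
    show 1: "rat_in B s \<otimes> (u \<otimes> v) \<in> Span (rats_of B) [u \<otimes> v]"
      unfolding Span_Cons_iff Span_Nil by (intro exI[of _ s] bexI[of _ \<zero>]) auto
    show 2: "rat_in B r \<otimes> v \<oplus> rat_in B s \<otimes> (u \<otimes> v) \<in> Span (rats_of B) [v, u \<otimes> v]"
      using 1 Span_Cons_iff[of _ v "[u \<otimes> v]"] by blast
    show "rat_in B q \<otimes> u \<oplus> (rat_in B r \<otimes> v \<oplus> rat_in B s \<otimes> (u \<otimes> v)) \<in> Span (rats_of B) [u, v, u \<otimes> v]"
      using 2 Span_Cons_iff[of _ u "[v, u \<otimes> v]"] by blast
  qed
  have "p = 0 \<and> rat_in B q \<otimes> u \<oplus> (rat_in B r \<otimes> v \<oplus> rat_in B s \<otimes> (u \<otimes> v)) = \<zero>"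
    using independent_zero[OF i S(3), of p] assms by (simp add: quat_def)
  moreover from this have "q = 0 \<and> rat_in B r \<otimes> v \<oplus> rat_in B s \<otimes> (u \<otimes> v) = \<zero>"
    using independent_zero[OF i' S(2), of q] by simp
  moreover from this have "r = 0 \<and> rat_in B s \<otimes> (u \<otimes> v) = \<zero>"
    using independent_zero[OF i'' S(1), of r] by simp
  moreover from this have "s = 0"
    using independent_zero[OF i''', of \<zero> s] by (simp add: Span_Nil)
  ultimately show ?thesis by blast
qed

lemma quat_minus: "\<ominus> quat p q r s = quat (- p) (- q) (- r) (- s)"
  by (rule minus_equality) (simp_all add: quat_add, simp add: quat_def)

lemma quat_inj:
  "quat p q r s = quat p' q' r' s' \<longleftrightarrow> p = p' \<and> q = q' \<and> r = r' \<and> s = s'"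
proof
  assume "quat p q r s = quat p' q' r' s'"
  then have "quat (p - p') (q - q') (r - r') (s - s') = \<zero>"
    using quat_add[of p q r s "- p'" "- q'" "- r'" "- s'"] quat_minus[of p' q' r' s']
      r_neg[OF quat_closed[of p' q' r' s']] by simp
  then show "p = p' \<and> q = q' \<and> r = r' \<and> s = s'" using quat_eq_zero by force
qed simp

lemma scaled_mult:
  assumes "x \<in> carrier B" "y \<in> carrier B"
  shows "(rat_in B p \<otimes> x) \<otimes> (rat_in B q \<otimes> y) = rat_in B (p * q) \<otimes> (x \<otimes> y)"
proof -
  have "(rat_in B p \<otimes> x) \<otimes> (rat_in B q \<otimes> y) = rat_in B p \<otimes> (x \<otimes> rat_in B q) \<otimes> y"
    using assms by (simp add: m_assoc)
  also have "\<dots> = rat_in B (p * q) \<otimes> (x \<otimes> y)"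
    using assms by (simp add: \<rho>_central[OF assms(1), symmetric] \<rho>_mult m_assoc)
  finally show ?thesis .
qed

lemma unit_products:
  "u \<otimes> (u \<otimes> v) = rat_in B a \<otimes> v" "(u \<otimes> v) \<otimes> u = rat_in B (- a) \<otimes> v"
  "v \<otimes> (u \<otimes> v) = rat_in B (- b) \<otimes> u" "(u \<otimes> v) \<otimes> v = rat_in B b \<otimes> u"
  "(u \<otimes> v) \<otimes> (u \<otimes> v) = rat_in B (- (a * b))" "v \<otimes> u = rat_in B (- 1) \<otimes> (u \<otimes> v)"
proof -
  have neg: "rat_in B (- q) = \<ominus> rat_in B q" for q
    using \<rho>.hom_a_inv[of q] by (simp add: rat_ring_minus)
  show 1: "u \<otimes> (u \<otimes> v) = rat_in B a \<otimes> v" by (simp add: m_assoc[symmetric] uu)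
  have "(u \<otimes> v) \<otimes> u = u \<otimes> (\<ominus> (u \<otimes> v))" using vu by (simp add: m_assoc)
  then show "(u \<otimes> v) \<otimes> u = rat_in B (- a) \<otimes> v" using 1 by (simp add: r_minus l_minus neg)
  have "v \<otimes> (u \<otimes> v) = \<ominus> (u \<otimes> v) \<otimes> v" using vu by (simp add: m_assoc[symmetric])
  also have "\<dots> = \<ominus> (u \<otimes> rat_in B b)" using vv by (simp add: l_minus m_assoc)
  finally show 3: "v \<otimes> (u \<otimes> v) = rat_in B (- b) \<otimes> u"
    by (simp add: neg l_minus \<rho>_central)
  show "(u \<otimes> v) \<otimes> v = rat_in B b \<otimes> u" using vv by (simp add: m_assoc \<rho>_central)
  have "(u \<otimes> v) \<otimes> (u \<otimes> v) = u \<otimes> (rat_in B (- b) \<otimes> u)" using 3 by (simp add: m_assoc)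
  also have "\<dots> = rat_in B (- b) \<otimes> (u \<otimes> u)" using scaled_mult[of u u 1 "- b"] by simp
  also have "\<dots> = rat_in B (- (a * b))" unfolding uu by (simp add: \<rho>_mult[symmetric] mult.commute)
  finally show "(u \<otimes> v) \<otimes> (u \<otimes> v) = rat_in B (- (a * b))" .
  show "v \<otimes> u = rat_in B (- 1) \<otimes> (u \<otimes> v)" using vu by (simp add: neg l_minus)
qed

lemma quat_split:
  "quat p q r s = rat_in B p \<otimes> \<one> \<oplus> (rat_in B q \<otimes> u \<oplus> (rat_in B r \<otimes> v \<oplus> rat_in B s \<otimes> (u \<otimes> v)))"
  by (simp add: quat_def)

lemma scaled_quat:
  "rat_in B p \<otimes> quat p' q' r' s' = quat (p * p') (p * q') (p * r') (p * s')"
  by (simp add: quat_def r_distr \<rho>_mult m_assoc)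

lemma quat_single:
  "rat_in B p = quat p 0 0 0" "rat_in B p \<otimes> u = quat 0 p 0 0"
  "rat_in B p \<otimes> v = quat 0 0 p 0" "rat_in B p \<otimes> (u \<otimes> v) = quat 0 0 0 p"
  by (simp_all add: quat_def)

text \<open>With this table, norms and commutation become polynomial identities in the
  coordinates.\<close>

lemma quat_mult:
  "quat p q r s \<otimes> quat p' q' r' s' = quat
    (p * p' + a * q * q' + b * r * r' - a * b * s * s')
    (p * q' + q * p' - b * r * s' + b * s * r')
    (p * r' + r * p' + a * q * s' - a * s * q')
    (p * s' + s * p' + q * r' - r * q')"
proof -
  have mult: "(rat_in B t \<otimes> x) \<otimes> quat p' q' r' s' = rat_in B (t * p') \<otimes> x \<oplus> (rat_in B (t * q') \<otimes> (x \<otimes> u)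
      \<oplus> (rat_in B (t * r') \<otimes> (x \<otimes> v) \<oplus> rat_in B (t * s') \<otimes> (x \<otimes> (u \<otimes> v))))"
    if x: "x \<in> carrier B" for x t
  proof -
    have "(rat_in B t \<otimes> x) \<otimes> (rat_in B p' \<otimes> \<one>) = rat_in B (t * p') \<otimes> x"
      using scaled_mult[OF x one_closed] x by simp
    then show ?thesis
      unfolding quat_split using x by (simp add: r_distr scaled_mult del: r_one)
  qed
  have scale: "rat_in B t \<otimes> (rat_in B t' \<otimes> x) = rat_in B (t * t') \<otimes> x" if "x \<in> carrier B" for t t' x
    using that by (simp add: \<rho>_mult m_assoc)
  note scale' = scale[OF u] scale[OF v] scale[OF m_closed[OF u v]] \<rho>_mult[symmetric]
  have e: "(rat_in B p \<otimes> \<one>) \<otimes> quat p' q' r' s' = quat (p * p') (p * q') (p * r') (p * s')"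
    by (simp add: scaled_quat)
  have e1: "(rat_in B q \<otimes> u) \<otimes> quat p' q' r' s' = quat (a * q * q') (q * p') (a * q * s') (q * r')"
    unfolding mult[OF u] unfolding uu unit_products scale' unfolding quat_single(2-4) unfolding quat_single(1) quat_add
    by (simp add: mult_ac)
  have e2: "(rat_in B r \<otimes> v) \<otimes> quat p' q' r' s' = quat (b * r * r') (- b * r * s') (r * p') (- r * q')"
    unfolding mult[OF v] unfolding vv unit_products scale' unfolding quat_single(2-4) unfolding quat_single(1) quat_add
    by (simp add: mult_ac)
  have e3: "(rat_in B s \<otimes> (u \<otimes> v)) \<otimes> quat p' q' r' s' = quat (- a * b * s * s') (b * s * r') (- a * s * q') (s * p')"
    unfolding mult[OF m_closed[OF u v]] unfolding unit_products scale' unfolding quat_single(2-4) unfolding quat_single(1) quat_add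
    by (simp add: mult_ac)
  have "quat p q r s \<otimes> quat p' q' r' s' = (rat_in B p \<otimes> \<one>) \<otimes> quat p' q' r' s' \<oplus> ((rat_in B q \<otimes> u) \<otimes> quat p' q' r' s'
      \<oplus> ((rat_in B r \<otimes> v) \<otimes> quat p' q' r' s' \<oplus> (rat_in B s \<otimes> (u \<otimes> v)) \<otimes> quat p' q' r' s'))"
    unfolding quat_split[of p q r s] by (simp add: l_distr)
  then show ?thesis unfolding e e1 e2 e3 quat_add by (simp add: algebra_simps)
qed

end

context quaternion
begin

text \<open>The value 0 beyond index 3 is needed because \<open>rat_basis\<close> asks for
  additivity at every index.\<close>

definition coords :: "nat \<Rightarrow> 'b \<Rightarrow> rat" where
  "coords j x = (SOME t. \<exists>p q r s. x = quat p q r s \<and> 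
    t = (if j = 0 then p else if j = 1 then q else if j = 2 then r else if j = 3 then s else 0))"

lemma coords_quat [simp]: "coords j (quat p q r s)
    = (if j = 0 then p else if j = 1 then q else if j = 2 then r else if j = 3 then s else 0)"
  unfolding coords_def by (rule some_equality) (auto simp: quat_inj)

lemma rat_basis: "rat_basis B 4 (\<lambda>j. [\<one>, u, v, u \<otimes> v] ! j) coords"
proof
  fix j :: nat assume "j < 4"
  then have "[\<one>, u, v, u \<otimes> v] ! j \<in> set [\<one>, u, v, u \<otimes> v]" by (intro nth_mem) simp
  then show "[\<one>, u, v, u \<otimes> v] ! j \<in> carrier B" by auto
next
  fix x y j assume x: "x \<in> carrier B" and y: "y \<in> carrier B"
  obtain p q r s where "x = quat p q r s" using quat_cases[OF x] .
  moreover obtain p' q' r' s' where "y = quat p' q' r' s'" using quat_cases[OF y] .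
  ultimately show "coords j (x \<oplus> y) = coords j x + coords j y" by (simp add: quat_add)
next
  fix j k :: nat assume "j < 4" "k < 4"
  have q: "\<one> = quat 1 0 0 0" "u = quat 0 1 0 0" "v = quat 0 0 1 0" "u \<otimes> v = quat 0 0 0 1"
    by (simp_all add: quat_def)
  have "coords j \<one> = (if j = 0 then 1 else 0)"
    using coords_quat[of j 1 0 0 0] by (simp add: q(1)[symmetric])
  moreover have "coords j u = (if j = 1 then 1 else 0)"
    using coords_quat[of j 0 1 0 0] by (simp add: q(2)[symmetric])
  moreover have "coords j v = (if j = 2 then 1 else 0)"
    using coords_quat[of j 0 0 1 0] by (simp add: q(3)[symmetric])
  moreover have "coords j (u \<otimes> v) = (if j = 3 then 1 else 0)"
    using coords_quat[of j 0 0 0 1] by (simp add: q(4)[symmetric])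
  ultimately show "coords j ([\<one>, u, v, u \<otimes> v] ! k) = (if j = k then 1 else 0)"
    using \<open>j < 4\<close> \<open>k < 4\<close> by (auto simp: numeral_eq_Suc less_Suc_eq)
next
  fix x assume x: "x \<in> carrier B"
  obtain p q r s where xq: "x = quat p q r s" using quat_cases[OF x] .
  have "{..<4} = {0, 1, 2, 3::nat}" by auto
  then have "(\<Oplus>j\<in>{..<4}. rat_in B (coords j x) \<otimes> [\<one>, u, v, u \<otimes> v] ! j)
      = rat_in B (coords 0 x) \<oplus> (rat_in B (coords 1 x) \<otimes> u
        \<oplus> (rat_in B (coords 2 x) \<otimes> v \<oplus> rat_in B (coords 3 x) \<otimes> (u \<otimes> v)))"
    by (simp add: numeral_eq_Suc)
  also have "\<dots> = x" unfolding xq by simp (simp add: quat_def)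
  finally show "x = (\<Oplus>j\<in>{..<4}. rat_in B (coords j x) \<otimes> [\<one>, u, v, u \<otimes> v] ! j)" ..
qed

text \<open>The rational number on the right is the reduced norm.\<close>

lemma quat_conj_mult:
  "quat p q r s \<otimes> quat p (- q) (- r) (- s) = rat_in B (p * p - a * q * q - b * r * r + a * b * s * s)"
  "quat p (- q) (- r) (- s) \<otimes> quat p q r s = rat_in B (p * p - a * q * q - b * r * r + a * b * s * s)"
  unfolding quat_mult quat_single(1) quat_inj by (simp_all add: algebra_simps)

text \<open>Commuting with u kills the coordinates at v and u v, commuting with v those at u and u
  v.\<close>

lemma commutes_with_generators:
  assumes x: "x \<in> carrier B" and "x \<otimes> u = u \<otimes> x" "x \<otimes> v = v \<otimes> x"
  shows "x \<in> rats_of B"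
proof -
  obtain p q r s where x: "x = quat p q r s" using quat_cases[OF x] .
  have uq: "u = quat 0 1 0 0" and vq: "v = quat 0 0 1 0" by (simp_all add: quat_def)
  have "x \<otimes> quat 0 1 0 0 = quat 0 1 0 0 \<otimes> x" "x \<otimes> quat 0 0 1 0 = quat 0 0 1 0 \<otimes> x"
    using assms(2,3) by (simp_all add: uq[symmetric] vq[symmetric])
  then have "q = 0" "r = 0" "s = 0" unfolding x quat_mult quat_inj using a b by simp_all
  then show ?thesis unfolding x by (auto simp: rats_of_def quat_single(1)[symmetric])
qed

text \<open>The commutator is governed by the cross product of the parts without constant term. If
  it vanishes, these parts are parallel, and that of y is nonzero as y is irrational.\<close>

lemma commutes_imp_in_span:
  assumes x: "x \<in> carrier B" and y: "y \<in> carrier B" "y \<notin> rats_of B" and xy: "x \<otimes> y = y \<otimes> x"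
  shows "\<exists>p q. x = rat_in B p \<oplus> rat_in B q \<otimes> y"
proof -
  obtain x0 x1 x2 x3 where x: "x = quat x0 x1 x2 x3" using quat_cases[OF x] .
  obtain y0 y1 y2 y3 where yq: "y = quat y0 y1 y2 y3" using quat_cases[OF y(1)] .
  have c: "x2 * y3 = x3 * y2" "x1 * y3 = x3 * y1" "x1 * y2 = x2 * y1"
    using xy a b unfolding x yq quat_mult quat_inj by (simp_all add: algebra_simps)
  have "\<exists>t. x1 = t * y1 \<and> x2 = t * y2 \<and> x3 = t * y3"
  proof -
    have "y1 \<noteq> 0 \<or> y2 \<noteq> 0 \<or> y3 \<noteq> 0"
      using y(2) unfolding yq by (auto simp: rats_of_def quat_single(1)[symmetric])
    then show ?thesis
    proof (elim disjE)
      assume "y1 \<noteq> 0" then show ?thesis using c by (intro exI[of _ "x1 / y1"]) (simp add: field_simps)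
    next
      assume "y2 \<noteq> 0" then show ?thesis using c by (intro exI[of _ "x2 / y2"]) (simp add: field_simps)
    next
      assume "y3 \<noteq> 0" then show ?thesis using c by (intro exI[of _ "x3 / y3"]) (simp add: field_simps)
    qed
  qed
  then obtain t where "x1 = t * y1" "x2 = t * y2" "x3 = t * y3" by blast
  then have "x = rat_in B (x0 - t * y0) \<oplus> rat_in B t \<otimes> y"
    unfolding x yq scaled_quat unfolding quat_single(1) quat_add by simp
  then show ?thesis by blast
qed

end

section \<open>Definite quaternion algebras are division algebras\<close>

lemma real_ring_simps [simp]:
  "carrier real_ring = UNIV" "p \<otimes>\<^bsub>real_ring\<^esub> q = p * q" "p \<oplus>\<^bsub>real_ring\<^esub> q = p + q"
  "\<one>\<^bsub>real_ring\<^esub> = 1" "\<zero>\<^bsub>real_ring\<^esub> = 0"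
  by (simp_all add: real_ring_def)

lemma ring_real_ring: "ring real_ring"
proof (rule ringI)
  show "abelian_group real_ring"
    by (rule abelian_groupI) (auto intro!: exI[of _ "- _"])
  show "monoid real_ring" by (rule monoidI) auto
qed (auto simp: algebra_simps)

locale definite_quaternion = quaternion +
  assumes definite: "Units (tensor_ring B real_ring)
    = carrier (tensor_ring B real_ring) - {\<zero>\<^bsub>tensor_ring B real_ring\<^esub>}"
begin

sublocale RB: ring_pair B real_ring
  by (intro ring_pair.intro ring_axioms ring_real_ring)

text \<open>Each rational coordinate extends to a real-valued map on the tensor product, so the
  coordinates of x can be recovered there.\<close>

lemma real_pure_eq_zero:
  assumes x: "x \<in> carrier B" and zero: "pure_tensor B real_ring x 1 = \<zero>\<^bsub>tensor_ring B real_ring\<^esub>"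
  shows "x = \<zero>"
proof -
  interpret rb: rat_basis B 4 "\<lambda>j. [\<one>, u, v, u \<otimes> v] ! j" coords by (rule rat_basis)
  have "coords j x = 0" for j
  proof -
    have "\<exists>\<phi>. abelian_group_hom (tensor_ring B real_ring) real_ring \<phi> \<and>
        (\<forall>y\<in>carrier B. \<forall>t\<in>carrier real_ring. \<phi> (pure_tensor B real_ring y t) = of_rat (coords j y) * t)"
      using ring.is_abelian_group[OF ring_real_ring]
      by (rule RB.tensor_lift) (auto simp: rb.c_add of_rat_add algebra_simps)
    then obtain \<phi> where \<phi>: "abelian_group_hom (tensor_ring B real_ring) real_ring \<phi>"
      "\<phi> (pure_tensor B real_ring x 1) = of_rat (coords j x)" using x by auto
    then show ?thesis using abelian_group_hom.hom_zero[OF \<phi>(1)] zero by simp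
  qed
  moreover obtain p q r s where "x = quat p q r s" using quat_cases[OF x] .
  ultimately show ?thesis using coords_quat[of 0 p q r s] coords_quat[of 1 p q r s] coords_quat[of 2 p q r s]
      coords_quat[of 3 p q r s] by (simp add: quat_def)
qed

text \<open>If the norm of x vanished, the conjugate of x would be killed by the image of x in the
  real extension, which is a unit there; then the conjugate and with it x would be 0. With nonzero
  norm, the conjugate divided by the norm is the inverse.\<close>

lemma nonzero_Units:
  assumes x: "x \<in> carrier B" "x \<noteq> \<zero>"
  shows "x \<in> Units B"
proof -
  obtain p q r s where xq: "x = quat p q r s" using quat_cases[OF x(1)] .
  define y where "y = quat p (- q) (- r) (- s)"
  define N where "N = p * p - a * q * q - b * r * r + a * b * s * s"
  have yc: "y \<in> carrier B" by (simp add: y_def)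
  have xy: "x \<otimes> y = rat_in B N" "y \<otimes> x = rat_in B N"
    unfolding xq y_def N_def by (rule quat_conj_mult)+
  have "N \<noteq> 0"
  proof
    assume N: "N = 0"
    let ?\<epsilon> = "\<lambda>x. pure_tensor B real_ring x 1"
    have "?\<epsilon> x \<in> Units (tensor_ring B real_ring)"
      unfolding definite using real_pure_eq_zero x by auto
    then obtain z where z: "z \<in> carrier (tensor_ring B real_ring)"
      "z \<otimes>\<^bsub>tensor_ring B real_ring\<^esub> ?\<epsilon> x = \<one>\<^bsub>tensor_ring B real_ring\<^esub>"
      unfolding Units_def by blast
    have e: "?\<epsilon> x \<in> carrier (tensor_ring B real_ring)" "?\<epsilon> y \<in> carrier (tensor_ring B real_ring)"
      using x yc by simp_all
    have "?\<epsilon> x \<otimes>\<^bsub>tensor_ring B real_ring\<^esub> ?\<epsilon> y = ?\<epsilon> \<zero>"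
      using x yc xy(1) N by (simp add: RB.pure_mult)
    also have "\<dots> = \<zero>\<^bsub>tensor_ring B real_ring\<^esub>"
      using abelian_group_hom.hom_zero[OF RB.pure_left_hom[of 1]] by simp
    finally have "?\<epsilon> x \<otimes>\<^bsub>tensor_ring B real_ring\<^esub> ?\<epsilon> y = \<zero>\<^bsub>tensor_ring B real_ring\<^esub>" .
    then have "?\<epsilon> y = \<zero>\<^bsub>tensor_ring B real_ring\<^esub>"
      using z e RB.T.m_assoc[OF z(1) e] by simp
    then have "y = \<zero>" using yc real_pure_eq_zero by blast
    then have "p = 0 \<and> q = 0 \<and> r = 0 \<and> s = 0" using quat_eq_zero unfolding y_def by fastforce
    then show False using x(2) xq by (simp add: quat_def)
  qed
  then have inv: "x \<otimes> (rat_in B (1 / N) \<otimes> y) = \<one>" "(rat_in B (1 / N) \<otimes> y) \<otimes> x = \<one>"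
  proof -
    assume N: "N \<noteq> 0"
    have "(rat_in B (1 / N) \<otimes> y) \<otimes> x = rat_in B (1 / N) \<otimes> rat_in B N"
      using x yc xy by (simp add: m_assoc)
    then show "(rat_in B (1 / N) \<otimes> y) \<otimes> x = \<one>" using N by (simp add: \<rho>_mult[symmetric])
    have "x \<otimes> (rat_in B (1 / N) \<otimes> y) = rat_in B (1 / N) \<otimes> (x \<otimes> y)"
      using scaled_mult[OF x(1) yc, of 1 "1 / N"] x yc by simp
    then show "x \<otimes> (rat_in B (1 / N) \<otimes> y) = \<one>" using N xy by (simp add: \<rho>_mult[symmetric])
  qed
  have "rat_in B (1 / N) \<otimes> y \<in> carrier B" using yc by simp
  with inv x(1) show ?thesis unfolding Units_def by blast
qed

end

section \<open>Quadratic fields\<close>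

locale quadratic = rat_alg K + field K for K :: "('k, 'm) ring_scheme" (structure) +
  fixes s t :: 'k
  assumes quadratic_basis: "is_rat_basis K [s, t]"
begin

lemma st_closed: "s \<in> carrier K" "t \<in> carrier K"
  using quadratic_basis independent_in_carrier[of "rats_of K" "[s, t]"] by (auto simp: is_rat_basis_def)

lemma span_st: "x \<in> carrier K \<Longrightarrow> \<exists>p q. x = rat_in K p \<otimes> s \<oplus> rat_in K q \<otimes> t"
  using quadratic_basis st_closed unfolding is_rat_basis_def
  by (auto simp: set_eq_iff Span_Cons_iff Span_Nil Bex_def) (metis r_zero m_closed \<rho>_closed)

lemma independent_st:
  assumes "rat_in K p \<otimes> s \<oplus> rat_in K q \<otimes> t = \<zero>"
  shows "p = 0 \<and> q = 0"
proof -
  have i: "independent (rats_of K) [s, t]" using quadratic_basis by (simp add: is_rat_basis_def)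
  have "rat_in K q \<otimes> t \<in> Span (rats_of K) [t]"
    unfolding Span_Cons_iff Span_Nil using st_closed by (intro exI[of _ q] bexI[of _ \<zero>]) auto
  then have "p = 0 \<and> rat_in K q \<otimes> t = \<zero>" using independent_zero[OF i _ assms] by simp
  moreover from this have "q = 0"
    using independent_zero[OF independent_backwards(2)[OF i], of \<zero> q] st_closed by (simp add: Span_Nil)
  ultimately show ?thesis by simp
qed

lemma not_all_rational: "\<not> (s \<in> rats_of K \<and> t \<in> rats_of K)"
proof
  assume "s \<in> rats_of K \<and> t \<in> rats_of K"
  then obtain p q where pq: "s = rat_in K p" "t = rat_in K q" by (auto simp: rats_of_def)
  have "rat_in K (- q) \<otimes> s \<oplus> rat_in K p \<otimes> t = rat_in K (- q * p + p * q)"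
    unfolding pq by (simp only: \<rho>_mult \<rho>_add)
  then have "q = 0" "p = 0" using independent_st[of "- q" p] by auto
  then have "rat_in K 1 \<otimes> s \<oplus> rat_in K 0 \<otimes> t = \<zero>" using pq by simp
  then show False using independent_st[of 1 0] by simp
qed

text \<open>An expansion of 1 in s and t has a nonzero coefficient, so 1 can be exchanged for that
  basis vector; the other one is irrational, since otherwise s and t would both be rational.\<close>

lemma generator:
  obtains w where "w \<in> carrier K" "w \<notin> rats_of K" "\<And>x. x \<in> carrier K \<Longrightarrow> \<exists>p q. x = rat_in K p \<oplus> rat_in K q \<otimes> w"
proof -
  obtain p q where pq: "\<one> = rat_in K p \<otimes> s \<oplus> rat_in K q \<otimes> t" using span_st[OF one_closed] by blast
  \<comment> \<open>Stated for arbitrary s and t, so that a nonzero coefficient of t is handled by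
    swapping the two.\<close>
  have *: "\<exists>w. w \<in> carrier K \<and> w \<notin> rats_of K \<and> (\<forall>x\<in>carrier K. \<exists>p q. x = rat_in K p \<oplus> rat_in K q \<otimes> w)"
    if one: "\<one> = rat_in K p \<otimes> s \<oplus> rat_in K q \<otimes> t" and p: "p \<noteq> 0" and c: "s \<in> carrier K" "t \<in> carrier K"
      and span: "\<And>x. x \<in> carrier K \<Longrightarrow> \<exists>p q. x = rat_in K p \<otimes> s \<oplus> rat_in K q \<otimes> t"
      and nr: "\<not> (s \<in> rats_of K \<and> t \<in> rats_of K)" for s t p q
  proof -
    have "rat_in K p \<otimes> s = \<one> \<oplus> rat_in K (- q) \<otimes> t"
      unfolding one using c \<rho>.hom_a_inv[of q] by (simp add: rat_ring_minus l_minus a_assoc r_neg)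
    then have "rat_in K (1 / p) \<otimes> (rat_in K p \<otimes> s) = rat_in K (1 / p) \<otimes> (\<one> \<oplus> rat_in K (- q) \<otimes> t)" by simp
    then have s: "s = rat_in K (1 / p) \<oplus> rat_in K (- q / p) \<otimes> t"
      using \<rho>_cancel[OF c(1) p] c by (simp add: r_distr m_assoc[symmetric] \<rho>_mult[symmetric])
    have "\<exists>p' q'. x = rat_in K p' \<oplus> rat_in K q' \<otimes> t" if x: "x \<in> carrier K" for x
    proof -
      obtain p' q' where "x = rat_in K p' \<otimes> s \<oplus> rat_in K q' \<otimes> t" using span[OF x] by blast
      then have "x = rat_in K (p' * (1 / p)) \<oplus> rat_in K (p' * (- q / p) + q') \<otimes> t"
        unfolding s \<rho>_mult \<rho>_add using c by (simp add: r_distr l_distr m_assoc a_assoc)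
      then show ?thesis by blast
    qed
    moreover have "t \<notin> rats_of K"
    proof
      assume t: "t \<in> rats_of K"
      then obtain r where "t = rat_in K r" by (auto simp: rats_of_def)
      then have "s = rat_in K (1 / p + - q / p * r)" using s by (simp only: \<rho>_add \<rho>_mult)
      then show False using nr t by (auto simp: rats_of_def)
    qed
    ultimately show ?thesis using c by blast
  qed
  have "p \<noteq> 0 \<or> q \<noteq> 0"
  proof (rule ccontr)
    assume "\<not> (p \<noteq> 0 \<or> q \<noteq> 0)"
    then have "\<one> = \<zero>" using pq st_closed by simp
    then show False by simp
  qed
  then have "\<exists>w. w \<in> carrier K \<and> w \<notin> rats_of K \<and> (\<forall>x\<in>carrier K. \<exists>p q. x = rat_in K p \<oplus> rat_in K q \<otimes> w)"
  proof
    assume "p \<noteq> 0"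
    then show ?thesis using *[OF pq] st_closed span_st not_all_rational by blast
  next
    assume q: "q \<noteq> 0"
    have "\<one> = rat_in K q \<otimes> t \<oplus> rat_in K p \<otimes> s" using pq st_closed by (simp add: a_comm)
    moreover have "\<exists>p q. x = rat_in K p \<otimes> t \<oplus> rat_in K q \<otimes> s" if "x \<in> carrier K" for x
      using span_st[OF that] st_closed a_comm by (metis \<rho>_closed m_closed)
    ultimately show ?thesis using *[of q t p s] q st_closed not_all_rational by blast
  qed
  then show ?thesis using that by blast
qed

text \<open>Completes the square. A generator with rational square is what makes the explicit
  intertwiners of two embeddings work.\<close>

lemma sqrt_generator:
  obtains \<theta> d where "\<theta> \<in> carrier K" "\<theta> \<notin> rats_of K" "\<theta> \<otimes> \<theta> = rat_in K d"
    "\<And>x. x \<in> carrier K \<Longrightarrow> \<exists>p q. x = rat_in K p \<oplus> rat_in K q \<otimes> \<theta>"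
proof -
  obtain w where w: "w \<in> carrier K" "w \<notin> rats_of K" "\<And>x. x \<in> carrier K \<Longrightarrow> \<exists>p q. x = rat_in K p \<oplus> rat_in K q \<otimes> w"
    using generator by metis
  obtain p q where ww: "w \<otimes> w = rat_in K p \<oplus> rat_in K q \<otimes> w" using w(3)[OF m_closed[OF w(1,1)]] by blast
  \<comment> \<open>Half of the linear coefficient in w w = p + q w, so that w - h has the rational
    square p + (q/2)(q/2).\<close>
  define h where "h = rat_in K (q / 2)"
  have hc: "h \<in> carrier K" by (simp add: h_def)
  have hh: "rat_in K q = h \<oplus> h" unfolding h_def by (simp flip: \<rho>_add)
  define \<theta> where "\<theta> = w \<ominus> h"
  have c: "\<theta> \<in> carrier K" using w hc by (simp add: \<theta>_def)
  have "\<theta> \<otimes> \<theta> = w \<otimes> w \<ominus> (h \<oplus> h) \<otimes> w \<oplus> h \<otimes> h"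
    unfolding \<theta>_def using w(1) hc by algebra
  also have "\<dots> = rat_in K p \<oplus> h \<otimes> h"
    unfolding ww hh using w(1) hc \<rho>_closed[of p] by algebra
  also have "\<dots> = rat_in K (p + q / 2 * (q / 2))" unfolding h_def by (simp only: \<rho>_add \<rho>_mult)
  finally have sq: "\<theta> \<otimes> \<theta> = rat_in K (p + q / 2 * (q / 2))" .
  have w_eq: "w = \<theta> \<oplus> h" unfolding \<theta>_def using w(1) hc by (simp add: a_minus_def a_assoc l_neg)
  have "\<theta> \<notin> rats_of K"
  proof
    assume "\<theta> \<in> rats_of K"
    then obtain r where "\<theta> = rat_in K r" by (auto simp: rats_of_def)
    then have "w = rat_in K (r + q / 2)" using w_eq by (simp only: h_def \<rho>_add)
    then show False using w(2) by (auto simp: rats_of_def)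
  qed
  moreover have "\<exists>p q. x = rat_in K p \<oplus> rat_in K q \<otimes> \<theta>" if x: "x \<in> carrier K" for x
  proof -
    obtain p' q' where "x = rat_in K p' \<oplus> rat_in K q' \<otimes> w" using w(3)[OF x] by blast
    then have "x = rat_in K (p' + q' * (q / 2)) \<oplus> rat_in K q' \<otimes> \<theta>"
      unfolding w_eq \<rho>_add \<rho>_mult h_def using c by (simp add: r_distr a_ac)
    then show ?thesis by blast
  qed
  ultimately show ?thesis using that c sq by blast
qed

end

section \<open>Embeddings of the quadratic field: conjugacy and centraliser\<close>

locale quadratic_in_quaternion = definite_quaternion + K: quadratic K s t
  for K :: "('k, 'w) ring_scheme" and s t :: 'k
begin

lemma ring_embeddingD:
  assumes "\<phi> \<in> ring_embeddings K B"
  shows "\<phi> \<in> ring_hom K B" "inj_on \<phi> (carrier K)" "x \<in> carrier K \<Longrightarrow> \<phi> x \<in> carrier B"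
    "\<phi> (rat_in K q) = rat_in B q"
proof -
  show \<phi>: "\<phi> \<in> ring_hom K B" "inj_on \<phi> (carrier K)" using assms by (auto simp: ring_embeddings_def)
  then show "x \<in> carrier K \<Longrightarrow> \<phi> x \<in> carrier B" by (simp add: ring_hom_closed)
  have "(\<lambda>q. \<phi> (rat_in K q)) \<in> ring_hom rat_ring B"
    using ring_hom_trans[OF K.\<rho> \<phi>(1)] by (simp add: comp_def)
  then show "\<phi> (rat_in K q) = rat_in B q" by (rule rat_hom_unique)
qed

lemma ring_embedding_linear:
  assumes "\<phi> \<in> ring_embeddings K B" "\<theta> \<in> carrier K"
  shows "\<phi> (rat_in K p \<oplus>\<^bsub>K\<^esub> rat_in K q \<otimes>\<^bsub>K\<^esub> \<theta>) = rat_in B p \<oplus> rat_in B q \<otimes> \<phi> \<theta>"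
  using assms ring_embeddingD[OF assms(1)] ring_hom_add[OF ring_embeddingD(1)[OF assms(1)]]
    ring_hom_mult[OF ring_embeddingD(1)[OF assms(1)]] by simp

lemma ring_embedding_irrational:
  assumes "\<phi> \<in> ring_embeddings K B" "\<theta> \<in> carrier K" "\<theta> \<notin> rats_of K"
  shows "\<phi> \<theta> \<notin> rats_of B"
proof
  assume "\<phi> \<theta> \<in> rats_of B"
  then obtain q where "\<phi> \<theta> = \<phi> (rat_in K q)" using ring_embeddingD(4)[OF assms(1)] by (auto simp: rats_of_def)
  then have "\<theta> = rat_in K q" using ring_embeddingD(2)[OF assms(1)] assms(2) by (auto dest: inj_onD)
  then show False using assms(3) by (auto simp: rats_of_def)
qed

text \<open>If \<open>p\<close> and \<open>q\<close> have the same rational square, then p x + x q intertwines them for every x;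
  these elements do not all vanish, since otherwise p = - q would be central.\<close>

lemma skolem_noether:
  assumes \<psi>: "\<psi> \<in> ring_embeddings K B" and \<phi>: "\<phi> \<in> ring_embeddings K B"
  shows "\<exists>\<alpha>\<in>Units B. \<forall>k\<in>carrier K. \<psi> k \<otimes> \<alpha> = \<alpha> \<otimes> \<phi> k"
proof -
  obtain \<theta> d where \<theta>: "\<theta> \<in> carrier K" "\<theta> \<notin> rats_of K" "\<theta> \<otimes>\<^bsub>K\<^esub> \<theta> = rat_in K d"
    and gen: "\<And>x. x \<in> carrier K \<Longrightarrow> \<exists>p q. x = rat_in K p \<oplus>\<^bsub>K\<^esub> rat_in K q \<otimes>\<^bsub>K\<^esub> \<theta>"
    using K.sqrt_generator by metis
  define p q where "p = \<psi> \<theta>" and "q = \<phi> \<theta>"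
  have c: "p \<in> carrier B" "q \<in> carrier B" using ring_embeddingD(3) \<psi> \<phi> \<theta>(1) by (auto simp: p_def q_def)
  have pp: "p \<otimes> p = rat_in B d"
    using ring_hom_mult[OF ring_embeddingD(1)[OF \<psi>] \<theta>(1,1)] ring_embeddingD(4)[OF \<psi>, of d] \<theta>(3) by (simp add: p_def)
  have qq: "q \<otimes> q = rat_in B d"
    using ring_hom_mult[OF ring_embeddingD(1)[OF \<phi>] \<theta>(1,1)] ring_embeddingD(4)[OF \<phi>, of d] \<theta>(3) by (simp add: q_def)
  have intertwine: "p \<otimes> (p \<otimes> x \<oplus> x \<otimes> q) = (p \<otimes> x \<oplus> x \<otimes> q) \<otimes> q" if x: "x \<in> carrier B" for x
  proof -
    have "p \<otimes> (p \<otimes> x \<oplus> x \<otimes> q) = (p \<otimes> p) \<otimes> x \<oplus> p \<otimes> x \<otimes> q"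
      using c x by (simp add: r_distr m_assoc)
    also have "(p \<otimes> p) \<otimes> x = x \<otimes> (q \<otimes> q)" unfolding pp qq using \<rho>_central[OF x] .
    also have "x \<otimes> (q \<otimes> q) \<oplus> p \<otimes> x \<otimes> q = (p \<otimes> x \<oplus> x \<otimes> q) \<otimes> q"
      using c x by (simp add: l_distr m_assoc a_comm)
    finally show ?thesis .
  qed
  have "\<exists>x\<in>carrier B. p \<otimes> x \<oplus> x \<otimes> q \<noteq> \<zero>"
  proof (rule ccontr)
    assume "\<not> (\<exists>x\<in>carrier B. p \<otimes> x \<oplus> x \<otimes> q \<noteq> \<zero>)"
    then have all: "p \<otimes> x \<oplus> x \<otimes> q = \<zero>" if "x \<in> carrier B" for x using that by blast
    have "p \<oplus> q = \<zero>" using all[OF one_closed] c by simp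
    then have q: "q = \<ominus> p" using c minus_equality[of q p] by (simp add: a_comm)
    have comm: "p \<otimes> x = x \<otimes> p" if x: "x \<in> carrier B" for x
    proof (rule diff_eq_zero)
      show "p \<otimes> x \<ominus> x \<otimes> p = \<zero>" using all[OF x] c(1) x unfolding q a_minus_def by (simp add: r_minus)
    qed (use c(1) x in auto)
    have "p \<in> rats_of B" by (rule commutes_with_generators) (use c comm in auto)
    then show False using ring_embedding_irrational[OF \<psi> \<theta>(1,2)] by (simp add: p_def)
  qed
  then obtain x where x: "x \<in> carrier B" "p \<otimes> x \<oplus> x \<otimes> q \<noteq> \<zero>" by blast
  define \<alpha> where "\<alpha> = p \<otimes> x \<oplus> x \<otimes> q"
  have \<alpha>c: "\<alpha> \<in> carrier B" using x c by (simp add: \<alpha>_def)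
  have "\<alpha> \<in> Units B" using x by (intro nonzero_Units \<alpha>c) (simp add: \<alpha>_def)
  moreover have "\<psi> k \<otimes> \<alpha> = \<alpha> \<otimes> \<phi> k" if k: "k \<in> carrier K" for k
  proof -
    obtain y z where kyz: "k = rat_in K y \<oplus>\<^bsub>K\<^esub> rat_in K z \<otimes>\<^bsub>K\<^esub> \<theta>" using gen[OF k] by blast
    have "\<psi> k \<otimes> \<alpha> = rat_in B y \<otimes> \<alpha> \<oplus> rat_in B z \<otimes> (p \<otimes> \<alpha>)"
      unfolding kyz ring_embedding_linear[OF \<psi> \<theta>(1)] p_def[symmetric] using c \<alpha>c by (simp add: l_distr m_assoc)
    also have "p \<otimes> \<alpha> = \<alpha> \<otimes> q" unfolding \<alpha>_def by (rule intertwine[OF x(1)])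
    also have "rat_in B y \<otimes> \<alpha> = \<alpha> \<otimes> rat_in B y" by (rule \<rho>_central[OF \<alpha>c])
    also have "rat_in B z \<otimes> (\<alpha> \<otimes> q) = \<alpha> \<otimes> (rat_in B z \<otimes> q)"
      using scaled_mult[OF \<alpha>c c(2), of 1 z] c \<alpha>c by simp
    also have "\<alpha> \<otimes> rat_in B y \<oplus> \<alpha> \<otimes> (rat_in B z \<otimes> q) = \<alpha> \<otimes> \<phi> k"
      unfolding kyz ring_embedding_linear[OF \<phi> \<theta>(1)] q_def[symmetric] using c \<alpha>c by (simp add: r_distr)
    finally show ?thesis .
  qed
  ultimately show ?thesis by blast
qed

text \<open>An element commuting with the irrational image of a generator is a rational combination
  of 1 and that image, hence comes from K. It is nonzero since \<alpha> is invertible, and K is a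
  field.\<close>

lemma centralizer:
  assumes \<phi>: "\<phi> \<in> ring_embeddings K B" and \<alpha>: "\<alpha> \<in> Units B"
    and comm: "\<And>k. k \<in> carrier K \<Longrightarrow> \<alpha> \<otimes> \<phi> k = \<phi> k \<otimes> \<alpha>"
  shows "\<exists>k\<in>Units K. \<alpha> = \<phi> k"
proof -
  obtain \<theta> d where \<theta>: "\<theta> \<in> carrier K" "\<theta> \<notin> rats_of K" "\<theta> \<otimes>\<^bsub>K\<^esub> \<theta> = rat_in K d"
    using K.sqrt_generator by metis
  have \<alpha>c: "\<alpha> \<in> carrier B" using \<alpha> by auto
  obtain p q where "\<alpha> = rat_in B p \<oplus> rat_in B q \<otimes> \<phi> \<theta>"
    using commutes_imp_in_span[OF \<alpha>c ring_embeddingD(3)[OF \<phi> \<theta>(1)] ring_embedding_irrational[OF \<phi> \<theta>(1,2)] comm[OF \<theta>(1)]]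
    by blast
  then have k: "\<alpha> = \<phi> (rat_in K p \<oplus>\<^bsub>K\<^esub> rat_in K q \<otimes>\<^bsub>K\<^esub> \<theta>)" using ring_embedding_linear[OF \<phi> \<theta>(1)] by simp
  let ?k = "rat_in K p \<oplus>\<^bsub>K\<^esub> rat_in K q \<otimes>\<^bsub>K\<^esub> \<theta>"
  have kc: "?k \<in> carrier K" using \<theta>(1) by simp
  have "?k \<noteq> \<zero>\<^bsub>K\<^esub>"
  proof
    assume "?k = \<zero>\<^bsub>K\<^esub>"
    then have "\<alpha> = \<zero>" using k ring_hom_zero[OF ring_embeddingD(1)[OF \<phi>] K.ring_axioms ring_axioms] by simp
    then have "\<one> = \<zero>" using Units_l_inv[OF \<alpha>] Units_inv_closed[OF \<alpha>] by simp
    then show False using quat_eq_zero[of 1 0 0 0] by (simp add: quat_def)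
  qed
  then have "?k \<in> Units K" using kc K.field_Units by blast
  then show ?thesis using k by blast
qed

end

section \<open>Special points\<close>

locale special_points_setup = quadratic_in_quaternion B u v a b K s t
  for B :: "('b, 'm) ring_scheme" (structure) and u v a b and K :: "('k, 'w) ring_scheme" and s t +
  fixes R :: "'b set" and i :: "'k \<Rightarrow> 'b" and S :: "'k set"
  assumes R: "is_order B R" and i: "i \<in> ring_embeddings K B" and S: "S \<subseteq> carrier K"
begin

sublocale Ord: rat_order B 4 "\<lambda>j. [\<one>, u, v, u \<otimes> v] ! j" coords R
  by (intro rat_order.intro rat_basis rat_order_axioms.intro R)

abbreviation "T \<equiv> scalar_ext zhat B"
abbreviation "\<iota> \<equiv> scalar_ext_embed zhat B"
abbreviation "SP \<equiv> special_points B R K S"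
abbreviation "act \<equiv> point_act B K"
text \<open>Special points carry extensional embeddings, while i is arbitrary outside K.\<close>

abbreviation "i' \<equiv> restrict i (carrier K)"

lemma i_closed: "k \<in> carrier K \<Longrightarrow> i k \<in> carrier B"
  by (rule ring_embeddingD(3)[OF i])

lemma i'_embedding: "i' \<in> ring_embeddings K B \<inter> extensional (carrier K)"
proof -
  have "i' \<in> ring_hom K B"
    using ring_embeddingD(1)[OF i] by (simp add: ring_hom_def Pi_def)
  moreover have "inj_on i' (carrier K)" using ring_embeddingD(2)[OF i] by (simp add: inj_on_def)
  ultimately show ?thesis by (simp add: ring_embeddings_def)
qed

text \<open>Moves the condition on the embedding from B to a subset of K, the form in which
  \<open>adelic_order\<close> is given.\<close>

lemma image_inter_iff:
  assumes "inj_on \<psi> (carrier K)"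
  shows "X \<inter> \<psi> ` carrier K = \<psi> ` S \<longleftrightarrow> {k \<in> carrier K. \<psi> k \<in> X} = S"
proof
  assume eq: "X \<inter> \<psi> ` carrier K = \<psi> ` S"
  show "{k \<in> carrier K. \<psi> k \<in> X} = S"
  proof
    show "{k \<in> carrier K. \<psi> k \<in> X} \<subseteq> S"
    proof
      fix k assume k: "k \<in> {k \<in> carrier K. \<psi> k \<in> X}"
      then have "\<psi> k \<in> \<psi> ` S" using eq by blast
      then obtain k' where "k' \<in> S" "\<psi> k = \<psi> k'" by blast
      then show "k \<in> S" using inj_onD[OF assms, of k k'] k S by auto
    qed
    show "S \<subseteq> {k \<in> carrier K. \<psi> k \<in> X}" using eq S by blast
  qed
next
  assume "{k \<in> carrier K. \<psi> k \<in> X} = S"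
  then show "X \<inter> \<psi> ` carrier K = \<psi> ` S" by blast
qed

lemma special_iff:
  "(I, \<psi>) \<in> SP \<longleftrightarrow> left_ideal_of B R I \<and> \<psi> \<in> ring_embeddings K B \<inter> extensional (carrier K) \<and>
    {k \<in> carrier K. \<psi> k \<in> right_order B I} = S"
  unfolding special_points_def using image_inter_iff ring_embeddingD(2) by auto

lemma left_ideal_subset: "left_ideal_of B R I \<Longrightarrow> I \<subseteq> carrier B"
  using Ord.left_ideal_lattice lattice_subset by blast

lemma conj_embedding:
  assumes \<psi>: "\<psi> \<in> ring_embeddings K B" and \<alpha>: "\<alpha> \<in> Units B"
  shows "(\<lambda>k\<in>carrier K. inv \<alpha> \<otimes> \<psi> k \<otimes> \<alpha>) \<in> ring_embeddings K B \<inter> extensional (carrier K)"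
proof -
  have \<alpha>c: "\<alpha> \<in> carrier B" "inv \<alpha> \<in> carrier B" using \<alpha> by auto
  note hom = ring_embeddingD(1)[OF \<psi>] and c = ring_embeddingD(3)[OF \<psi>]
  have "(\<lambda>k\<in>carrier K. inv \<alpha> \<otimes> \<psi> k \<otimes> \<alpha>) \<in> ring_hom K B"
  proof (rule ring_hom_memI)
    fix x y assume x: "x \<in> carrier K" and y: "y \<in> carrier K"
    have "inv \<alpha> \<otimes> \<psi> x \<otimes> \<alpha> \<otimes> (inv \<alpha> \<otimes> \<psi> y \<otimes> \<alpha>) = inv \<alpha> \<otimes> \<psi> x \<otimes> (\<alpha> \<otimes> inv \<alpha>) \<otimes> \<psi> y \<otimes> \<alpha>"
      using \<alpha>c c x y by (simp add: m_assoc)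
    also have "\<dots> = inv \<alpha> \<otimes> (\<psi> x \<otimes> \<psi> y) \<otimes> \<alpha>"
      using \<alpha> \<alpha>c c x y by (simp add: m_assoc Units_r_inv)
    finally show "(\<lambda>k\<in>carrier K. inv \<alpha> \<otimes> \<psi> k \<otimes> \<alpha>) (x \<otimes>\<^bsub>K\<^esub> y)
        = (\<lambda>k\<in>carrier K. inv \<alpha> \<otimes> \<psi> k \<otimes> \<alpha>) x \<otimes> (\<lambda>k\<in>carrier K. inv \<alpha> \<otimes> \<psi> k \<otimes> \<alpha>) y"
      using x y ring_hom_mult[OF hom x y] by simp
    show "(\<lambda>k\<in>carrier K. inv \<alpha> \<otimes> \<psi> k \<otimes> \<alpha>) (x \<oplus>\<^bsub>K\<^esub> y)
        = (\<lambda>k\<in>carrier K. inv \<alpha> \<otimes> \<psi> k \<otimes> \<alpha>) x \<oplus> (\<lambda>k\<in>carrier K. inv \<alpha> \<otimes> \<psi> k \<otimes> \<alpha>) y"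
      using x y \<alpha>c c ring_hom_add[OF hom x y] by (simp add: l_distr r_distr)
    show "(\<lambda>k\<in>carrier K. inv \<alpha> \<otimes> \<psi> k \<otimes> \<alpha>) x \<in> carrier B" using x \<alpha>c c by simp
  next
    show "(\<lambda>k\<in>carrier K. inv \<alpha> \<otimes> \<psi> k \<otimes> \<alpha>) \<one>\<^bsub>K\<^esub> = \<one>"
      using \<alpha> \<alpha>c ring_hom_one[OF hom] by (simp add: Units_l_inv)
  qed
  moreover have "inj_on (\<lambda>k\<in>carrier K. inv \<alpha> \<otimes> \<psi> k \<otimes> \<alpha>) (carrier K)"
  proof (rule inj_onI)
    fix x y assume x: "x \<in> carrier K" and y: "y \<in> carrier K"
      and "(\<lambda>k\<in>carrier K. inv \<alpha> \<otimes> \<psi> k \<otimes> \<alpha>) x = (\<lambda>k\<in>carrier K. inv \<alpha> \<otimes> \<psi> k \<otimes> \<alpha>) y"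
    then have eq: "inv \<alpha> \<otimes> \<psi> x \<otimes> \<alpha> = inv \<alpha> \<otimes> \<psi> y \<otimes> \<alpha>" by simp
    have undo: "\<alpha> \<otimes> (inv \<alpha> \<otimes> \<psi> z \<otimes> \<alpha>) \<otimes> inv \<alpha> = \<psi> z" if "z \<in> carrier K" for z
    proof -
      have "\<alpha> \<otimes> (inv \<alpha> \<otimes> \<psi> z \<otimes> \<alpha>) \<otimes> inv \<alpha> = (\<alpha> \<otimes> inv \<alpha>) \<otimes> \<psi> z \<otimes> (\<alpha> \<otimes> inv \<alpha>)"
        using \<alpha>c c[OF that] by (simp add: m_assoc)
      then show ?thesis using \<alpha> c[OF that] by (simp add: Units_r_inv)
    qed
    have "\<psi> x = \<psi> y" using undo[OF x, unfolded eq] undo[OF y] by (rule trans[OF sym])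
    then show "x = y" using inj_onD[OF ring_embeddingD(2)[OF \<psi>]] x y by blast
  qed
  ultimately show ?thesis by (simp add: ring_embeddings_def)
qed

text \<open>Both sides compare I x \<alpha> with I \<alpha>, because \<alpha> times the conjugate is
  x \<alpha>, and right multiplication by \<alpha> can be cancelled.\<close>

lemma right_order_conj:
  assumes I: "I \<subseteq> carrier B" and \<alpha>: "\<alpha> \<in> Units B" and x: "x \<in> carrier B"
  shows "inv \<alpha> \<otimes> x \<otimes> \<alpha> \<in> right_order B (I #> \<alpha>) \<longleftrightarrow> x \<in> right_order B I"
proof -
  have \<alpha>c: "\<alpha> \<in> carrier B" "inv \<alpha> \<in> carrier B" using \<alpha> by auto
  have "\<alpha> \<otimes> (inv \<alpha> \<otimes> x \<otimes> \<alpha>) = (\<alpha> \<otimes> inv \<alpha>) \<otimes> x \<otimes> \<alpha>" using \<alpha>c x by (simp add: m_assoc)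
  then have "\<alpha> \<otimes> (inv \<alpha> \<otimes> x \<otimes> \<alpha>) = x \<otimes> \<alpha>" using \<alpha> x by (simp add: Units_r_inv)
  then have eq: "I #> \<alpha> #> (inv \<alpha> \<otimes> x \<otimes> \<alpha>) = I #> x #> \<alpha>"
    using I \<alpha>c x by (simp add: r_coset_r_coset)
  have Ix: "I #> x \<subseteq> carrier B" unfolding r_coset_def using I x by auto
  have cancel: "I #> x #> \<alpha> \<subseteq> I #> \<alpha> \<longleftrightarrow> I #> x \<subseteq> I"
  proof
    assume sub: "I #> x #> \<alpha> \<subseteq> I #> \<alpha>"
    show "I #> x \<subseteq> I"
    proof
      fix y assume y: "y \<in> I #> x"
      then have yc: "y \<in> carrier B" using Ix by blast
      have "y \<otimes> \<alpha> \<in> I #> \<alpha>" using y sub unfolding r_coset_def by blast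
      then have "y \<otimes> \<alpha> \<otimes> inv \<alpha> \<in> I" using r_coset_unit_iff[OF \<alpha> I] by blast
      then show "y \<in> I" using yc \<alpha> \<alpha>c by (simp add: m_assoc Units_r_inv)
    qed
  qed (auto simp: r_coset_def)
  show ?thesis unfolding right_order_def using eq cancel \<alpha>c x by simp
qed

lemma act_special:
  assumes p: "p \<in> SP" and \<alpha>: "\<alpha> \<in> Units B"
  shows "act p \<alpha> \<in> SP"
proof -
  obtain I \<psi> where p_eq: "p = (I, \<psi>)" by (cases p)
  have I: "left_ideal_of B R I" and \<psi>: "\<psi> \<in> ring_embeddings K B"
    and ord: "{k \<in> carrier K. \<psi> k \<in> right_order B I} = S" using p unfolding p_eq special_iff by auto
  \<comment> \<open>The idele of I is needed to see that the translate by \<alpha> is again a left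
    ideal.\<close>
  obtain x where "x \<in> Units T" "lattice_ext zhat B I = lattice_ext zhat B R #>\<^bsub>T\<^esub> x"
    using Ord.left_ideal_adelic_generator[OF I] by blast
  then have "Ord.generated_by I x" using I by (simp add: Ord.generated_by_def)
  then have "left_ideal_of B R (I #> \<alpha>)"
    using Ord.generated_by_r_coset[OF _ \<alpha>] by (auto simp: Ord.generated_by_def)
  moreover have "{k \<in> carrier K. (\<lambda>k\<in>carrier K. inv \<alpha> \<otimes> \<psi> k \<otimes> \<alpha>) k \<in> right_order B (I #> \<alpha>)} = S"
    using right_order_conj[OF left_ideal_subset[OF I] \<alpha>] ring_embeddingD(3)[OF \<psi>] ord by auto
  ultimately show ?thesis
    using conj_embedding[OF \<psi> \<alpha>] unfolding p_eq point_act_def fst_conv snd_conv special_iff by blast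
qed

lemma special_closed:
  assumes "p \<in> SP"
  shows "fst p \<subseteq> carrier B" "snd p \<in> extensional (carrier K)" "k \<in> carrier K \<Longrightarrow> snd p k \<in> carrier B"
  using assms left_ideal_subset ring_embeddingD(3) by (cases p; auto simp: special_iff)+

section \<open>Orbits of special points\<close>

lemma act_act:
  assumes p: "p \<in> SP" and \<alpha>: "\<alpha> \<in> Units B" and \<beta>: "\<beta> \<in> Units B"
  shows "act (act p \<alpha>) \<beta> = act p (\<alpha> \<otimes> \<beta>)"
proof -
  have c: "\<alpha> \<in> carrier B" "\<beta> \<in> carrier B" "inv \<alpha> \<in> carrier B" "inv \<beta> \<in> carrier B" using \<alpha> \<beta> by auto
  have "\<alpha> \<otimes> \<beta> \<otimes> (inv \<beta> \<otimes> inv \<alpha>) = \<alpha> \<otimes> (\<beta> \<otimes> inv \<beta>) \<otimes> inv \<alpha>"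
    "inv \<beta> \<otimes> inv \<alpha> \<otimes> (\<alpha> \<otimes> \<beta>) = inv \<beta> \<otimes> (inv \<alpha> \<otimes> \<alpha>) \<otimes> \<beta>"
    using c by (simp_all add: m_assoc)
  then have inv_eq: "inv \<beta> \<otimes> inv \<alpha> = inv (\<alpha> \<otimes> \<beta>)"
    using \<alpha> \<beta> c by (intro inv_unique') (simp_all add: Units_r_inv Units_l_inv)
  show ?thesis unfolding point_act_def
    using c special_closed[OF p] by (auto simp: r_coset_r_coset m_assoc inv_eq[symmetric] intro!: restrict_ext)
qed

lemma act_one:
  assumes p: "p \<in> SP"
  shows "act p \<one> = p"
proof -
  have "fst p #> \<one> = fst p"
    using r_coset_unit_iff[OF Units_one_closed special_closed(1)[OF p]] special_closed(1)[OF p] by auto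
  moreover have "(\<lambda>k\<in>carrier K. inv \<one> \<otimes> snd p k \<otimes> \<one>) = snd p"
    using special_closed(2,3)[OF p] by (auto simp: fun_eq_iff extensional_def)
  ultimately show ?thesis unfolding point_act_def by simp
qed

lemma orbit_eq:
  assumes p: "p \<in> SP" and q: "q \<in> act p ` Units B"
  shows "act q ` Units B = act p ` Units B"
proof -
  obtain \<alpha> where \<alpha>: "\<alpha> \<in> Units B" "q = act p \<alpha>" using q by blast
  show ?thesis
  proof
    show "act q ` Units B \<subseteq> act p ` Units B"
      using \<alpha> act_act[OF p \<alpha>(1)] by auto
    show "act p ` Units B \<subseteq> act q ` Units B"
    proof
      fix r assume "r \<in> act p ` Units B"
      then obtain \<beta> where \<beta>: "\<beta> \<in> Units B" "r = act p \<beta>" by blast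
      have "act q (inv \<alpha> \<otimes> \<beta>) = act p (\<alpha> \<otimes> (inv \<alpha> \<otimes> \<beta>))"
        unfolding \<alpha>(2) using \<alpha> \<beta> by (intro act_act[OF p]) auto
      also have "\<alpha> \<otimes> (inv \<alpha> \<otimes> \<beta>) = \<beta>"
        using \<alpha> \<beta> by (simp add: m_assoc[symmetric] Units_closed Units_r_inv)
      finally show "r \<in> act q ` Units B" using \<alpha> \<beta> by (metis Units_inv_Units Units_m_closed image_eqI)
    qed
  qed
qed

lemma orbit_self: "p \<in> SP \<Longrightarrow> p \<in> act p ` Units B"
  using act_one by (metis Units_one_closed image_eqI)

lemma orbit_contains_i:
  assumes p: "p \<in> SP"
  shows "\<exists>I. (I, i') \<in> act p ` Units B"
proof -
  obtain I \<psi> where p_eq: "p = (I, \<psi>)" by (cases p)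
  have \<psi>: "\<psi> \<in> ring_embeddings K B" using p unfolding p_eq special_iff by blast
  obtain \<alpha> where \<alpha>: "\<alpha> \<in> Units B" and comm: "\<And>k. k \<in> carrier K \<Longrightarrow> \<psi> k \<otimes> \<alpha> = \<alpha> \<otimes> i k"
    using skolem_noether[OF \<psi> i] by blast
  have \<alpha>c: "\<alpha> \<in> carrier B" "inv \<alpha> \<in> carrier B" using \<alpha> by auto
  have "inv \<alpha> \<otimes> \<psi> k \<otimes> \<alpha> = i k" if k: "k \<in> carrier K" for k
  proof -
    have "inv \<alpha> \<otimes> \<psi> k \<otimes> \<alpha> = inv \<alpha> \<otimes> (\<alpha> \<otimes> i k)"
      using comm[OF k] \<alpha>c ring_embeddingD(3)[OF \<psi> k] by (simp add: m_assoc)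
    then show ?thesis using \<alpha> \<alpha>c i_closed[OF k] by (simp add: m_assoc[symmetric] Units_l_inv)
  qed
  then have "act p \<alpha> = (I #> \<alpha>, i')"
    unfolding p_eq point_act_def by (auto intro!: restrict_ext)
  then show ?thesis using \<alpha> by (metis image_eqI)
qed

text \<open>The elements of K that i sends into the right order of I are exactly the order cut out
  by x, by \<open>generated_by_right_order\<close>.\<close>

lemma special_i_iff:
  assumes "Ord.generated_by I x"
  shows "(I, i') \<in> SP \<longleftrightarrow> x \<in> adelic_units_with_order B R K i S"
proof -
  have "left_ideal_of B R I" "x \<in> Units T" using assms by (auto simp: Ord.generated_by_def)
  moreover have "{k \<in> carrier K. i' k \<in> right_order B I} = adelic_order B R K i x"
    unfolding adelic_order_def using Ord.generated_by_right_order[OF assms] i_closed by auto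
  ultimately show ?thesis
    unfolding special_iff adelic_units_with_order_def using i'_embedding by auto
qed

text \<open>An \<alpha> carrying i to itself commutes with the image of K, so
  \<open>centralizer\<close> puts it in that image; the converse is commutativity of K.\<close>

lemma orbit_i_iff:
  assumes I: "(I, i') \<in> SP"
  shows "(J, i') \<in> act (I, i') ` Units B \<longleftrightarrow> (\<exists>k\<in>Units K. J = I #> i k)"
proof
  assume "(J, i') \<in> act (I, i') ` Units B"
  then obtain \<alpha> where \<alpha>: "\<alpha> \<in> Units B" and J: "J = I #> \<alpha>"
    and conj: "i' = (\<lambda>k\<in>carrier K. inv \<alpha> \<otimes> i' k \<otimes> \<alpha>)" unfolding point_act_def by auto
  have \<alpha>c: "\<alpha> \<in> carrier B" "inv \<alpha> \<in> carrier B" using \<alpha> by auto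
  have "\<alpha> \<otimes> i k = i k \<otimes> \<alpha>" if k: "k \<in> carrier K" for k
  proof -
    have "i k = inv \<alpha> \<otimes> i k \<otimes> \<alpha>" using fun_cong[OF conj, of k] k by simp
    then have "\<alpha> \<otimes> i k = \<alpha> \<otimes> (inv \<alpha> \<otimes> i k \<otimes> \<alpha>)" by (rule arg_cong)
    also have "\<dots> = (\<alpha> \<otimes> inv \<alpha>) \<otimes> i k \<otimes> \<alpha>" using \<alpha>c i_closed[OF k] by (simp add: m_assoc)
    finally show ?thesis using \<alpha> i_closed[OF k] by (simp add: Units_r_inv)
  qed
  then show "\<exists>k\<in>Units K. J = I #> i k" using centralizer[OF i \<alpha>] J by blast
next
  assume "\<exists>k\<in>Units K. J = I #> i k"
  then obtain k where k: "k \<in> Units K" and J: "J = I #> i k" by blast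
  have kc: "k \<in> carrier K" using k by auto
  have U: "i k \<in> Units B"
    by (rule ring_hom_Units(1)[OF K.ring_axioms ring_axioms ring_embeddingD(1)[OF i] k])
  have "inv (i k) \<otimes> i y \<otimes> i k = i y" if y: "y \<in> carrier K" for y
  proof -
    have "i y \<otimes> i k = i k \<otimes> i y"
      using ring_hom_mult[OF ring_embeddingD(1)[OF i]] y kc K.m_comm by metis
    then have "inv (i k) \<otimes> i y \<otimes> i k = inv (i k) \<otimes> i k \<otimes> i y"
      using U i_closed[OF y] i_closed[OF kc] m_assoc[of "inv (i k)" "i y" "i k"] m_assoc[of "inv (i k)" "i k" "i y"]
      by simp
    then show ?thesis using U i_closed[OF y] by (simp only: Units_l_inv l_one)
  qed
  then have "act (I, i') (i k) = (J, i')" unfolding point_act_def J by (auto intro!: restrict_ext)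
  then show "(J, i') \<in> act (I, i') ` Units B" using U by (metis image_eqI)
qed

section \<open>From orbits to double cosets\<close>

definition generators :: "('b set \<times> ('k \<Rightarrow> 'b)) set \<Rightarrow> _ set" where
  "generators C = {x. \<exists>I. (I, i') \<in> C \<and> Ord.generated_by I x}"

text \<open>Two freedoms make up the double coset: moving the ideal within its orbit multiplies x on
  the right by some i k, and changing the generator of a fixed ideal multiplies it on the left by a
  unit.\<close>

lemma generators_orbit:
  assumes I: "(I, i') \<in> SP" and x: "Ord.generated_by I x"
  shows "generators (act (I, i') ` Units B) = {w \<otimes>\<^bsub>T\<^esub> x \<otimes>\<^bsub>T\<^esub> \<iota> (i k) | w k.
    w \<in> Units (T \<lparr>carrier := lattice_ext zhat B R\<rparr>) \<and> k \<in> Units K}"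
proof -
  have xc: "x \<in> carrier T" using x by (auto simp: Ord.generated_by_def)
  have ik: "i k \<in> Units B" "\<iota> (i k) \<in> carrier T" if "k \<in> Units K" for k
  proof -
    show "i k \<in> Units B"
      by (rule ring_hom_Units(1)[OF K.ring_axioms ring_axioms ring_embeddingD(1)[OF i] that])
    then show "\<iota> (i k) \<in> carrier T" by auto
  qed
  have wc: "w \<in> carrier T" if "w \<in> Units (T \<lparr>carrier := lattice_ext zhat B R\<rparr>)" for w
    using that Ord.extR_closed unfolding Units_def by auto
  have unit: "Ord.generated_by (I #> i k) y \<longleftrightarrow>
    (\<exists>w\<in>Units (T \<lparr>carrier := lattice_ext zhat B R\<rparr>). y = w \<otimes>\<^bsub>T\<^esub> x \<otimes>\<^bsub>T\<^esub> \<iota> (i k))" if k: "k \<in> Units K" for k y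
    using Ord.generated_by_iff[OF Ord.generated_by_r_coset[OF x ik(1)[OF k]], of y] wc xc ik(2)[OF k]
    by (simp add: Ord.H.T.m_assoc)
  show ?thesis
  proof (rule Set.set_eqI)
    fix y
    have "y \<in> generators (act (I, i') ` Units B) \<longleftrightarrow> (\<exists>k\<in>Units K. Ord.generated_by (I #> i k) y)"
      unfolding generators_def using orbit_i_iff[OF I] by auto
    also have "\<dots> \<longleftrightarrow> (\<exists>k\<in>Units K. \<exists>w\<in>Units (T \<lparr>carrier := lattice_ext zhat B R\<rparr>). y = w \<otimes>\<^bsub>T\<^esub> x \<otimes>\<^bsub>T\<^esub> \<iota> (i k))"
      using unit by (intro bex_cong refl) simp
    finally show "y \<in> generators (act (I, i') ` Units B) \<longleftrightarrow> y \<in> {w \<otimes>\<^bsub>T\<^esub> x \<otimes>\<^bsub>T\<^esub> \<iota> (i k) | w k.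
        w \<in> Units (T \<lparr>carrier := lattice_ext zhat B R\<rparr>) \<and> k \<in> Units K}"
      by auto
  qed
qed

theorem special_point_classes_bij:
  "bij_betw generators (special_point_classes B R K S) (order_points B R K i S)"
proof -
  have norm: "\<exists>I x. (I, i') \<in> SP \<and> Ord.generated_by I x \<and> C = act (I, i') ` Units B"
    if C: "C \<in> special_point_classes B R K S" for C
  proof -
    obtain p where p: "p \<in> SP" "C = act p ` Units B" using C unfolding special_point_classes_def by blast
    obtain I where I: "(I, i') \<in> act p ` Units B" using orbit_contains_i[OF p(1)] by blast
    then have sp: "(I, i') \<in> SP" using act_special[OF p(1)] by auto
    then have "left_ideal_of B R I" by (simp add: special_iff)
    then obtain x where "Ord.generated_by I x"
      using Ord.left_ideal_adelic_generator unfolding Ord.generated_by_def by blast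
    then show ?thesis using sp orbit_eq[OF p(1) I] p(2) by blast
  qed
  show ?thesis
    unfolding bij_betw_def
  proof
    show "inj_on generators (special_point_classes B R K S)"
    proof (rule inj_onI)
      fix C C' assume "C \<in> special_point_classes B R K S" "C' \<in> special_point_classes B R K S"
        and eq: "generators C = generators C'"
      then obtain I x J y where I: "(I, i') \<in> SP" "Ord.generated_by I x" "C = act (I, i') ` Units B"
        and J: "(J, i') \<in> SP" "C' = act (J, i') ` Units B" using norm by metis
      \<comment> \<open>Equal sets share the idele x, and x determines its ideal; so the two orbits
        have a point in common and coincide.\<close>
      have "x \<in> generators C" unfolding generators_def using I orbit_self[OF I(1)] by blast
      then have "x \<in> generators C'" using eq by simp
      then obtain J' where J': "(J', i') \<in> C'" "Ord.generated_by J' x" unfolding generators_def by blast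
      then have "(I, i') \<in> act (J, i') ` Units B" using Ord.generated_by_unique[OF I(2) J'(2)] J(2) by simp
      from orbit_eq[OF J(1) this] show "C = C'" using I(3) J(2) by simp
    qed
    show "generators ` special_point_classes B R K S = order_points B R K i S"
    proof
      show "generators ` special_point_classes B R K S \<subseteq> order_points B R K i S"
      proof
        fix X assume "X \<in> generators ` special_point_classes B R K S"
        then obtain I x where I: "(I, i') \<in> SP" "Ord.generated_by I x" "X = generators (act (I, i') ` Units B)"
          using norm by blast
        then show "X \<in> order_points B R K i S"
          unfolding order_points_def using special_i_iff[OF I(2)] generators_orbit[OF I(1,2)] by blast
      qed
      show "order_points B R K i S \<subseteq> generators ` special_point_classes B R K S"
      proof
        fix X assume "X \<in> order_points B R K i S"
        then obtain x where x: "x \<in> adelic_units_with_order B R K i S"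
          "X = {w \<otimes>\<^bsub>T\<^esub> x \<otimes>\<^bsub>T\<^esub> \<iota> (i k) | w k.
             w \<in> Units (T \<lparr>carrier := lattice_ext zhat B R\<rparr>) \<and> k \<in> Units K}"
          unfolding order_points_def by blast
        have xU: "x \<in> Units T" using x(1) by (simp add: adelic_units_with_order_def)
        then obtain I where I: "Ord.generated_by I x"
          using Ord.unit_left_ideal[OF xU] unfolding Ord.generated_by_def by blast
        have sp: "(I, i') \<in> SP" using special_i_iff[OF I] x(1) by blast
        have "act (I, i') ` Units B \<in> special_point_classes B R K S"
          unfolding special_point_classes_def by (rule imageI[OF sp])
        moreover have "X = generators (act (I, i') ` Units B)" using generators_orbit[OF sp I] x(2) by simp
        ultimately show "X \<in> generators ` special_point_classes B R K S" by (rule rev_image_eqI)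
      qed
    qed
  qed
qed

end

theorem proposition1p4:
  fixes B :: "('b, 'm) ring_scheme"
    and K :: "('k, 'n) ring_scheme"
    and R :: "'b set"
    and i :: "'k \<Rightarrow> 'b"
    and \<O> :: "'k set"
    and D :: int
  assumes "definite_quaternion_algebra B"
    and "is_order B R"
    and "quadratic_field K"
    and "i \<in> ring_embeddings K B"
    and "is_order K \<O>"
    and "has_discriminant K \<O> D"
  shows "\<exists>f. bij_betw f (special_point_classes B R K \<O>) (order_points B R K i \<O>)"
proof -
  have B: "rat_algebra B"
    and definite: "Units (tensor_ring B real_ring)
      = carrier (tensor_ring B real_ring) - {\<zero>\<^bsub>tensor_ring B real_ring\<^esub>}"
    using assms(1) by (auto simp: definite_quaternion_algebra_def quaternion_algebra_def)
  have "\<exists>a b u v. a \<noteq> 0 \<and> b \<noteq> 0 \<and> u \<in> carrier B \<and> v \<in> carrier B \<and>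
      u \<otimes>\<^bsub>B\<^esub> u = rat_in B a \<and> v \<otimes>\<^bsub>B\<^esub> v = rat_in B b \<and> v \<otimes>\<^bsub>B\<^esub> u = \<ominus>\<^bsub>B\<^esub> (u \<otimes>\<^bsub>B\<^esub> v) \<and>
      is_rat_basis B [\<one>\<^bsub>B\<^esub>, u, v, u \<otimes>\<^bsub>B\<^esub> v]"
    using assms(1) unfolding definite_quaternion_algebra_def quaternion_algebra_def by meson
  then obtain a b u v where "a \<noteq> 0" "b \<noteq> 0" "u \<in> carrier B" "v \<in> carrier B"
    "u \<otimes>\<^bsub>B\<^esub> u = rat_in B a" "v \<otimes>\<^bsub>B\<^esub> v = rat_in B b" "v \<otimes>\<^bsub>B\<^esub> u = \<ominus>\<^bsub>B\<^esub> (u \<otimes>\<^bsub>B\<^esub> v)"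
    "is_rat_basis B [\<one>\<^bsub>B\<^esub>, u, v, u \<otimes>\<^bsub>B\<^esub> v]" by blast
  then have quat: "definite_quaternion B u v a b"
    using rat_algebra_rat_alg[OF B] definite
    by (intro definite_quaternion.intro quaternion.intro quaternion_axioms.intro definite_quaternion_axioms.intro)
  \<comment> \<open>The discriminant is computed on a rational basis of K with two members, and that
    basis is taken.\<close>
  obtain s t where "is_rat_basis K [s, t]"
    using assms(6) unfolding has_discriminant_def by blast
  then have quadr: "quadratic K s t"
    using assms(3) rat_algebra_rat_alg
    by (auto simp: quadratic_field_def intro!: quadratic.intro quadratic_axioms.intro)
  have "\<O> \<subseteq> carrier K" using assms(5) subringE(1) by (auto simp: is_order_def)
  then interpret special_points_setup B u v a b K s t R i \<O>
    using quat quadr assms(2,4)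
    by (intro special_points_setup.intro quadratic_in_quaternion.intro special_points_setup_axioms.intro)
  show ?thesis using special_point_classes_bij by blast
qed


end
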